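(* For each integer $k\ge 0$ let $$c_k:=\sum_{j=0}^k (-1)^j \binom{k}{j}\frac{1}{\zeta(2j+2)},$$ where $\zeta$ is the Riemann zeta function. Then the Riemann hypothesis is true if and only if, for every $\epsilon>0$, $$c_k\ll k^{-\frac34+\epsilon}.$$
   Context: The notation $c_k\ll k^{-\frac34+\epsilon}$ means that there is a constant $C_\epsilon>0$ (which may depend on $\epsilon$) such that $|c_k|\le C_\epsilon\, k^{-\frac34+\epsilon}$ for all integers $k\ge 1$. *)

theory Defs
  imports "HOL-Complex_Analysis.Complex_Analysis"
begin

text \<open>The Riemann zeta function is the analytic continuation to \<open>\<complex> - {1}\<close> of the series
  \<open>\<Sum>n\<ge>1. n\<^sup>-\<^sup>s\<close>; the value at the pole is set to 0 so that the function is unique.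
  Existence and uniqueness are proved below as \<open>ex1_is_zeta\<close>.\<close>

definition is_zeta :: "(complex \<Rightarrow> complex) \<Rightarrow> bool" where
  "is_zeta f \<longleftrightarrow> f holomorphic_on - {1} \<and>
     (\<forall>s. Re s > 1 \<longrightarrow> (\<lambda>n. 1 / of_nat (Suc n) powr s) sums f s) \<and> f 1 = 0"

definition zeta :: "complex \<Rightarrow> complex" where
  "zeta = (THE f. is_zeta f)"

text \<open>The zeros at the negative even integers are the trivial ones; 1 is excluded because the value
  there is only a convention.\<close>

definition riemann_hypothesis :: bool where
  "riemann_hypothesis \<longleftrightarrow>
     (\<forall>s. s \<noteq> 1 \<and> zeta s = 0 \<and> (\<nexists>n::nat. s = - 2 * of_nat (Suc n)) \<longrightarrow> Re s = 1 / 2)"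

definition c_seq :: "nat \<Rightarrow> complex" where
  "c_seq k = (\<Sum>j=0..k. (-1) ^ j * of_nat (k choose j) * (1 / zeta (2 * of_nat j + 2)))"

lemma holomorphic_on_suminf:
  fixes f :: "nat \<Rightarrow> complex \<Rightarrow> complex"
  assumes "open S" "\<And>n. f n holomorphic_on S"
    and "\<And>x. x \<in> S \<Longrightarrow> \<exists>d>0. cball x d \<subseteq> S \<and>
           (\<exists>h. summable h \<and> (\<forall>n. \<forall>y\<in>cball x d. norm (f n y) \<le> h n))"
  shows "(\<lambda>s. \<Sum>n. f n s) holomorphic_on S"
proof (rule holomorphic_uniform_sequence[OF assms(1)])
  show "(\<lambda>s. \<Sum>i<n. f i s) holomorphic_on S" for n
    by (intro holomorphic_intros assms(2))
  fix x assume "x \<in> S"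
  then obtain d h where "d > 0" "cball x d \<subseteq> S" "summable h"
    "\<And>n y. y \<in> cball x d \<Longrightarrow> norm (f n y) \<le> h n"
    using assms(3) by meson
  then show "\<exists>d>0. cball x d \<subseteq> S \<and>
      uniform_limit (cball x d) (\<lambda>n s. \<Sum>i<n. f i s) (\<lambda>s. \<Sum>n. f n s) sequentially"
    by (intro exI[of _ d] conjI Weierstrass_m_test) auto
qed

lemma summable_shift2_powr:
  assumes "s < -1"
  shows "summable (\<lambda>n. real (n + 2) powr s)"
  using assms summable_iff_shift[of "\<lambda>n. real n powr s" 2] summable_real_powr_iff[of s] by simp

lemma norm_of_nat_powr: "n > 0 \<Longrightarrow> norm (of_nat n powr s :: complex) = real n powr Re s"
  by (simp add: norm_powr_real powr_def)

lemma norm_gbinomial_le: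
  fixes a :: complex
  assumes "norm a \<le> R"
  shows "norm (a gchoose k) \<le> (-1)^k * ((-R) gchoose k)"
proof -
  have "norm (a gchoose k) = (\<Prod>i<k. norm (a - of_nat i)) / fact k"
    by (simp add: gbinomial_prod_rev norm_divide prod_norm[symmetric] norm_mult atLeast0LessThan)
  also have "\<dots> \<le> (\<Prod>i<k. R + real i) / fact k"
  proof (intro divide_right_mono prod_mono conjI)
    fix i
    have "norm (a - of_nat i) \<le> norm a + norm (of_nat i :: complex)"
      by (rule norm_triangle_ineq4)
    then show "norm (a - of_nat i) \<le> R + real i" using assms by simp
  qed auto
  also have "(\<Prod>i<k. R + real i) = (-1)^k * (\<Prod>i<k. - R - real i)"
    by (induction k) (auto simp: algebra_simps)
  finally show ?thesis by (simp add: gbinomial_prod_rev atLeast0LessThan)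
qed

lemma binomial_tail_bound:
  fixes R :: real
  shows "\<exists>C. \<forall>a::complex. norm a \<le> R \<longrightarrow> (\<forall>x::real. 0 \<le> x \<and> x \<le> 1/2 \<longrightarrow>
     norm ((1 + of_real x) powr a - (\<Sum>k\<le>M. (a gchoose k) * of_real x ^ k)) \<le> C * x ^ Suc M)"
proof -
  define b where "b k = (-1)^k * ((-R) gchoose k) * (1/2)^k" for k
  have "(\<lambda>k. ((-R) gchoose k) * (-(1/2))^k) sums (1 + -(1/2)) powr (-R)"
    by (rule gen_binomial_real) auto
  moreover have "((-R) gchoose k) * (-(1/2))^k = b k" for k
    unfolding b_def by (subst power_minus) simp
  ultimately have sb: "summable b" by (simp add: sums_iff)
  show ?thesis
  proof (intro exI[of _ "2 ^ Suc M * (\<Sum>k. b (k + Suc M))"] allI impI, elim conjE)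
    fix a :: complex and x :: real
    assume a: "norm a \<le> R" and x: "0 \<le> x" "x \<le> 1/2"
    define t where "t k = (a gchoose k) * of_real x ^ k" for k
    have "t sums (1 + of_real x) powr a"
      unfolding t_def by (rule gen_binomial_complex) (use x in auto)
    then have "(\<lambda>k. t (k + Suc M)) sums ((1 + of_real x) powr a - (\<Sum>k<Suc M. t k))"
      by (subst sums_iff_shift) auto
    then have eq: "(1 + of_real x) powr a - (\<Sum>k\<le>M. t k) = (\<Sum>k. t (k + Suc M))"
      by (simp add: sums_iff lessThan_Suc_atMost)
    have le: "norm (t (k + Suc M)) \<le> 2 ^ Suc M * x ^ Suc M * b (k + Suc M)" for k
    proof -
      define B where "B = (-1)^(k + Suc M) * ((-R) gchoose (k + Suc M))"
      have B: "norm (a gchoose (k + Suc M)) \<le> B"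
        unfolding B_def by (rule norm_gbinomial_le[OF a])
      then have "B \<ge> 0" using norm_ge_zero order_trans by blast
      have "norm (t (k + Suc M)) = norm (a gchoose (k + Suc M)) * (x ^ k * x ^ Suc M)"
        using x unfolding t_def by (simp add: norm_mult norm_power power_add)
      also have "\<dots> \<le> B * ((1/2) ^ k * x ^ Suc M)"
        using x \<open>B \<ge> 0\<close> by (intro mult_mono B power_mono mult_nonneg_nonneg) auto
      also have "\<dots> = 2 ^ Suc M * x ^ Suc M * b (k + Suc M)"
        unfolding b_def B_def[symmetric] by (simp add: power_add field_simps)
      finally show ?thesis .
    qed
    have s: "summable (\<lambda>k. 2 ^ Suc M * x ^ Suc M * b (k + Suc M))"
      using sb by (intro summable_mult) (subst summable_iff_shift)
    have "norm (\<Sum>k. t (k + Suc M)) \<le> (\<Sum>k. 2 ^ Suc M * x ^ Suc M * b (k + Suc M))"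
      by (rule norm_suminf_le[OF le s])
    also have "\<dots> = 2 ^ Suc M * x ^ Suc M * (\<Sum>k. b (k + Suc M))"
      using sb by (intro suminf_mult) (subst summable_iff_shift)
    finally show "norm ((1 + of_real x) powr a - (\<Sum>k\<le>M. (a gchoose k) * of_real x ^ k))
        \<le> 2 ^ Suc M * (\<Sum>k. b (k + Suc M)) * x ^ Suc M"
      unfolding t_def[symmetric] eq by (simp add: mult_ac)
  qed
qed

text \<open>The series over \<open>n \<ge> 2\<close>, i.e. the zeta function minus 1.\<close>

definition zeta_tail :: "complex \<Rightarrow> complex" where
  "zeta_tail s = (\<Sum>n. of_nat (n + 2) powr (-s))"

lemma summable_zeta_tail:
  assumes "Re s > 1"
  shows "summable (\<lambda>n. of_nat (n + 2) powr (-s) :: complex)"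
proof (rule summable_norm_cancel)
  show "summable (\<lambda>n. norm (of_nat (n + 2) powr (-s) :: complex))"
    using summable_shift2_powr[of "-Re s"] assms by (subst norm_of_nat_powr) auto
qed

lemma holomorphic_zeta_tail: "zeta_tail holomorphic_on {s. Re s > 1}"
  unfolding zeta_tail_def[abs_def]
proof (rule holomorphic_on_suminf)
  fix x assume "x \<in> {s. Re s > 1}"
  then have x: "Re x > 1" by simp
  define d where "d = (Re x - 1) / 2"
  have d: "d > 0" using x by (simp add: d_def)
  have re: "Re y \<ge> 1 + d" if "y \<in> cball x d" for y
  proof -
    have "\<bar>Re (x - y)\<bar> \<le> d"
      using that abs_Re_le_cmod[of "x - y"] by (simp add: dist_norm)
    then show ?thesis by (simp add: d_def field_simps abs_if split: if_splits)
  qed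
  show "\<exists>d>0. cball x d \<subseteq> {s. Re s > 1} \<and> (\<exists>h. summable h \<and>
      (\<forall>n. \<forall>y\<in>cball x d. norm (of_nat (n + 2) powr - y :: complex) \<le> h n))"
  proof (intro exI[of _ d] conjI exI[of _ "\<lambda>n. real (n + 2) powr (-(1+d))"] allI ballI)
    show "cball x d \<subseteq> {s. 1 < Re s}" using re d by fastforce
    show "summable (\<lambda>n. real (n + 2) powr - (1 + d))"
      by (rule summable_shift2_powr) (use d in simp)
    fix n y assume "y \<in> cball x d"
    then show "norm (of_nat (n + 2) powr - y :: complex) \<le> real (n + 2) powr - (1 + d)"
      using re[of y] by (subst norm_of_nat_powr) (auto intro!: powr_mono simp del: mem_cball)
  qed (use d in auto)
qed (auto intro!: holomorphic_intros open_halfspace_Re_gt)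

definition powr_rem :: "nat \<Rightarrow> nat \<Rightarrow> complex \<Rightarrow> complex" where
  "powr_rem M n s = of_nat (n + 3) powr (1 - s) -
     (\<Sum>k\<le>M. ((1 - s) gchoose k) * of_nat (n + 2) powr (1 - s - of_nat k))"

lemma powr_rem_altdef:
  "powr_rem M n s = of_nat (n + 2) powr (1 - s) * ((1 + of_real (1 / real (n + 2))) powr (1 - s) -
     (\<Sum>k\<le>M. ((1 - s) gchoose k) * of_real (1 / real (n + 2)) ^ k))"
proof -
  have "of_nat (n + 3) = (of_nat (n + 2) * (1 + of_real (1 / real (n + 2))) :: complex)"
    using of_nat_neq_0[of "n + 1", where ?'a = complex] by (simp add: field_simps)
  also have "\<dots> powr (1 - s) = of_nat (n + 2) powr (1 - s) * (1 + of_real (1 / real (n + 2))) powr (1 - s)"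
    using powr_times_real[of "of_nat (n+2)" "1 + of_real (1 / real (n + 2))" "1 - s"]
    by (simp add: complex_is_Real_iff)
  finally have 1: "of_nat (n + 3) powr (1 - s) =
     of_nat (n + 2) powr (1 - s) * (1 + of_real (1 / real (n + 2))) powr (1 - s)" .
  have 2: "of_nat (n + 2) powr (1 - s - of_nat k) =
     (of_nat (n + 2) powr (1 - s) * of_real (1 / real (n + 2)) ^ k :: complex)" for k
    using of_nat_neq_0[of "n + 1", where ?'a = complex]
    by (subst powr_diff) (simp add: powr_nat' power_one_over divide_simps)
  show ?thesis
    unfolding powr_rem_def 1 2 by (simp add: right_diff_distrib sum_distrib_left mult_ac)
qed

lemma holomorphic_gbinomial: "(\<lambda>s::complex. (1 - s) gchoose k) holomorphic_on A"
  unfolding gbinomial_prod_rev by (intro holomorphic_intros) auto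

lemma powr_rem_bound:
  "\<exists>C. \<forall>s. norm (1 - s) \<le> R \<longrightarrow> (\<forall>n. norm (powr_rem M n s) \<le> C * real (n + 2) powr (- Re s - M))"
proof -
  obtain C where C: "\<And>a x. norm (a::complex) \<le> R \<Longrightarrow> 0 \<le> x \<Longrightarrow> x \<le> 1/2 \<Longrightarrow>
     norm ((1 + of_real x) powr a - (\<Sum>k\<le>M. (a gchoose k) * of_real x ^ k)) \<le> C * x ^ Suc M"
    using binomial_tail_bound[of R M] by blast
  show ?thesis
  proof (intro exI[of _ C] allI impI)
    fix s :: complex and n assume s: "norm (1 - s) \<le> R"
    have "norm (powr_rem M n s) \<le> real (n + 2) powr (1 - Re s) * (C * (1 / real (n + 2)) ^ Suc M)"
      unfolding powr_rem_altdef norm_mult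
      by (subst norm_of_nat_powr, simp, rule mult_mono[OF _ C]) (use s in \<open>auto simp: field_simps\<close>)
    also have "(1 / real (n + 2)) ^ Suc M = real (n + 2) powr (- real (Suc M))"
      by (subst powr_minus, subst powr_realpow) (auto simp: field_simps)
    also have "real (n + 2) powr (1 - Re s) * (C * real (n + 2) powr (- real (Suc M)))
       = C * real (n + 2) powr (1 - Re s + (- real (Suc M)))"
      by (subst powr_add) (simp add: mult_ac)
    finally show "norm (powr_rem M n s) \<le> C * real (n + 2) powr (- Re s - M)" by simp
  qed
qed

lemma summable_powr_rem:
  assumes "Re s > 1 - real M"
  shows "summable (\<lambda>n. powr_rem M n s)"
proof -
  obtain C where C: "\<And>n. norm (powr_rem M n s) \<le> C * real (n + 2) powr (- Re s - M)"
    using powr_rem_bound[of "norm (1 - s)" M] by blast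
  show ?thesis
    by (rule summable_comparison_test'[OF summable_mult[OF summable_shift2_powr] C])
       (use assms in auto)
qed

lemma holomorphic_powr_rem:
  "(\<lambda>s. \<Sum>n. powr_rem M n s) holomorphic_on {s. Re s > 1 - real M}"
proof (rule holomorphic_on_suminf)
  fix x assume "x \<in> {s. Re s > 1 - real M}"
  then have x: "Re x > 1 - real M" by simp
  define d where "d = (Re x - (1 - real M)) / 2"
  have d: "d > 0" using x by (simp add: d_def)
  have re: "Re y \<ge> 1 - real M + d" if "y \<in> cball x d" for y
  proof -
    have "\<bar>Re (x - y)\<bar> \<le> d"
      using that abs_Re_le_cmod[of "x - y"] by (simp add: dist_norm)
    then show ?thesis by (simp add: d_def field_simps abs_if split: if_splits)
  qed
  obtain C where C: "\<And>s n. norm (1 - s) \<le> norm (1 - x) + d \<Longrightarrow>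
      norm (powr_rem M n s) \<le> C * real (n + 2) powr (- Re s - M)"
    using powr_rem_bound[of "norm (1 - x) + d" M] by blast
  show "\<exists>d>0. cball x d \<subseteq> {s. Re s > 1 - real M} \<and> (\<exists>h. summable h \<and>
      (\<forall>n. \<forall>y\<in>cball x d. norm (powr_rem M n y) \<le> h n))"
  proof (intro exI[of _ d] conjI exI[of _ "\<lambda>n. \<bar>C\<bar> * real (n + 2) powr (-(1+d))"] allI ballI)
    show "cball x d \<subseteq> {s. 1 - real M < Re s}" using re d by fastforce
    show "summable (\<lambda>n. \<bar>C\<bar> * real (n + 2) powr - (1 + d))"
      by (intro summable_mult summable_shift2_powr) (use d in simp)
    fix n y assume y: "y \<in> cball x d"
    have "norm (1 - y) \<le> norm (1 - x) + norm (x - y)"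
      using norm_triangle_ineq[of "1 - x" "x - y"] by simp
    also have "\<dots> \<le> norm (1 - x) + d" using y by (simp add: dist_norm)
    finally have "norm (powr_rem M n y) \<le> C * real (n + 2) powr (- Re y - M)" by (rule C)
    also have "\<dots> \<le> \<bar>C\<bar> * real (n + 2) powr (- (1 + d))"
      using re[OF y] by (intro mult_mono powr_mono) auto
    finally show "norm (powr_rem M n y) \<le> \<bar>C\<bar> * real (n + 2) powr - (1 + d)" .
  qed (use d in auto)
next
  show "powr_rem M n holomorphic_on {s. Re s > 1 - real M}" for n
    unfolding powr_rem_def[abs_def] by (intro holomorphic_intros holomorphic_gbinomial)
qed (rule open_halfspace_Re_gt)

lemma zeta_tail_recurrence:
  assumes s: "Re s > 1" and M: "M \<ge> 1"
  shows "(s - 1) * zeta_tail s = 2 powr (1 - s) -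
    (\<Sum>k=2..M. ((1 - s) gchoose (k - 1)) / of_nat k * ((s + of_nat k - 2) * zeta_tail (s + of_nat k - 1)))
    + (\<Sum>n. powr_rem M n s)"
proof -
  have *: "(\<lambda>n. of_nat (n + 2) powr (1 - s) :: complex) \<longlonglongrightarrow> 0"
  proof (rule tendsto_norm_zero_cancel)
    have "(\<lambda>n. real (n + 2) powr (1 - Re s)) \<longlonglongrightarrow> 0"
      using s by (intro tendsto_neg_powr filterlim_compose[OF filterlim_real_sequentially]
          filterlim_add_const_nat_at_top) auto
    then show "(\<lambda>n. norm (of_nat (n + 2) powr (1 - s) :: complex)) \<longlonglongrightarrow> 0"
      by (subst norm_of_nat_powr) auto
  qed
  have tele: "(\<lambda>n. of_nat (n + 3) powr (1 - s) - of_nat (n + 2) powr (1 - s)) sums (0 - (2::complex) powr (1 - s))"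
    using telescope_sums[OF *] by (simp add: eval_nat_numeral)
  have zt: "(\<lambda>n. of_nat (n + 2) powr (1 - s - of_nat k)) sums zeta_tail (s + of_nat k - 1)" if "k \<ge> 1" for k
  proof -
    have "Re (s + of_nat k - 1) > 1" using s that by simp
    from summable_sums[OF summable_zeta_tail[OF this]] show ?thesis
      by (simp add: zeta_tail_def algebra_simps)
  qed
  have "(\<lambda>n. (\<Sum>k=1..M. ((1 - s) gchoose k) * of_nat (n + 2) powr (1 - s - of_nat k)) + powr_rem M n s) sums
     ((\<Sum>k=1..M. ((1 - s) gchoose k) * zeta_tail (s + of_nat k - 1)) + (\<Sum>n. powr_rem M n s))"
    using s M by (intro sums_add sums_sum sums_mult zt summable_sums summable_powr_rem) auto
  moreover have "(\<Sum>k=1..M. ((1 - s) gchoose k) * of_nat (n + 2) powr (1 - s - of_nat k)) + powr_rem M n s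
     = of_nat (n + 3) powr (1 - s) - of_nat (n + 2) powr (1 - s)" for n
  proof -
    have "{..M} = insert 0 {1..M}" by auto
    then show ?thesis by (simp add: powr_rem_def del: of_nat_add)
  qed
  ultimately have "(\<Sum>k=1..M. ((1 - s) gchoose k) * zeta_tail (s + of_nat k - 1)) + (\<Sum>n. powr_rem M n s)
     = - (2 powr (1 - s))"
    using sums_unique2[OF tele] by simp
  moreover have "(\<Sum>k=1..M. ((1 - s) gchoose k) * zeta_tail (s + of_nat k - 1)) = (1 - s) * zeta_tail s
      + (\<Sum>k=2..M. ((1 - s) gchoose k) * zeta_tail (s + of_nat k - 1))"
  proof -
    have "{1..M} = insert 1 {2..M}" using M by auto
    then show ?thesis by simp
  qed
  moreover have "(\<Sum>k=2..M. ((1 - s) gchoose k) * zeta_tail (s + of_nat k - 1)) =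
     - (\<Sum>k=2..M. ((1 - s) gchoose (k - 1)) / of_nat k * ((s + of_nat k - 2) * zeta_tail (s + of_nat k - 1)))"
    unfolding sum_negf[symmetric]
  proof (rule sum.cong[OF refl])
    fix k assume "k \<in> {2..M}"
    then obtain j where k: "k = Suc j" "j \<ge> 1" by (cases k) auto
    have "of_nat (Suc j) * ((1 - s) gchoose Suc j) = (1 - s - of_nat j) * ((1 - s) gchoose j)"
      using gbinomial_absorb_comp[of "1 - s" j] gbinomial_absorption[of j "1 - s"] by (simp only:)
    then have "((1 - s) gchoose Suc j) = (1 - s - of_nat j) * ((1 - s) gchoose j) / of_nat (Suc j)"
      by (metis nonzero_mult_div_cancel_left of_nat_neq_0)
    moreover have "1 - s - of_nat j = - (s + of_nat (Suc j) - 2)" by simp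
    moreover have alg: "(- E) * A / B = - (A / B * E)" for A B E :: complex by simp
    ultimately have "((1 - s) gchoose Suc j) = - ((((1 - s) gchoose j) / of_nat (Suc j)) * (s + of_nat (Suc j) - 2))"
      using alg by (simp only:)
    then show "((1 - s) gchoose k) * zeta_tail (s + of_nat k - 1) =
       - (((1 - s) gchoose (k - 1)) / of_nat k * ((s + of_nat k - 2) * zeta_tail (s + of_nat k - 1)))"
      unfolding k by (simp del: of_nat_Suc)
  qed
  ultimately show ?thesis by algebra
qed

lemma zeta_tail_continuation_strip:
  "\<exists>G. G holomorphic_on {s. Re s > 1 - real m} \<and> (\<forall>s. Re s > 1 \<longrightarrow> G s = (s - 1) * zeta_tail s)"
proof (induction m)
  case 0
  show ?case
    by (rule exI[of _ "\<lambda>s. (s - 1) * zeta_tail s"])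
       (auto intro!: holomorphic_intros holomorphic_zeta_tail)
next
  case (Suc m)
  then obtain G where G: "G holomorphic_on {s. Re s > 1 - real m}"
    "\<And>s. Re s > 1 \<Longrightarrow> G s = (s - 1) * zeta_tail s" by blast
  define H where "H s = 2 powr (1 - s) -
    (\<Sum>k=2..Suc m. ((1 - s) gchoose (k - 1)) / of_nat k * G (s + of_nat k - 1))
    + (\<Sum>n. powr_rem (Suc m) n s)" for s
  have 1: "(\<lambda>s. G (s + of_nat k - 1)) holomorphic_on {s. Re s > 1 - real (Suc m)}" if "k \<in> {2..Suc m}" for k
  proof -
    have "(\<lambda>s. s + of_nat k - 1) ` {s. Re s > 1 - real (Suc m)} \<subseteq> {s. Re s > 1 - real m}"
      using that by auto
    then show ?thesis
      by (intro holomorphic_on_compose_gen[OF _ G(1), unfolded o_def] holomorphic_intros)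
  qed
  have "H holomorphic_on {s. Re s > 1 - real (Suc m)}"
    unfolding H_def[abs_def]
    by (intro holomorphic_intros holomorphic_gbinomial holomorphic_powr_rem 1) auto
  moreover have "H s = (s - 1) * zeta_tail s" if s: "Re s > 1" for s
  proof -
    have "G (s + of_nat k - 1) = (s + of_nat k - 2) * zeta_tail (s + of_nat k - 1)" if "k \<in> {2..Suc m}" for k
      using that s by (subst G(2)) (auto simp: algebra_simps)
    then show ?thesis
      unfolding H_def by (subst zeta_tail_recurrence[OF s, of "Suc m"]) auto
  qed
  ultimately show ?case by blast
qed

lemma zeta_tail_continuation:
  "\<exists>G. G holomorphic_on UNIV \<and> (\<forall>s. Re s > 1 \<longrightarrow> G s = (s - 1) * zeta_tail s)"
proof -
  obtain G where G: "\<And>m. G m holomorphic_on {s. Re s > 1 - real m}"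
    "\<And>m s. Re s > 1 \<Longrightarrow> G m s = (s - 1) * zeta_tail s"
    using zeta_tail_continuation_strip by metis
  have agree: "G m s = G m' s" if "m \<le> m'" "Re s > 1 - real m" for m m' s
  proof (rule analytic_continuation_open[of "{s. Re s > 1}" "{s. Re s > 1 - real m}" "G m" "G m'"])
    show "G m' holomorphic_on {s. Re s > 1 - real m}"
      by (rule holomorphic_on_subset[OF G(1)]) (use that in auto)
    show "{s. Re s > 1} \<noteq> {}" by (auto intro!: exI[of _ 2])
    show "connected {s. Re s > 1 - real m}"
      by (intro convex_connected convex_halfspace_Re_gt)
  qed (use that G in \<open>auto intro!: open_halfspace_Re_gt\<close>)
  define m where "m s = nat \<lceil>2 + \<bar>Re s\<bar>\<rceil>" for s :: complex
  define H where "H s = G (m s) s" for s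
  have ms: "Re s > 1 - real (m s)" for s
    unfolding m_def by linarith
  have eq: "H s = G k s" if "Re s > 1 - real k" for k s
  proof (cases "m s \<le> k")
    case True
    then show ?thesis unfolding H_def by (rule agree) (rule ms)
  next
    case False
    then show ?thesis unfolding H_def using agree[of k "m s" s] that by (metis nle_le)
  qed
  have "H holomorphic_on (\<Union>k. {s. Re s > 1 - real k})"
  proof (rule holomorphic_on_UN_open)
    show "H holomorphic_on {s. Re s > 1 - real k}" for k
      using G(1)[of k] by (rule holomorphic_transform) (simp add: eq[symmetric])
  qed (auto intro!: open_halfspace_Re_gt)
  moreover have "(\<Union>k. {s. Re s > 1 - real k}) = UNIV" using ms by blast
  ultimately have "H holomorphic_on UNIV" by simp
  moreover have "\<forall>s. Re s > 1 \<longrightarrow> H s = (s - 1) * zeta_tail s" by (simp add: H_def G(2))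
  ultimately show ?thesis by blast
qed

lemma ex1_is_zeta: "\<exists>!f. is_zeta f"
proof (rule ex_ex1I)
  obtain G where G: "G holomorphic_on UNIV" "\<And>s. Re s > 1 \<Longrightarrow> G s = (s - 1) * zeta_tail s"
    using zeta_tail_continuation by blast
  define f where "f s = (if s = 1 then 0 else 1 + G s / (s - 1))" for s
  have "(\<lambda>s. 1 + G s / (s - 1)) holomorphic_on - {1}"
    by (intro holomorphic_intros holomorphic_on_subset[OF G(1)]) auto
  then have "f holomorphic_on - {1}"
    by (subst holomorphic_cong[OF refl, of _ _ "\<lambda>s. 1 + G s / (s - 1)"]) (auto simp: f_def)
  moreover have "(\<lambda>n. 1 / of_nat (Suc n) powr s) sums f s" if s: "Re s > 1" for s
  proof -
    have "(\<lambda>n. of_nat (n + 2) powr (-s)) sums zeta_tail s"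
      unfolding zeta_tail_def by (rule summable_sums[OF summable_zeta_tail[OF s]])
    then have "(\<lambda>n. 1 / of_nat (Suc (Suc n)) powr s) sums zeta_tail s"
      by (simp add: powr_minus field_simps)
    then have "(\<lambda>n. 1 / of_nat (Suc n) powr s) sums (zeta_tail s + 1)"
      using sums_Suc[of "\<lambda>n. 1 / of_nat (Suc n) powr s" "zeta_tail s"] by simp
    moreover have "s \<noteq> 1" using s by auto
    ultimately show ?thesis using G(2)[OF s] by (simp add: f_def add.commute)
  qed
  ultimately show "\<exists>f. is_zeta f" by (auto simp: is_zeta_def f_def intro!: exI[of _ f])
next
  fix f g assume fg: "is_zeta f" "is_zeta g"
  show "f = g"
  proof
    fix s :: complex
    show "f s = g s"
    proof (cases "s = 1")
      case False
      show ?thesis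
      proof (rule analytic_continuation_open[of "{s. Re s > 1}" "- {1}" f g])
        show "{s. Re s > 1} \<noteq> {}" by (auto intro!: exI[of _ 2])
        show "connected (- {1::complex})"
          by (rule connected_punctured_universe) auto
        show "f z = g z" if "z \<in> {s. Re s > 1}" for z
          using fg that unfolding is_zeta_def by (blast intro: sums_unique2)
      qed (use fg False in \<open>auto simp: is_zeta_def intro!: open_halfspace_Re_gt\<close>)
    qed (use fg in \<open>auto simp: is_zeta_def\<close>)
  qed
qed

lemma is_zeta_zeta: "is_zeta zeta"
  unfolding zeta_def by (rule theI'[OF ex1_is_zeta])

end

theory Submission
  imports Defs "HOL-Computational_Algebra.Squarefree"
begin

text \<open>
  For the direction from the Riemann hypothesis to the bound, the zero-free half-plane \<open>Re s > 1/2\<close>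
  carries a holomorphic logarithm of \<open>(s - 1) zeta(s)\<close>. Its real part is \<open>O(log |t|)\<close>, and by
  Borel--Caratheodory so is its modulus, hence \<open>1 / zeta\<close> grows at most polynomially on
  \<open>Re s \<ge> 1/2 + \<delta>\<close>. The sum defining \<open>c_k\<close> is a finite difference, i.e. a Noerlund--Rice integral of
  \<open>1 / zeta(2z + 2)\<close> against \<open>k! / (z (z - 1) ... (z - k))\<close>; on the line \<open>Re z = - a\<close> with \<open>a < 3/4\<close> the
  kernel is \<open>O(k powr (- a))\<close> with arbitrary polynomial decay in \<open>t\<close>, so the degree of the growth of
  \<open>1 / zeta\<close> does not matter.

  Conversely, inserting the Moebius series of \<open>1 / zeta\<close> and the binomial series gives
  \<open>1 / zeta(2w) = (\<Sum>k. c_k (1 - w) (1 - w/2) ... (1 - w/k))\<close> for \<open>Re w > 1\<close>. The products are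
  \<open>O(k powr (- Re w))\<close>, so the assumed decay of \<open>c_k\<close> makes the series converge for \<open>Re w > 1/4\<close> and
  continues \<open>1 / zeta\<close>. This excludes zeros with \<open>Re s > 1/2\<close>; the functional equation then forces the
  zeros with \<open>Re s < 1/2\<close> to be trivial. For \<open>-1 < s < 0\<close> the functional equation comes from writing
  zeta as a sum of trapezoid errors of \<open>x powr (-s)\<close>, representing these by Gamma integrals, and
  expanding the resulting hyperbolic cotangent into partial fractions; all terms are nonnegative, so
  Tonelli's theorem suffices.
\<close>

section \<open>The zeta function to the right of \<open>-1\<close>\<close>

lemma zeta_sums: "Re s > 1 \<Longrightarrow> (\<lambda>n. 1 / of_nat (Suc n) powr s) sums zeta s"
  using is_zeta_zeta by (simp add: is_zeta_def)

lemma holomorphic_zeta: "zeta holomorphic_on - {1}"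
  using is_zeta_zeta by (simp add: is_zeta_def)

lemma zeta_1 [simp]: "zeta 1 = 0"
  using is_zeta_zeta by (simp add: is_zeta_def)

text \<open>The error of the trapezoidal rule for \<open>x powr (-s)\<close> on the interval \<open>[n + 1, n + 2]\<close>. It is
  \<open>O(n powr (- Re s - 2))\<close>, so summing it continues zeta to \<open>Re s > -1\<close>.\<close>

definition trapezoid_error :: "nat \<Rightarrow> complex \<Rightarrow> complex" where
  "trapezoid_error n s = (of_nat (n + 1) powr (-s) + of_nat (n + 2) powr (-s)) / 2 -
     (of_nat (n + 2) powr (1 - s) - of_nat (n + 1) powr (1 - s)) / (1 - s)"

text \<open>As a function \<open>f 0\<close> of the interval length \<open>t\<close>, the error
  vanishes to second order at \<open>t = 0\<close> and has second derivative
  \<open>s * (s + 1) * t * (m + t) powr (-s-2) / 2\<close>, so Taylor's theorem on [0, 1] gives the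
  bound. \<open>Re s \<ge> -2\<close> makes the modulus of the power largest at the left
  endpoint.\<close>

lemma norm_trapezoid_error_le:
  assumes s: "s \<noteq> 1" "Re s \<ge> -2"
  shows "norm (trapezoid_error n s) \<le> norm s * norm (s + 1) * real (n + 1) powr (- Re s - 2)"
proof -
  define m :: complex where "m = of_nat (n + 1)"
  define f where "f i t = (if i = 0 then (m powr (-s) + (m + t) powr (-s)) * t / 2
      - ((m + t) powr (1 - s) - m powr (1 - s)) / (1 - s)
    else if i = Suc 0 then (m powr (-s) - (m + t) powr (-s)) / 2 - s * t * (m + t) powr (-s-1) / 2
    else s * (s + 1) * t * (m + t) powr (-s-2) / 2)" for i :: nat and t :: complex
  define S where "S = (closed_segment 0 1 :: complex set)"
  have S: "\<exists>u. t = of_real u \<and> 0 \<le> u \<and> u \<le> 1" if "t \<in> S" for t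
    using that by (auto simp: S_def in_segment scaleR_conv_of_real)
  have pos: "m + t \<notin> \<real>\<^sub>\<le>\<^sub>0" if "t \<in> S" for t
    using S[OF that] by (auto simp: complex_nonpos_Reals_iff m_def)
  have "norm (f 0 1 - (\<Sum>i\<le>1. f i 0 * (1 - 0) ^ i / fact i)) \<le>
     (norm s * norm (s + 1) * real (n + 1) powr (- Re s - 2)) * norm (1 - 0 :: complex) ^ Suc 1 / fact 1"
  proof (rule complex_Taylor[where S = S])
    show "convex S" "0 \<in> S" "1 \<in> S" by (auto simp: S_def)
    fix t assume t: "t \<in> S"
    have "m + t \<noteq> 0" using pos[OF t] by auto
    have powr_m1: "(m + t) powr (-s) = (m + t) powr (-s-1) * (m + t)"
      using \<open>m + t \<noteq> 0\<close> by (simp add: powr_diff)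
    have powr_m2: "(m + t) powr (-s-1) = (m + t) powr (-s-2) * (m + t)"
    proof -
      have "-s-1 = (-s-2) + 1" by simp
      then show ?thesis by (simp only: powr_add) simp
    qed
    show "(f i has_field_derivative f (Suc i) t) (at t within S)" if "i \<le> 1" for i
    proof (cases i)
      case 0
      have "((\<lambda>t. (m + t) powr (1 - s) - m powr (1 - s)) has_field_derivative
          (1 - s) * (m + t) powr (-s)) (at t within S)"
        by (rule derivative_eq_intros refl pos[OF t])+ simp
      from DERIV_cdivide[OF this, of "1 - s"]
      have d: "((\<lambda>t. ((m + t) powr (1 - s) - m powr (1 - s)) / (1 - s)) has_field_derivative
          (m + t) powr (-s)) (at t within S)"
        using s by simp
      have "(f 0 has_field_derivative f 1 t) (at t within S)"
        unfolding f_def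
        by (simp, rule DERIV_cong[OF DERIV_diff[OF _ d]], (rule derivative_eq_intros refl pos[OF t] | simp)+)
           (simp add: field_simps)
      then show ?thesis using 0 by simp
    next
      case (Suc j)
      then have i: "i = 1" using that by simp
      have e: "(m + t) powr (-2 - s) = (m + t) powr (-s-2)"
        by (rule arg_cong[of _ _ "\<lambda>a. (m + t) powr a"]) simp
      have "(f 1 has_field_derivative f 2 t) (at t within S)"
        unfolding f_def
        by (simp, rule DERIV_cong[OF DERIV_diff], (rule derivative_eq_intros refl pos[OF t] | simp)+)
           (use powr_m1 powr_m2 in \<open>simp add: e field_simps\<close>)
      then show ?thesis using i by (simp add: numeral_2_eq_2)
    qed
    obtain u where u: "t = of_real u" "0 \<le> u" "u \<le> 1" using S[OF t] by blast
    have mt: "m + t = of_real (real (n + 1) + u)" by (simp add: m_def u)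
    have "norm ((m + t) powr (-s-2)) = (real (n + 1) + u) powr (- Re s - 2)"
      unfolding mt by (subst norm_powr_real_powr) (use u in auto)
    also have "\<dots> \<le> real (n + 1) powr (- Re s - 2)"
      using s u by (intro powr_mono2') auto
    finally have "norm (f 2 t) \<le> norm s * norm (s + 1) * u * real (n + 1) powr (- Re s - 2) / 2"
      using u by (simp add: f_def norm_mult norm_divide mult_left_mono)
    \<comment> \<open>Bounding \<open>u\<close> by 2 cancels the denominator.\<close>
    also have "\<dots> \<le> norm s * norm (s + 1) * 2 * real (n + 1) powr (- Re s - 2) / 2"
      using u by (intro divide_right_mono mult_right_mono mult_left_mono) auto
    finally show "norm (f (Suc 1) t) \<le> norm s * norm (s + 1) * real (n + 1) powr (- Re s - 2)"
      by (simp add: numeral_2_eq_2)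
  qed
  moreover have "f 0 0 = 0" "f 1 0 = 0" by (auto simp: f_def)
  moreover have "f 0 1 = trapezoid_error n s"
    by (simp add: f_def trapezoid_error_def m_def add_ac)
  ultimately show ?thesis by simp
qed

lemma summable_trapezoid_error:
  assumes s: "s \<noteq> 1" "Re s > -1"
  shows "summable (\<lambda>n. trapezoid_error n s)"
proof (rule summable_comparison_test')
  have "summable (\<lambda>n. real (n + 1) powr (- Re s - 2))"
    using s summable_iff_shift[of "\<lambda>n. real n powr (- Re s - 2)" 1] summable_real_powr_iff[of "- Re s - 2"]
    by simp
  then show "summable (\<lambda>n. norm s * norm (s + 1) * real (n + 1) powr (- Re s - 2))"
    by (rule summable_mult)
  show "norm (trapezoid_error n s) \<le> norm s * norm (s + 1) * real (n + 1) powr (- Re s - 2)" for n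
    by (rule norm_trapezoid_error_le) (use s in auto)
qed

text \<open>Summed over \<open>n\<close>, the endpoint averages give \<open>zeta s - 1 / 2\<close>,
  and the differences of antiderivatives telescope to \<open>1 / (s - 1)\<close>.\<close>

lemma zeta_trapezoid_aux:
  assumes s: "Re s > 1"
  shows "zeta s = 1 / 2 + 1 / (s - 1) + (\<Sum>n. trapezoid_error n s)"
proof -
  have "s \<noteq> 1" using s by auto
  have *: "(\<lambda>n. of_nat (n + 1) powr (1 - s) :: complex) \<longlonglongrightarrow> 0"
  proof (rule tendsto_norm_zero_cancel)
    have "(\<lambda>n. real (n + 1) powr (1 - Re s)) \<longlonglongrightarrow> 0"
      using s by (intro tendsto_neg_powr filterlim_compose[OF filterlim_real_sequentially]
          filterlim_add_const_nat_at_top) auto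
    then show "(\<lambda>n. norm (of_nat (n + 1) powr (1 - s) :: complex)) \<longlonglongrightarrow> 0"
      by (subst norm_of_nat_powr) auto
  qed
  have tele: "(\<lambda>n. of_nat (n + 2) powr (1 - s) - of_nat (n + 1) powr (1 - s)) sums (0 - (1::complex))"
    using telescope_sums[OF *] by simp
  have z1: "(\<lambda>n. of_nat (n + 1) powr (-s)) sums zeta s"
    using zeta_sums[OF s] by (simp add: powr_minus field_simps)
  then have z2: "(\<lambda>n. of_nat (n + 2) powr (-s)) sums (zeta s - 1)"
    using sums_Suc_iff[of "\<lambda>n. of_nat (n + 1) powr (-s)" "zeta s - 1"] by simp
  have "(\<lambda>n. trapezoid_error n s) sums ((zeta s + (zeta s - 1)) / 2 - (0 - 1) / (1 - s))"
    unfolding trapezoid_error_def by (intro sums_diff sums_divide sums_add z1 z2 tele)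
  then show ?thesis using \<open>s \<noteq> 1\<close> by (simp add: sums_iff field_simps)
qed

lemma holomorphic_trapezoid_sum:
  "(\<lambda>s. \<Sum>n. trapezoid_error n s) holomorphic_on ({s. Re s > -1} - {1})"
proof (rule holomorphic_on_suminf)
  show op: "open ({s. Re s > -1} - {1})"
    by (intro open_delete open_halfspace_Re_gt)
  show "trapezoid_error n holomorphic_on ({s. Re s > -1} - {1})" for n
    unfolding trapezoid_error_def[abs_def] by (intro holomorphic_intros) auto
  fix x assume x: "x \<in> {s. Re s > -1} - {1}"
  obtain d0 where d0: "d0 > 0" "cball x d0 \<subseteq> {s. Re s > -1} - {1}"
    using op x open_contains_cball by blast
  \<comment> \<open>Half the distance to the line \<open>Re s = -1\<close>: on the disc
    \<open>Re y \<ge> (Re x - 1) / 2 > -1\<close>, which keeps the dominating exponent below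
    -1.\<close>
  define d where "d = min d0 ((Re x + 1) / 2)"
  have d: "d > 0" "cball x d \<subseteq> {s. Re s > -1} - {1}"
    using x d0 unfolding d_def by (simp, use d0(2) in \<open>auto simp: subset_iff\<close>)
  have re: "Re y \<ge> (Re x - 1) / 2" if "y \<in> cball x d" for y
  proof -
    have "\<bar>Re (x - y)\<bar> \<le> (Re x + 1) / 2"
      using that abs_Re_le_cmod[of "x - y"] by (simp add: dist_norm d_def)
    then show ?thesis by (simp add: field_simps abs_if split: if_splits)
  qed
  define B where "B = norm x + d"
  have nB: "norm y \<le> B" if "y \<in> cball x d" for y
    using that norm_triangle_sub[of y x] by (simp add: B_def dist_norm norm_minus_commute)
  show "\<exists>d>0. cball x d \<subseteq> {s. Re s > -1} - {1} \<and> (\<exists>h. summable h \<and>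
     (\<forall>n. \<forall>y\<in>cball x d. norm (trapezoid_error n y) \<le> h n))"
  proof (intro exI[of _ d] conjI exI[of _ "\<lambda>n. B * (B + 1) * real (n + 1) powr (- ((Re x - 1) / 2) - 2)"]
      allI ballI d)
    have "summable (\<lambda>n. real (n + 1) powr (- ((Re x - 1) / 2) - 2))"
      using x summable_iff_shift[of "\<lambda>n. real n powr (- ((Re x - 1) / 2) - 2)" 1]
        summable_real_powr_iff[of "- ((Re x - 1) / 2) - 2"]
      by simp
    then show "summable (\<lambda>n. B * (B + 1) * real (n + 1) powr (- ((Re x - 1) / 2) - 2))"
      by (rule summable_mult)
    fix n y assume y: "y \<in> cball x d"
    then have y': "y \<noteq> 1" "Re y > -1" using d by auto
    have "norm (trapezoid_error n y) \<le> norm y * norm (y + 1) * real (n + 1) powr (- Re y - 2)"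
      by (rule norm_trapezoid_error_le) (use y' in auto)
    also have "\<dots> \<le> B * (B + 1) * real (n + 1) powr (- ((Re x - 1) / 2) - 2)"
    proof (intro mult_mono powr_mono nB[OF y])
      show "norm (y + 1) \<le> B + 1" using nB[OF y] norm_triangle_ineq[of y 1] by simp
    qed (use re[OF y] nB[OF y] order_trans[OF norm_ge_zero nB[OF y]] in auto)
    finally show "norm (trapezoid_error n y) \<le> B * (B + 1) * real (n + 1) powr (- ((Re x - 1) / 2) - 2)" .
  qed
qed

lemma zeta_trapezoid:
  assumes s: "Re s > -1" "s \<noteq> 1"
  shows "zeta s = 1 / 2 + 1 / (s - 1) + (\<Sum>n. trapezoid_error n s)"
proof (rule analytic_continuation_open[of "{s. Re s > 1}" "{s. Re s > -1} - {1}" zeta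
      "\<lambda>s. 1 / 2 + 1 / (s - 1) + (\<Sum>n. trapezoid_error n s)"])
  show "{s. Re s > 1} \<noteq> {}" by (auto intro!: exI[of _ 2])
  show "connected ({s. Re s > -1} - {1})"
    by (intro connected_open_delete convex_connected convex_halfspace_Re_gt open_halfspace_Re_gt) auto
  show "zeta holomorphic_on {s. Re s > -1} - {1}"
    by (rule holomorphic_on_subset[OF holomorphic_zeta]) auto
  show "(\<lambda>s. 1 / 2 + 1 / (s - 1) + (\<Sum>n. trapezoid_error n s)) holomorphic_on ({s. Re s > -1} - {1})"
    by (intro holomorphic_intros holomorphic_trapezoid_sum) auto
qed (use s zeta_trapezoid_aux in \<open>auto intro!: open_halfspace_Re_gt open_delete\<close>)

text \<open>The trapezoidal rule is exact for the constant function, so only the elementary terms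
  remain. This covers the point 0, which the functional equation leaves out.\<close>

lemma zeta_0: "zeta 0 = - 1 / 2"
proof -
  have "trapezoid_error n 0 = 0" for n
    using of_nat_neq_0[of n, where ?'a = complex] of_nat_neq_0[of "Suc n", where ?'a = complex]
    by (simp add: trapezoid_error_def)
  then show ?thesis by (subst zeta_trapezoid) auto
qed

section \<open>Polynomial growth of zeta and removal of its pole\<close>

lemma norm_zeta_le:
  "\<exists>C>0. \<forall>s. Re s \<ge> 0 \<longrightarrow> s \<noteq> 1 \<longrightarrow> norm (zeta s - 1 / (s - 1)) \<le> C * (1 + norm s) ^ 2"
proof -
  define K where "K = (\<Sum>n. real (n + 1) powr (-2))"
  have sK: "summable (\<lambda>n. real (n + 1) powr (-2))"
    using summable_iff_shift[of "\<lambda>n. real n powr (-2)" 1] summable_real_powr_iff[of "-2"] by simp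
  have "K \<ge> 0" unfolding K_def by (intro suminf_nonneg sK) auto
  show ?thesis
  proof (intro exI[of _ "1 + K"] conjI allI impI)
    show "1 + K > 0" using \<open>K \<ge> 0\<close> by simp
    fix s :: complex assume s: "0 \<le> Re s" "s \<noteq> 1"
    define D where "D = norm s * norm (s + 1)"
    \<comment> \<open>For \<open>0 \<le> Re s\<close> the exponent may be replaced by -2; the sum
      over \<open>n\<close> is then the constant \<open>K\<close>, and all growth in
      \<open>s\<close> sits in \<open>D\<close>.\<close>
    have le: "norm (trapezoid_error n s) \<le> D * real (n + 1) powr (-2)" for n
    proof -
      have "norm (trapezoid_error n s) \<le> D * real (n + 1) powr (- Re s - 2)"
        unfolding D_def by (rule norm_trapezoid_error_le) (use s in auto)
      also have "\<dots> \<le> D * real (n + 1) powr (-2)"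
        using s by (intro mult_left_mono powr_mono) (auto simp: D_def)
      finally show ?thesis .
    qed
    have "D \<le> (1 + norm s) * (1 + norm s)"
      unfolding D_def using norm_triangle_ineq[of s 1] by (intro mult_mono) auto
    then have D: "0 \<le> D" "D \<le> (1 + norm s) ^ 2" by (simp_all add: D_def power2_eq_square)
    have "norm (\<Sum>n. trapezoid_error n s) \<le> (\<Sum>n. D * real (n + 1) powr (-2))"
      by (rule norm_suminf_le[OF le summable_mult[OF sK]])
    also have "\<dots> = D * K" unfolding K_def by (rule suminf_mult[OF sK])
    also have "\<dots> \<le> (1 + norm s) ^ 2 * K" by (intro mult_right_mono D \<open>K \<ge> 0\<close>)
    finally have "norm (\<Sum>n. trapezoid_error n s) \<le> (1 + norm s) ^ 2 * K" .
    moreover have "1 \<le> (1 + norm s) ^ 2" by (rule one_le_power) simp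
    moreover have "zeta s - 1 / (s - 1) = 1 / 2 + (\<Sum>n. trapezoid_error n s)"
      by (subst zeta_trapezoid) (use s in auto)
    moreover have "norm (1 / 2 + (\<Sum>n. trapezoid_error n s)) \<le> 1 / 2 + norm (\<Sum>n. trapezoid_error n s)"
      using norm_triangle_ineq[of "1/2" "(\<Sum>n. trapezoid_error n s)"] by simp
    ultimately show "norm (zeta s - 1 / (s - 1)) \<le> (1 + K) * (1 + norm s) ^ 2"
      unfolding distrib_right mult_1 by (simp only: mult.commute)
  qed
qed

text \<open>The value 1 at 1 is the residue of zeta there, so the pole is removed and no zero is
  introduced at 1.\<close>

definition zeta_reg :: "complex \<Rightarrow> complex" where
  "zeta_reg s = (if s = 1 then 1 else (s - 1) * zeta s)"

text \<open>The factor \<open>norm (s - 1)\<close> yields continuity at the removed pole; the rest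
  yields polynomial growth.\<close>

lemma norm_zeta_reg_le:
  "\<exists>C>0. \<forall>s. Re s \<ge> 0 \<longrightarrow> norm (zeta_reg s - 1) \<le> C * norm (s - 1) * (1 + norm s) ^ 2"
proof -
  obtain C where C: "C > 0"
    "\<And>s. Re s \<ge> 0 \<Longrightarrow> s \<noteq> 1 \<Longrightarrow> norm (zeta s - 1 / (s - 1)) \<le> C * (1 + norm s) ^ 2"
    using norm_zeta_le by blast
  have "norm (zeta_reg s - 1) \<le> C * norm (s - 1) * (1 + norm s) ^ 2" if "Re s \<ge> 0" for s
  proof (cases "s = 1")
    case False
    then have "zeta_reg s - 1 = (s - 1) * (zeta s - 1 / (s - 1))"
      by (simp add: zeta_reg_def field_simps)
    then have "norm (zeta_reg s - 1) = norm (s - 1) * norm (zeta s - 1 / (s - 1))"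
      by (simp add: norm_mult)
    also have "\<dots> \<le> norm (s - 1) * (C * (1 + norm s) ^ 2)"
      by (intro mult_left_mono C that False) auto
    finally show ?thesis by (simp add: mult_ac)
  qed (simp add: zeta_reg_def)
  then show ?thesis using C(1) by blast
qed

lemma holomorphic_zeta_reg: "zeta_reg holomorphic_on UNIV"
proof (rule no_isolated_singularity[where K = "{1}"])
  show "zeta_reg holomorphic_on UNIV - {1}"
  proof (subst holomorphic_cong[OF refl])
    show "(\<lambda>s. (s - 1) * zeta s) holomorphic_on UNIV - {1}"
      by (intro holomorphic_intros holomorphic_on_subset[OF holomorphic_zeta]) auto
  qed (auto simp: zeta_reg_def)
  then have 1: "isCont zeta_reg z" if "z \<noteq> 1" for z
    by (rule continuous_on_interior[OF holomorphic_on_imp_continuous_on])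
       (use that in \<open>auto simp: interior_open open_delete\<close>)
  have "isCont zeta_reg 1"
  proof -
    obtain C where C: "\<And>s. Re s \<ge> 0 \<Longrightarrow> norm (zeta_reg s - 1) \<le> C * norm (s - 1) * (1 + norm s) ^ 2"
      using norm_zeta_reg_le by blast
    have "((\<lambda>s::complex. C * norm (s - 1) * (1 + norm s) ^ 2) \<longlongrightarrow> C * norm (1 - 1 :: complex) * (1 + norm (1::complex)) ^ 2) (at 1)"
      by (intro tendsto_intros)
    then have "((\<lambda>s::complex. C * norm (s - 1) * (1 + norm s) ^ 2) \<longlongrightarrow> 0) (at (1::complex))" by simp
    moreover have "\<forall>\<^sub>F s in at (1::complex). norm (zeta_reg s - 1) \<le> C * norm (s - 1) * (1 + norm s) ^ 2"
    proof -
      have "\<forall>\<^sub>F s in at (1::complex). s \<in> {s. Re s > 0}"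
        by (intro eventually_at_in_open' open_halfspace_Re_gt) auto
      then show ?thesis by eventually_elim (use C in auto)
    qed
    ultimately have "((\<lambda>s. zeta_reg s - 1) \<longlongrightarrow> 0) (at 1)"
      by (rule Lim_null_comparison[rotated])
    then have "(zeta_reg \<longlongrightarrow> 1) (at 1)" by (simp add: LIM_zero_iff)
    then show ?thesis by (simp add: isCont_def zeta_reg_def)
  qed
  with 1 show "continuous_on UNIV zeta_reg"
    by (metis continuous_at_imp_continuous_on)
qed auto

section \<open>The functional equation\<close>

lemma Digamma_reflection_complex:
  fixes z :: complex
  assumes "z \<notin> \<int>"
  shows "Digamma (1 - z) - Digamma z = of_real pi * (cos (of_real pi * z) / sin (of_real pi * z))"
proof -
  have sin0: "sin (of_real pi * z) \<noteq> 0"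
  proof
    assume "sin (of_real pi * z) = 0"
    then obtain n :: int where "of_real pi * z = of_real (of_int n * pi)"
      by (auto simp: Complex_Transcendental.sin_eq_0)
    then have "z = of_int n" by simp
    then show False using assms by simp
  qed
  have z: "z \<notin> \<int>\<^sub>\<le>\<^sub>0" "1 - z \<notin> \<int>\<^sub>\<le>\<^sub>0"
    using assms nonpos_Ints_Int Ints_diff[of 1 "1 - z"] by auto
  define P where "P = Gamma z * Gamma (1 - z)"
  have P: "P = of_real pi / sin (of_real pi * z)" unfolding P_def by (rule Gamma_reflection_complex)
  \<comment> \<open>Both sides of the reflection formula are differentiated, and the common nonzero
    factor \<open>P\<close> is cancelled.\<close>
  have "((\<lambda>z. Gamma z * Gamma (1 - z)) has_field_derivative
      (Gamma z * Digamma z) * Gamma (1 - z) + Gamma z * (Gamma (1 - z) * Digamma (1 - z) * (- 1))) (at z)"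
    by (rule derivative_eq_intros refl z | simp)+
  moreover have "((\<lambda>z. Gamma z * Gamma (1 - z)) has_field_derivative
      - (of_real pi * (cos (of_real pi * z) * of_real pi) / (sin (of_real pi * z)) ^ 2)) (at z)"
    unfolding Gamma_reflection_complex
    by (rule derivative_eq_intros refl | simp add: sin0 power2_eq_square)+
  ultimately have "(Gamma z * Digamma z) * Gamma (1 - z) + Gamma z * (Gamma (1 - z) * Digamma (1 - z) * (- 1)) =
      - (of_real pi * (cos (of_real pi * z) * of_real pi) / (sin (of_real pi * z)) ^ 2)"
    by (rule DERIV_unique)
  moreover have "P * (Digamma z - Digamma (1 - z)) =
      (Gamma z * Digamma z) * Gamma (1 - z) + Gamma z * (Gamma (1 - z) * Digamma (1 - z) * (- 1))"
    by (simp add: P_def algebra_simps)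
  moreover have "- (of_real pi * (cos (of_real pi * z) * of_real pi) / (sin (of_real pi * z)) ^ 2) =
      P * (- (of_real pi * (cos (of_real pi * z) / sin (of_real pi * z))))"
    unfolding P by (simp add: power2_eq_square)
  ultimately have "P * (Digamma z - Digamma (1 - z)) = P * (- (of_real pi * (cos (of_real pi * z) / sin (of_real pi * z))))"
    by (simp only:)
  moreover have "P \<noteq> 0" unfolding P using sin0 by simp
  ultimately have "Digamma z - Digamma (1 - z) = - (of_real pi * (cos (of_real pi * z) / sin (of_real pi * z)))"
    by (simp only: mult_cancel_left) simp
  then show ?thesis by (simp add: algebra_simps)
qed

text \<open>The difference of the Digamma series at \<open>1 - z\<close> and \<open>z\<close> has
  terms \<open>inverse (z + of_nat k) - inverse (1 - z + of_nat k)\<close>; adding a telescoping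
  series shifts the first index by one and splits off \<open>inverse z\<close>.\<close>

lemma cot_partial_fractions:
  fixes z :: complex
  assumes z: "z \<notin> \<int>"
  shows "(\<lambda>k. inverse (z + of_nat (Suc k)) - inverse (1 - z + of_nat k)) sums
    (of_real pi * (cos (of_real pi * z) / sin (of_real pi * z)) - inverse z)"
proof -
  have "z \<noteq> 0" "1 - z \<noteq> 0" using z by auto
  have D: "(\<lambda>k. inverse (of_nat (Suc k)) - inverse (w + of_nat k)) sums (Digamma w + euler_mascheroni)"
    if "w \<noteq> 0" for w :: complex
    using summable_sums[OF summable_Digamma[OF that]] by (simp add: Digamma_def)
  have tele: "(\<lambda>k. inverse (z + of_nat (Suc k)) - inverse (z + of_nat k)) sums (0 - inverse (z + of_nat 0))"
    by (intro telescope_sums filterlim_compose[OF tendsto_inverse_0]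
              tendsto_add_filterlim_at_infinity[OF tendsto_const] tendsto_of_nat)
  from sums_add[OF sums_diff[OF D[OF \<open>1 - z \<noteq> 0\<close>] D[OF \<open>z \<noteq> 0\<close>]] tele]
  show ?thesis using Digamma_reflection_complex[OF z] by (simp add: algebra_simps)
qed

text \<open>The cotangent expansion at the imaginary point i u / (2 pi), scaled by i / (2 pi). The
  limit is coth(u/2) / 2 - 1/u.\<close>

lemma coth_partial_fractions:
  fixes u :: real
  assumes u: "u > 0"
  shows "(\<lambda>k. 2 * u / (u ^ 2 + (2 * pi * real (Suc k)) ^ 2)) sums
    ((1 + exp (- u)) / (2 * (1 - exp (- u))) - 1 / u)"
proof -
  define z where "z = \<i> * of_real (u / (2 * pi))"
  have z: "z \<notin> \<int>" using u by (auto simp: z_def complex_is_Int_iff)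
  have pz: "of_real pi * z = \<i> * of_real (u / 2)" by (simp add: z_def)
  \<comment> \<open>At this point sine and cosine become rational expressions in
    \<open>e\<close>.\<close>
  define e where "e = exp (- u / 2)"
  have e: "0 < e" "e < 1" using u by (auto simp: e_def)
  have e2: "exp (- u) = e ^ 2" by (simp add: e_def exp_double[symmetric])
  have ii: "\<i> * (\<i> * of_real (u / 2)) = of_real (- u / 2)" "- (\<i> * (\<i> * of_real (u / 2))) = of_real (u / 2)"
    by simp_all
  have "exp (u / 2) = 1 / e" by (simp add: e_def exp_minus field_simps)
  then have ee: "exp (- (\<i> * (\<i> * of_real (u / 2)))) = of_real (1 / e)"
    unfolding ii(2) exp_of_real by (simp only:)
  have ee': "exp (\<i> * (\<i> * of_real (u / 2))) = of_real e"
    unfolding ii(1) exp_of_real e_def by (rule refl)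
  have e2lt: "e ^ 2 < 1" using e by (simp add: power_less_one_iff)
  have c1: "cos (of_real pi * z) = of_real ((e + 1 / e) / 2)"
    unfolding pz cos_exp_eq ee ee' by simp
  have s1: "sin (of_real pi * z) = - \<i> * of_real ((e - 1 / e) / 2)"
  proof -
    have "x / (2 * \<i>) = - \<i> * (x / 2)" for x by (simp add: field_simps)
    then show ?thesis unfolding pz sin_exp_eq ee ee' by simp
  qed
  have "(\<lambda>k. \<i> / (2 * of_real pi) * (inverse (z + of_nat (Suc k)) - inverse (1 - z + of_nat k))) sums
     (\<i> / (2 * of_real pi) * (of_real pi * (cos (of_real pi * z) / sin (of_real pi * z)) - inverse z))"
    by (rule sums_mult[OF cot_partial_fractions[OF z]])
  moreover have "\<i> / (2 * of_real pi) * (inverse (z + of_nat (Suc k)) - inverse (1 - z + of_nat k)) =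
      of_real (2 * u / (u ^ 2 + (2 * pi * real (Suc k)) ^ 2))" for k
  proof -
    define n :: complex where "n = of_nat (Suc k)"
    have n: "z + n \<noteq> 0" "n - z \<noteq> 0" by (auto simp: n_def z_def complex_eq_iff)
    have d: "u ^ 2 + (2 * pi * real (Suc k)) ^ 2 \<noteq> 0" using u by (smt (verit) zero_le_power2 zero_less_power)
    have "1 - z + of_nat k = n - z" by (simp add: n_def)
    then have "inverse (z + of_nat (Suc k)) - inverse (1 - z + of_nat k) = - 2 * z / (n ^ 2 - z ^ 2)"
      using n by (simp add: n_def[symmetric] field_simps power2_eq_square)
    also have "n ^ 2 - z ^ 2 = of_real ((u ^ 2 + (2 * pi * real (Suc k)) ^ 2) / (2 * pi) ^ 2)"
      by (simp add: n_def z_def power_mult_distrib power_divide field_simps del: of_nat_Suc)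
    also have "\<i> / (2 * of_real pi) * (- 2 * z / of_real ((u ^ 2 + (2 * pi * real (Suc k)) ^ 2) / (2 * pi) ^ 2)) =
        of_real (2 * u / (u ^ 2 + (2 * pi * real (Suc k)) ^ 2))"
      using d unfolding z_def by (simp add: power2_eq_square del: of_nat_Suc)
    finally show ?thesis .
  qed
  moreover have "\<i> / (2 * of_real pi) * (of_real pi * (cos (of_real pi * z) / sin (of_real pi * z)) - inverse z) =
      of_real ((1 + exp (- u)) / (2 * (1 - exp (- u))) - 1 / u)"
  proof -
    have "\<i> / (2 * of_real pi) * (of_real pi * (cos (of_real pi * z) / sin (of_real pi * z))) =
      of_real (- ((e + 1 / e) / 2 / (2 * ((e - 1 / e) / 2))))"
    proof -
      have "\<i> / (2 * of_real pi) * (of_real pi * (A / (- \<i> * B))) = - (A / (2 * B))" for A B :: complex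
        by (cases "B = 0") (auto simp: field_simps)
      then show ?thesis unfolding c1 s1 by (simp only: of_real_minus of_real_divide of_real_mult of_real_numeral)
    qed
    also have "- ((e + 1 / e) / 2 / (2 * ((e - 1 / e) / 2))) = (1 + e ^ 2) / (2 * (1 - e ^ 2))"
    proof -
      have "e - 1 / e = (e ^ 2 - 1) / e" "e + 1 / e = (1 + e ^ 2) / e"
        using e by (simp_all add: field_simps power2_eq_square)
      then show ?thesis using e e2lt by (simp add: divide_simps) (simp add: algebra_simps)
    qed
    finally have 1: "\<i> / (2 * of_real pi) * (of_real pi * (cos (of_real pi * z) / sin (of_real pi * z))) =
      of_real ((1 + e ^ 2) / (2 * (1 - e ^ 2)))" .
    have 2: "\<i> / (2 * of_real pi) * inverse z = of_real (1 / u)"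
      using u by (simp add: z_def divide_simps)
    show ?thesis unfolding right_diff_distrib 1 2 e2 by simp
  qed
  ultimately show ?thesis by (simp only: sums_of_real_iff)
qed

section \<open>Integral formulas: Gamma, Peano kernel and Beta integrals\<close>

lemma nn_integral_Gamma_scaled:
  fixes s y :: real
  assumes s: "s > 0" and y: "y > 0"
  shows "(\<integral>\<^sup>+u. ennreal (indicator {0..} u * (u powr (s - 1) * exp (- y * u))) \<partial>lborel) = ennreal (Gamma s * y powr (- s))"
proof -
  have "ennreal (Gamma s) = (\<integral>\<^sup>+t. ennreal (indicator {0..} t * t powr (s - 1) / exp t) \<partial>lborel)"
    by (rule Gamma_conv_nn_integral_real[OF s])
  also have "\<dots> = ennreal \<bar>y\<bar> * (\<integral>\<^sup>+u. ennreal (indicator {0..} (0 + y * u) * (0 + y * u) powr (s - 1) / exp (0 + y * u)) \<partial>lborel)"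
    by (rule nn_integral_real_affine) (use y in auto)
  also have "(\<integral>\<^sup>+u. ennreal (indicator {0..} (0 + y * u) * (0 + y * u) powr (s - 1) / exp (0 + y * u)) \<partial>lborel) =
     (\<integral>\<^sup>+u. ennreal (y powr (s - 1)) * ennreal (indicator {0..} u * (u powr (s - 1) * exp (- y * u))) \<partial>lborel)"
    using y by (intro nn_integral_cong)
      (auto simp: indicator_def powr_mult exp_minus field_simps zero_le_mult_iff ennreal_mult'[symmetric])
  also have "\<dots> = ennreal (y powr (s - 1)) * (\<integral>\<^sup>+u. ennreal (indicator {0..} u * (u powr (s - 1) * exp (- y * u))) \<partial>lborel)"
    by (rule nn_integral_cmult) auto
  also have "ennreal \<bar>y\<bar> * \<dots> = ennreal (y powr s) * (\<integral>\<^sup>+u. ennreal (indicator {0..} u * (u powr (s - 1) * exp (- y * u))) \<partial>lborel)"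
    using y by (simp add: mult.assoc[symmetric] ennreal_mult'[symmetric] powr_mult_base)
  finally have "ennreal (y powr (- s)) * ennreal (Gamma s) =
     ennreal (y powr (- s)) * ennreal (y powr s) * (\<integral>\<^sup>+u. ennreal (indicator {0..} u * (u powr (s - 1) * exp (- y * u))) \<partial>lborel)"
    by (simp add: mult.assoc)
  moreover have "ennreal (y powr (- s)) * ennreal (y powr s) = 1"
    using y by (simp add: ennreal_mult'[symmetric] powr_add[symmetric])
  ultimately show ?thesis
    using Gamma_real_pos[OF s] by (simp add: ennreal_mult'[symmetric] mult.commute)
qed

text \<open>\<open>x * (1 - x) / 2\<close> is the Peano kernel of the trapezoidal rule. The
  antiderivative \<open>K\<close> packs two integrations by parts into one. Continuity is asked of
  the product with \<open>g\<close> only, so \<open>g\<close> itself may blow up at an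
  endpoint.\<close>

lemma has_integral_trapezoid_kernel:
  fixes f F g h :: "real \<Rightarrow> real"
  assumes F: "\<And>x. x \<in> {0<..<1} \<Longrightarrow> (F has_field_derivative f x) (at x)"
    and f: "\<And>x. x \<in> {0<..<1} \<Longrightarrow> (f has_field_derivative g x) (at x)"
    and g: "\<And>x. x \<in> {0<..<1} \<Longrightarrow> (g has_field_derivative h x) (at x)"
    and cont: "continuous_on {0..1} F" "continuous_on {0..1} f" "continuous_on {0..1} (\<lambda>x. x * (1 - x) / 2 * g x)"
  shows "((\<lambda>x. x * (1 - x) / 2 * h x) has_integral ((f 0 + f 1) / 2 - (F 1 - F 0))) {0..1}"
proof -
  define K where "K x = x * (1 - x) / 2 * g x - (1 / 2 - x) * f x - F x" for x
  have "((\<lambda>x. x * (1 - x) / 2 * h x) has_integral (K 1 - K 0)) {0..1}"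
  proof (rule fundamental_theorem_of_calculus_interior)
    show "continuous_on {0..1} K"
      unfolding K_def by (intro continuous_intros cont)
    fix x :: real assume x: "x \<in> {0<..<1}"
    have "(K has_field_derivative x * (1 - x) / 2 * h x) (at x)"
      unfolding K_def
      by (rule derivative_eq_intros refl F[OF x] f[OF x] g[OF x] zero_neq_numeral[symmetric])+
         (simp add: field_simps)
    then show "(K has_vector_derivative x * (1 - x) / 2 * h x) (at x)"
      by (simp add: has_real_derivative_iff_has_vector_derivative)
  qed simp
  moreover have "K 1 - K 0 = (f 0 + f 1) / 2 - (F 1 - F 0)"
    by (simp add: K_def algebra_simps add_divide_distrib)
  ultimately show ?thesis by (simp only:)
qed

text \<open>The kernel formula for \<open>exp (- x * u)\<close>, divided by \<open>u ^ 2\<close>; it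
  evaluates the inner integral once powers have been replaced by Gamma integrals.\<close>

lemma has_integral_trapezoid_kernel_exp:
  fixes u :: real
  assumes u: "u > 0"
  shows "((\<lambda>x. x * (1 - x) / 2 * exp (- x * u)) has_integral
     (((1 + exp (- u)) / 2 - (1 - exp (- u)) / u) / u ^ 2)) {0..1}"
proof -
  have "((\<lambda>x. x * (1 - x) / 2 * (u ^ 2 * exp (- x * u))) has_integral
     ((exp (- 0 * u) + exp (- 1 * u)) / 2 - (- exp (- 1 * u) / u - (- exp (- 0 * u) / u)))) {0..1}"
    by (rule has_integral_trapezoid_kernel[where g = "\<lambda>x. - u * exp (- x * u)"])
       (use u in \<open>auto intro!: derivative_eq_intros continuous_intros simp: power2_eq_square\<close>)
  from has_integral_divide[OF this, of "u ^ 2"]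
  have "((\<lambda>x. x * (1 - x) / 2 * (u ^ 2 * exp (- x * u)) / u ^ 2) has_integral
     (((1 + exp (- u)) / 2 - (1 - exp (- u)) / u) / u ^ 2)) {0..1}"
    by (simp add: diff_divide_distrib)
  moreover have "x * (1 - x) / 2 * (u ^ 2 * exp (- x * u)) / u ^ 2 = x * (1 - x) / 2 * exp (- x * u)" for x
    using u by simp
  ultimately show ?thesis by (simp only:)
qed

lemma has_integral_trapezoid_kernel_powr:
  fixes \<alpha> :: real
  assumes \<alpha>: "0 < \<alpha>" "\<alpha> < 1"
  shows "((\<lambda>x. x * (1 - x) / 2 * (\<alpha> * (1 - \<alpha>) * (real n + x) powr (\<alpha> - 2))) has_integral
     ((real (n + 1) powr (1 + \<alpha>) - real n powr (1 + \<alpha>)) / (1 + \<alpha>)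
       - (real n powr \<alpha> + real (n + 1) powr \<alpha>) / 2)) {0..1}"
proof -
  have I: "((\<lambda>x. x * (1 - x) / 2 * (\<alpha> * ((\<alpha> - 1) * (real n + x) powr (\<alpha> - 2)))) has_integral
     (((real n + 0) powr \<alpha> + (real n + 1) powr \<alpha>) / 2 -
       ((real n + 1) powr (1 + \<alpha>) / (1 + \<alpha>) - (real n + 0) powr (1 + \<alpha>) / (1 + \<alpha>)))) {0..1}"
  proof (rule has_integral_trapezoid_kernel[where g = "\<lambda>x. \<alpha> * (real n + x) powr (\<alpha> - 1)"])
    show "continuous_on {0..1} (\<lambda>x. (real n + x) powr (1 + \<alpha>) / (1 + \<alpha>))"
      "continuous_on {0..1} (\<lambda>x. (real n + x) powr \<alpha>)"
      using \<alpha> by (auto intro!: continuous_intros continuous_on_powr')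
    show "continuous_on {0..1} (\<lambda>x. x * (1 - x) / 2 * (\<alpha> * (real n + x) powr (\<alpha> - 1)))"
    \<comment> \<open>For \<open>n = 0\<close> the power is unbounded near 0; the factor
      \<open>x\<close> of the kernel turns it into the continuous
      \<open>x powr \<alpha>\<close>.\<close>
    proof (cases "n = 0")
      case True
      have "continuous_on {0..1} (\<lambda>x. (1 - x) / 2 * (\<alpha> * x powr \<alpha>))"
        using \<alpha> by (auto intro!: continuous_intros continuous_on_powr')
      moreover have "x * (1 - x) / 2 * (\<alpha> * (real n + x) powr (\<alpha> - 1)) = (1 - x) / 2 * (\<alpha> * x powr \<alpha>)"
        if "x \<in> {0..1}" for x
        using that True powr_mult_base[of x "\<alpha> - 1"] by (simp add: mult_ac)
      ultimately show ?thesis by (subst continuous_on_cong[OF refl]) auto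
    next
      case False
      then show ?thesis by (auto intro!: continuous_intros)
    qed
    fix x :: real assume x: "x \<in> {0<..<1}"
    then have nx: "real n + x > 0" by (simp add: add_nonneg_pos)
    have d: "((\<lambda>x. (real n + x) powr b) has_field_derivative b * (real n + x) powr (b - 1)) (at x)" for b
      using nx by (auto intro!: derivative_eq_intros)
    show "((\<lambda>x. (real n + x) powr (1 + \<alpha>) / (1 + \<alpha>)) has_field_derivative (real n + x) powr \<alpha>) (at x)"
      using DERIV_cdivide[OF d[of "1 + \<alpha>"], of "1 + \<alpha>"] \<alpha> by simp
    show "((\<lambda>x. (real n + x) powr \<alpha>) has_field_derivative \<alpha> * (real n + x) powr (\<alpha> - 1)) (at x)"
      by (rule d)
    show "((\<lambda>x. \<alpha> * (real n + x) powr (\<alpha> - 1)) has_field_derivative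
        \<alpha> * ((\<alpha> - 1) * (real n + x) powr (\<alpha> - 2))) (at x)"
      using DERIV_cmult[OF d[of "\<alpha> - 1"], of \<alpha>] by simp
  qed
  have e1: "- (x * (1 - x) / 2 * (\<alpha> * ((\<alpha> - 1) * (real n + x) powr (\<alpha> - 2)))) =
      x * (1 - x) / 2 * (\<alpha> * (1 - \<alpha>) * (real n + x) powr (\<alpha> - 2))" for x
    by (simp add: algebra_simps)
  have e2: "- (((real n + 0) powr \<alpha> + (real n + 1) powr \<alpha>) / 2 -
       ((real n + 1) powr (1 + \<alpha>) / (1 + \<alpha>) - (real n + 0) powr (1 + \<alpha>) / (1 + \<alpha>))) =
     (real (n + 1) powr (1 + \<alpha>) - real n powr (1 + \<alpha>)) / (1 + \<alpha>)
       - (real n powr \<alpha> + real (n + 1) powr \<alpha>) / 2"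
    by (simp add: diff_divide_distrib add_ac)
  show ?thesis using has_integral_neg[OF I] unfolding e1 e2 .
qed

text \<open>The substitution t = v^2 / (1 + v^2) turns the Beta integral with parameters
  \<open>p\<close> and \<open>q\<close> into twice this one. As \<open>p + q = 1\<close>, the Beta
  value is \<open>Gamma p * Gamma (1 - p)\<close>, known from the reflection formula.\<close>

lemma has_integral_powr_div_one_plus_square:
  fixes \<alpha> :: real
  assumes \<alpha>: "0 < \<alpha>" "\<alpha> < 1"
  shows "((\<lambda>v. v powr (- \<alpha>) / (1 + v ^ 2)) has_integral (pi / (2 * cos (pi * \<alpha> / 2)))) {0<..}"
proof -
  define p where "p = (1 - \<alpha>) / 2"
  define q where "q = (1 + \<alpha>) / 2"
  have pq: "p > 0" "q > 0" "p + q = 1" using \<alpha> by (auto simp: p_def q_def field_simps)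
  define f where "f t = t powr (p - 1) * (1 - t) powr (q - 1)" for t :: real
  define g where "g v = v ^ 2 / (1 + v ^ 2)" for v :: real
  define g' where "g' v = 2 * v / (1 + v ^ 2) ^ 2" for v :: real
  have pos: "1 + v ^ 2 > 0" for v :: real by (simp add: add_pos_nonneg)
  have g: "(g has_field_derivative g' v) (at v within S)" for v S
    unfolding g_def g'_def using pos[of v]
    by (auto intro!: derivative_eq_intros simp: field_simps power2_eq_square)
  have inj: "inj_on g {0<..}"
  proof (rule inj_onI)
    fix x y :: real assume xy: "x \<in> {0<..}" "y \<in> {0<..}" "g x = g y"
    then have "x ^ 2 = y ^ 2" using pos[of x] pos[of y] by (simp add: g_def field_simps)
    then show "x = y" using xy by (simp add: power2_eq_iff)
  qed
  have img: "g ` {0<..} = {0<..<1}"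
  proof (intro equalityI subsetI)
    fix t :: real assume t: "t \<in> {0<..<1}"
    define v where "v = sqrt (t / (1 - t))"
    have "v > 0" "v ^ 2 = t / (1 - t)" using t by (auto simp: v_def)
    then have "1 + v ^ 2 = 1 / (1 - t)" using t by (simp add: field_simps)
    then have "t = g v" using t \<open>v ^ 2 = t / (1 - t)\<close> by (simp add: g_def)
    then show "t \<in> g ` {0<..}" using \<open>v > 0\<close> by auto
  qed (use pos in \<open>auto simp: g_def field_simps\<close>)
  have "(f has_integral Beta p q) {0..1}"
    unfolding f_def by (rule has_integral_Beta_real) (use pq in auto)
  then have hi: "(f has_integral Beta p q) {0<..<1}" by (simp add: has_integral_Icc_iff_Ioo)
  have "f absolutely_integrable_on {0<..<1}"
    by (rule nonnegative_absolutely_integrable_1) (use hi in \<open>auto simp: f_def\<close>)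
  with hi have *: "(\<lambda>v. \<bar>g' v\<bar> * f (g v)) absolutely_integrable_on {0<..} \<and>
      integral {0<..} (\<lambda>v. \<bar>g' v\<bar> * f (g v)) = Beta p q"
    by (subst has_absolute_integral_change_of_variables_1'[OF _ g inj]) (auto simp: img integral_unique)
  then have "((\<lambda>v. \<bar>g' v\<bar> * f (g v)) has_integral Beta p q) {0<..}"
    using set_lebesgue_integral_eq_integral(1) has_integral_integral by metis
  then have *: "((\<lambda>v. 2 * (v powr (- \<alpha>) / (1 + v ^ 2))) has_integral Beta p q) {0<..}"
  proof (rule has_integral_eq[rotated])
    fix v :: real assume v: "v \<in> {0<..}"
    define w where "w = 1 + v ^ 2"
    have w: "w > 0" using pos[of v] by (simp add: w_def)
    have g1: "g v = v powr 2 * w powr (- 1)" using v w by (simp add: g_def w_def powr_minus divide_inverse)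
    have g2: "1 - g v = w powr (- 1)" using w by (simp add: g_def w_def powr_minus field_simps)
    have g3: "\<bar>g' v\<bar> = 2 * v powr 1 * w powr (- 2)"
      using v w by (simp add: g'_def w_def powr_minus field_simps)
    have "\<bar>g' v\<bar> * f (g v) = 2 * (v powr 1 * (v powr 2) powr (p - 1)) *
        (w powr (- 2) * (w powr (- 1)) powr (p - 1) * (w powr (- 1)) powr (q - 1))"
      unfolding f_def g2 g3 unfolding g1 using v w by (subst powr_mult) auto
    also have "v powr 1 * (v powr 2) powr (p - 1) = v powr (1 + 2 * (p - 1))"
      by (simp only: powr_powr powr_add)
    also have "w powr (- 2) * (w powr (- 1)) powr (p - 1) * (w powr (- 1)) powr (q - 1) =
        w powr (- 2 + - 1 * (p - 1) + - 1 * (q - 1))"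
      by (simp only: powr_powr powr_add)
    also have "- 2 + - 1 * (p - 1) + - 1 * (q - 1) = - 1" using pq by simp
    also have "1 + 2 * (p - 1) = - \<alpha>" by (simp add: p_def field_simps)
    finally show "\<bar>g' v\<bar> * f (g v) = 2 * (v powr (- \<alpha>) / (1 + v ^ 2))"
      using w by (simp add: w_def powr_minus field_simps)
  qed
  have "((\<lambda>v. v powr (- \<alpha>) / (1 + v ^ 2)) has_integral (Beta p q / 2)) {0<..}"
  proof -
    have c: "2 * y / 2 = y" for y :: real by simp
    show ?thesis using has_integral_divide[OF *, of 2] unfolding c .
  qed
  moreover have "Beta p q = pi / cos (pi * \<alpha> / 2)"
  proof -
    have "complex_of_real (Gamma p * Gamma (1 - p)) = of_real (pi / sin (pi * p))"
    proof -
      have e: "1 - of_real p = (of_real (1 - p) :: complex)" by simp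
      show ?thesis
        using Gamma_reflection_complex[of "of_real p"]
        by (simp only: e Gamma_complex_of_real of_real_mult[symmetric] sin_of_real of_real_divide[symmetric])
    qed
    then have "Gamma p * Gamma (1 - p) = pi / sin (pi * p)" by (simp only: of_real_eq_iff)
    moreover have "q = 1 - p" using pq by simp
    moreover have "sin (pi * p) = cos (pi * \<alpha> / 2)"
      by (simp add: p_def cos_sin_eq field_simps)
    ultimately have "Gamma p * Gamma q = pi / cos (pi * \<alpha> / 2)" by (simp only:)
    then show ?thesis using pq(3) by (simp add: Beta_def)
  qed
  ultimately show ?thesis by (simp add: mult.commute)
qed

lemma nn_integral_powr_div_square_plus_square:
  fixes \<alpha> w :: real
  assumes \<alpha>: "0 < \<alpha>" "\<alpha> < 1" and w: "w > 0"
  shows "(\<integral>\<^sup>+u. ennreal (indicator {0<..} u * (u powr (- \<alpha>) / (u ^ 2 + w ^ 2))) \<partial>lborel) =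
    ennreal (w powr (- 1 - \<alpha>) * (pi / (2 * cos (pi * \<alpha> / 2))))"
proof -
  define B where "B = pi / (2 * cos (pi * \<alpha> / 2))"
  have B: "(\<integral>\<^sup>+v. ennreal (indicator {0<..} v * (v powr (- \<alpha>) / (1 + v ^ 2))) \<partial>lborel) = ennreal B"
    unfolding B_def by (rule nn_integral_has_integral_lebesgue)
      (auto intro!: has_integral_powr_div_one_plus_square \<alpha>)
  have "(\<integral>\<^sup>+u. ennreal (indicator {0<..} u * (u powr (- \<alpha>) / (u ^ 2 + w ^ 2))) \<partial>lborel) =
     ennreal \<bar>w\<bar> * (\<integral>\<^sup>+v. ennreal (indicator {0<..} (0 + w * v) * ((0 + w * v) powr (- \<alpha>) / ((0 + w * v) ^ 2 + w ^ 2))) \<partial>lborel)"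
    by (rule nn_integral_real_affine) (use w in auto)
  also have "(\<integral>\<^sup>+v. ennreal (indicator {0<..} (0 + w * v) * ((0 + w * v) powr (- \<alpha>) / ((0 + w * v) ^ 2 + w ^ 2))) \<partial>lborel) =
     (\<integral>\<^sup>+v. ennreal (w powr (- \<alpha> - 2)) * ennreal (indicator {0<..} v * (v powr (- \<alpha>) / (1 + v ^ 2))) \<partial>lborel)"
  proof (intro nn_integral_cong)
    fix v :: real
    show "ennreal (indicator {0<..} (0 + w * v) * ((0 + w * v) powr (- \<alpha>) / ((0 + w * v) ^ 2 + w ^ 2))) =
      ennreal (w powr (- \<alpha> - 2)) * ennreal (indicator {0<..} v * (v powr (- \<alpha>) / (1 + v ^ 2)))"
    proof (cases "v > 0")
      case True
      have "(w * v) powr (- \<alpha>) / ((w * v) ^ 2 + w ^ 2) = (w powr (- \<alpha>) / w ^ 2) * (v powr (- \<alpha>) / (1 + v ^ 2))"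
        using True w by (simp add: powr_mult power_mult_distrib field_simps)
      also have "w powr (- \<alpha>) / w ^ 2 = w powr (- \<alpha> - 2)" using w by (simp add: powr_diff)
      finally show ?thesis using True w by (simp add: ennreal_mult'[symmetric])
    next
      case False
      then show ?thesis using w by (simp add: zero_less_mult_iff)
    qed
  qed
  also have "\<dots> = ennreal (w powr (- \<alpha> - 2)) * ennreal B"
    by (subst nn_integral_cmult, simp, simp only: B)
  also have "ennreal \<bar>w\<bar> * \<dots> = ennreal (w * w powr (- \<alpha> - 2) * B)"
    using w by (simp add: ennreal_mult'[symmetric] mult.assoc)
  also have "w * w powr (- \<alpha> - 2) = w powr (- 1 - \<alpha>)"
    using w by (simp add: powr_mult_base)
  finally show ?thesis by (simp add: B_def)
qed

section \<open>Zeta on the interval (-1, 0)\<close>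

text \<open>Minus the trapezoid error of \<open>x powr \<alpha>\<close> on \<open>[n, n + 1]\<close>. The interval with \<open>n = 0\<close> is included:
  as \<open>0 powr \<alpha> = 0\<close>, its defect is exactly the elementary part of zeta at \<open>- \<alpha>\<close>.\<close>

definition trapezoid_defect :: "real \<Rightarrow> nat \<Rightarrow> real" where
  "trapezoid_defect \<alpha> n = (real (n + 1) powr (1 + \<alpha>) - real n powr (1 + \<alpha>)) / (1 + \<alpha>)
       - (real n powr \<alpha> + real (n + 1) powr \<alpha>) / 2"

text \<open>The Peano kernel representation has a nonnegative integrand. The sign is what allows
  sums and integrals to be exchanged by Tonelli.\<close>

lemma trapezoid_defect_nonneg:
  assumes \<alpha>: "0 < \<alpha>" "\<alpha> < 1"
  shows "trapezoid_defect \<alpha> n \<ge> 0"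
  unfolding trapezoid_defect_def
  by (rule has_integral_nonneg[OF has_integral_trapezoid_kernel_powr[OF \<alpha>]]) (use \<alpha> in auto)

lemma trapezoid_defect_sums:
  assumes \<alpha>: "0 < \<alpha>" "\<alpha> < 1"
  shows "summable (trapezoid_defect \<alpha>)" "zeta (of_real (- \<alpha>)) = - of_real (\<Sum>n. trapezoid_defect \<alpha> n)"
proof -
  have s: "complex_of_real (- \<alpha>) \<noteq> 1" "Re (of_real (- \<alpha>)) > -1"
    using \<alpha> by (auto simp: complex_eq_iff)
  \<comment> \<open>The indices differ by one: the error with index \<open>n\<close> lives on
    [n + 1, n + 2], the defect with index \<open>n\<close> on [n, n + 1].\<close>
  have eq: "trapezoid_error n (of_real (- \<alpha>)) = of_real (- trapezoid_defect \<alpha> (Suc n))" for n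
  proof -
    have p: "of_nat m powr of_real x = (of_real (real m powr x) :: complex)" for m x
      using powr_of_real[of "real m" x] by simp
    have "1 - complex_of_real (- \<alpha>) = of_real (1 + \<alpha>)" "- complex_of_real (- \<alpha>) = of_real \<alpha>" by simp_all
    then have "trapezoid_error n (of_real (- \<alpha>)) =
       (of_real (real (n + 1) powr \<alpha>) + of_real (real (n + 2) powr \<alpha>)) / 2 -
       (of_real (real (n + 2) powr (1 + \<alpha>)) - of_real (real (n + 1) powr (1 + \<alpha>))) / of_real (1 + \<alpha>)"
      unfolding trapezoid_error_def by (simp only: p)
    also have "\<dots> = of_real ((real (n + 1) powr \<alpha> + real (n + 2) powr \<alpha>) / 2 -
       (real (n + 2) powr (1 + \<alpha>) - real (n + 1) powr (1 + \<alpha>)) / (1 + \<alpha>))"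
      by (simp only: of_real_add of_real_diff of_real_divide of_real_numeral)
    also have "(real (n + 1) powr \<alpha> + real (n + 2) powr \<alpha>) / 2 -
       (real (n + 2) powr (1 + \<alpha>) - real (n + 1) powr (1 + \<alpha>)) / (1 + \<alpha>) = - trapezoid_defect \<alpha> (Suc n)"
      by (simp add: trapezoid_defect_def)
    finally show ?thesis .
  qed
  have sm: "summable (\<lambda>n. complex_of_real (- trapezoid_defect \<alpha> (Suc n)))"
    using summable_trapezoid_error[OF s] unfolding eq .
  then have "summable (\<lambda>n. - trapezoid_defect \<alpha> (Suc n))" by (simp only: summable_of_real_iff)
  then have sS: "summable (\<lambda>n. trapezoid_defect \<alpha> (Suc n))" by (simp add: summable_minus_iff)
  then show sd: "summable (trapezoid_defect \<alpha>)" by (simp add: summable_Suc_iff)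
  have "zeta (of_real (- \<alpha>)) = 1 / 2 + 1 / (of_real (- \<alpha>) - 1) + (\<Sum>n. of_real (- trapezoid_defect \<alpha> (Suc n)))"
    using zeta_trapezoid[OF s(2,1)] unfolding eq .
  also have "(\<Sum>n. complex_of_real (- trapezoid_defect \<alpha> (Suc n))) = of_real (- (\<Sum>n. trapezoid_defect \<alpha> (Suc n)))"
    using sS by (simp add: suminf_of_real[symmetric] suminf_minus)
  also have "(\<Sum>n. trapezoid_defect \<alpha> (Suc n)) = (\<Sum>n. trapezoid_defect \<alpha> n) - trapezoid_defect \<alpha> 0"
    by (rule suminf_split_head[OF sd])
  also have "1 / 2 + 1 / (complex_of_real (- \<alpha>) - 1) = of_real (1 / 2 + 1 / (- \<alpha> - 1))" by simp
  also have "1 / 2 + 1 / (- \<alpha> - 1) = - trapezoid_defect \<alpha> 0"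
    using \<alpha> by (simp add: trapezoid_defect_def field_simps)
  finally show "zeta (of_real (- \<alpha>)) = - of_real (\<Sum>n. trapezoid_defect \<alpha> n)" by simp
qed

text \<open>In the Peano representation the power of \<open>real n + x\<close> is written as a Gamma
  integral with parameter \<open>2 - \<alpha>\<close>; Tonelli then leaves the kernel integral of an
  exponential. The constant arises from
  \<open>Gamma (2 - \<alpha>) = (1 - \<alpha>) * Gamma (1 - \<alpha>)\<close>.\<close>

lemma ennreal_trapezoid_defect:
  assumes \<alpha>: "0 < \<alpha>" "\<alpha> < 1"
  shows "ennreal (trapezoid_defect \<alpha> n) = ennreal (\<alpha> / Gamma (1 - \<alpha>)) *
    (\<integral>\<^sup>+u. ennreal (indicator {0<..} u * (u powr (- 1 - \<alpha>) * ((1 + exp (- u)) / 2 - (1 - exp (- u)) / u) * exp (- u) ^ n)) \<partial>lborel)"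
proof -
  define c where "c = \<alpha> / Gamma (1 - \<alpha>)"
  have G: "Gamma (1 - \<alpha>) > 0" using \<alpha> by (intro Gamma_real_pos) simp
  have G2: "Gamma (2 - \<alpha>) = (1 - \<alpha>) * Gamma (1 - \<alpha>)"
  proof -
    have "1 - \<alpha> \<notin> \<int>\<^sub>\<le>\<^sub>0" using \<alpha> by (auto elim!: nonpos_Ints_cases)
    from Gamma_plus1[OF this] show ?thesis by (simp add: add.commute)
  qed
  have c: "c \<ge> 0" "c * Gamma (2 - \<alpha>) = \<alpha> * (1 - \<alpha>)"
  proof -
    show "c \<ge> 0" unfolding c_def by (rule divide_nonneg_pos[OF _ G]) (use \<alpha> in simp)
    have "Gamma (1 - \<alpha>) \<noteq> 0" by (rule less_imp_neq[OF G, symmetric])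
    then show "c * Gamma (2 - \<alpha>) = \<alpha> * (1 - \<alpha>)" by (simp add: c_def G2)
  qed
  define k where "k x = indicator {0..1} x * (x * (1 - x) / 2)" for x :: real
  have k0: "k x \<ge> 0" for x by (simp add: k_def indicator_def)
  have [measurable]: "k \<in> borel_measurable borel" unfolding k_def by measurable
  define h where "h x u = k x * (indicator {0..} u * (u powr (1 - \<alpha>) * exp (- (real n + x) * u)))" for x u :: real
  have "ennreal (trapezoid_defect \<alpha> n) =
     (\<integral>\<^sup>+x. ennreal (indicator {0..1} x * (x * (1 - x) / 2 * (\<alpha> * (1 - \<alpha>) * (real n + x) powr (\<alpha> - 2)))) \<partial>lborel)"
    unfolding trapezoid_defect_def
    by (rule nn_integral_has_integral_lebesgue[symmetric, OF _ has_integral_trapezoid_kernel_powr[OF \<alpha>]])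
       (use \<alpha> in auto)
  also have "\<dots> = (\<integral>\<^sup>+x. ennreal c * (\<integral>\<^sup>+u. ennreal (h x u) \<partial>lborel) \<partial>lborel)"
  proof (rule nn_integral_cong)
    fix x :: real
    show "ennreal (indicator {0..1} x * (x * (1 - x) / 2 * (\<alpha> * (1 - \<alpha>) * (real n + x) powr (\<alpha> - 2)))) =
       ennreal c * (\<integral>\<^sup>+u. ennreal (h x u) \<partial>lborel)"
    \<comment> \<open>The point 0 is split off because \<open>real n + x\<close> can vanish there;
      the kernel is 0 at this point.\<close>
    proof (cases "x \<in> {0<..1}")
      case True
      then have nx: "real n + x > 0" by (simp add: add_nonneg_pos)
      have "(\<integral>\<^sup>+u. ennreal (h x u) \<partial>lborel) = (\<integral>\<^sup>+u. ennreal (k x) *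
          ennreal (indicator {0..} u * (u powr ((2 - \<alpha>) - 1) * exp (- (real n + x) * u))) \<partial>lborel)"
        unfolding h_def by (intro nn_integral_cong) (simp add: ennreal_mult'[OF k0])
      also have "\<dots> = ennreal (k x) * ennreal (Gamma (2 - \<alpha>) * (real n + x) powr (- (2 - \<alpha>)))"
        by (subst nn_integral_cmult, simp, subst nn_integral_Gamma_scaled) (use \<alpha> nx in auto)
      finally have "ennreal c * (\<integral>\<^sup>+u. ennreal (h x u) \<partial>lborel) =
          ennreal (c * (k x * (Gamma (2 - \<alpha>) * (real n + x) powr (\<alpha> - 2))))"
        using c k0 by (simp add: ennreal_mult')
      also have "c * (k x * (Gamma (2 - \<alpha>) * (real n + x) powr (\<alpha> - 2))) =
          k x * (c * Gamma (2 - \<alpha>) * (real n + x) powr (\<alpha> - 2))"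
        by (simp add: mult_ac)
      finally show ?thesis unfolding c(2) k_def by (simp add: mult.assoc)
    next
      case False
      then have "k x = 0" by (cases "x = 0") (auto simp: k_def indicator_def)
      then have e0: "indicator {0..1} x * (x * (1 - x) / 2 * (\<alpha> * (1 - \<alpha>) * (real n + x) powr (\<alpha> - 2))) = 0"
        unfolding k_def by (auto simp: indicator_def)
      show ?thesis by (simp only: e0 h_def \<open>k x = 0\<close>) simp
    qed
  qed
  also have "\<dots> = ennreal c * (\<integral>\<^sup>+x. (\<integral>\<^sup>+u. ennreal (h x u) \<partial>lborel) \<partial>lborel)"
    unfolding h_def by (rule nn_integral_cmult) measurable
  also have "(\<integral>\<^sup>+x. (\<integral>\<^sup>+u. ennreal (h x u) \<partial>lborel) \<partial>lborel) =
     (\<integral>\<^sup>+u. (\<integral>\<^sup>+x. ennreal (h x u) \<partial>lborel) \<partial>lborel)"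
    unfolding h_def by (rule lborel_pair.Fubini'[symmetric]) measurable
  also have "\<dots> = (\<integral>\<^sup>+u. ennreal (indicator {0<..} u * (u powr (- 1 - \<alpha>) * ((1 + exp (- u)) / 2 - (1 - exp (- u)) / u) * exp (- u) ^ n)) \<partial>lborel)"
  proof (rule nn_integral_cong)
    fix u :: real
    show "(\<integral>\<^sup>+x. ennreal (h x u) \<partial>lborel) =
      ennreal (indicator {0<..} u * (u powr (- 1 - \<alpha>) * ((1 + exp (- u)) / 2 - (1 - exp (- u)) / u) * exp (- u) ^ n))"
    proof (cases "u > 0")
      case True
      define E where "E = (1 + exp (- u)) / 2 - (1 - exp (- u)) / u"
      have e: "exp (- (real n + x) * u) = exp (- u) ^ n * exp (- x * u)" for x
        by (simp add: exp_of_nat_mult[symmetric] mult_exp_exp algebra_simps)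
      have "(\<integral>\<^sup>+x. ennreal (h x u) \<partial>lborel) = (\<integral>\<^sup>+x. ennreal (u powr (1 - \<alpha>) * exp (- u) ^ n) *
          ennreal (indicator {0..1} x * (x * (1 - x) / 2 * exp (- x * u))) \<partial>lborel)"
        using True unfolding h_def k_def e
        by (intro nn_integral_cong) (simp add: ennreal_mult'[symmetric] mult_ac)
      also have "\<dots> = ennreal (u powr (1 - \<alpha>) * exp (- u) ^ n) *
          (\<integral>\<^sup>+x. ennreal (indicator {0..1} x * (x * (1 - x) / 2 * exp (- x * u))) \<partial>lborel)"
        by (rule nn_integral_cmult) measurable
      also have "(\<integral>\<^sup>+x. ennreal (indicator {0..1} x * (x * (1 - x) / 2 * exp (- x * u))) \<partial>lborel) = ennreal (E / u ^ 2)"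
        unfolding E_def by (rule nn_integral_has_integral_lebesgue[OF _ has_integral_trapezoid_kernel_exp[OF True]]) auto
      also have "ennreal (u powr (1 - \<alpha>) * exp (- u) ^ n) * ennreal (E / u ^ 2) =
          ennreal ((u powr (1 - \<alpha>) / u ^ 2) * E * exp (- u) ^ n)"
        by (subst ennreal_mult'[symmetric]) (auto simp: mult_ac)
      also have "u powr (1 - \<alpha>) / u ^ 2 = u powr (- 1 - \<alpha>)"
        using True powr_diff[of u "1 - \<alpha>" 2] by simp
      finally show ?thesis using True by (simp add: E_def)
    next
      case False
      then have "h x u = 0" for x by (cases "u = 0") (auto simp: h_def indicator_def)
      then show ?thesis using False by simp
    qed
  qed
  finally show ?thesis by (simp add: c_def)
qed

text \<open>Summing the defects gives a geometric series in \<open>exp (- u)\<close>, hence a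
  hyperbolic cotangent under the integral. Its partial fractions have the parameters
  \<open>w k\<close>, each term integrates to a multiple of
  \<open>w k powr (- 1 - \<alpha>)\<close>, and these powers add up to zeta at
  \<open>1 + \<alpha>\<close>.\<close>

lemma zeta_neg_real:
  assumes \<alpha>: "0 < \<alpha>" "\<alpha> < 1"
  shows "zeta (of_real (- \<alpha>)) = - of_real (\<alpha> / Gamma (1 - \<alpha>) * (2 * pi) powr (- 1 - \<alpha>) *
    (pi / cos (pi * \<alpha> / 2))) * zeta (of_real (1 + \<alpha>))"
proof -
  define c where "c = \<alpha> / Gamma (1 - \<alpha>)"
  define E where "E u = u powr (- 1 - \<alpha>) * ((1 + exp (- u)) / 2 - (1 - exp (- u)) / u)" for u
  define B where "B = pi / (2 * cos (pi * \<alpha> / 2))"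
  define w where "w k = 2 * pi * real (Suc k)" for k
  define Z where "Z = (\<Sum>k. real (Suc k) powr (- 1 - \<alpha>))"
  have c0: "c \<ge> 0" using Gamma_real_pos[of "1 - \<alpha>"] \<alpha> by (simp add: c_def)
  have w0: "w k > 0" for k by (simp add: w_def)
  have "cos (pi * \<alpha> / 2) > 0" by (rule cos_gt_zero) (use \<alpha> in auto)
  then have B0: "B \<ge> 0" by (simp add: B_def)
  have sZ: "summable (\<lambda>k. real (Suc k) powr (- 1 - \<alpha>))"
    using \<alpha> by (subst summable_Suc_iff) (simp add: summable_real_powr_iff)
  have Z0: "Z \<ge> 0" unfolding Z_def by (intro suminf_nonneg sZ) auto
  have "ennreal (\<Sum>n. trapezoid_defect \<alpha> n) = (\<Sum>n. ennreal (trapezoid_defect \<alpha> n))"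
    by (rule suminf_ennreal2[symmetric]) (use trapezoid_defect_nonneg trapezoid_defect_sums \<alpha> in auto)
  also have "\<dots> = ennreal c * (\<Sum>n. \<integral>\<^sup>+u. ennreal (indicator {0<..} u * (E u * exp (- u) ^ n)) \<partial>lborel)"
    unfolding ennreal_trapezoid_defect[OF \<alpha>] c_def E_def by (rule ennreal_suminf_cmult)
  also have "(\<Sum>n. \<integral>\<^sup>+u. ennreal (indicator {0<..} u * (E u * exp (- u) ^ n)) \<partial>lborel) =
      (\<integral>\<^sup>+u. (\<Sum>n. ennreal (indicator {0<..} u * (E u * exp (- u) ^ n))) \<partial>lborel)"
    unfolding E_def by (rule nn_integral_suminf[symmetric]) measurable
  also have "\<dots> = (\<integral>\<^sup>+u. (\<Sum>k. ennreal (indicator {0<..} u * (2 * (u powr (- \<alpha>) / (u ^ 2 + w k ^ 2))))) \<partial>lborel)"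
  proof (rule nn_integral_cong)
    fix u :: real
    show "(\<Sum>n. ennreal (indicator {0<..} u * (E u * exp (- u) ^ n))) =
       (\<Sum>k. ennreal (indicator {0<..} u * (2 * (u powr (- \<alpha>) / (u ^ 2 + w k ^ 2)))))"
    proof (cases "u > 0")
      case True
      have q: "1 - exp (- u) > 0" using True by simp
      have cs: "(\<lambda>k. u powr (- 1 - \<alpha>) * (2 * u / (u ^ 2 + w k ^ 2))) sums
          (u powr (- 1 - \<alpha>) * ((1 + exp (- u)) / (2 * (1 - exp (- u))) - 1 / u))"
        unfolding w_def by (intro sums_mult coth_partial_fractions True)
      have e1: "u powr (- 1 - \<alpha>) * (2 * u / (u ^ 2 + w k ^ 2)) = 2 * (u powr (- \<alpha>) / (u ^ 2 + w k ^ 2))" for k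
      proof -
        have "u * u powr (- 1 - \<alpha>) = u powr (- \<alpha>)" using True by (simp add: powr_mult_base)
        then show ?thesis by (simp add: mult_ac)
      qed
      have e2: "u powr (- 1 - \<alpha>) * ((1 + exp (- u)) / (2 * (1 - exp (- u))) - 1 / u) = E u * (1 / (1 - exp (- u)))"
        using q True by (simp add: E_def field_simps)
      have cs: "(\<lambda>k. 2 * (u powr (- \<alpha>) / (u ^ 2 + w k ^ 2))) sums (E u * (1 / (1 - exp (- u))))"
        using cs unfolding e1 e2 .
      have pos: "2 * (u powr (- \<alpha>) / (u ^ 2 + w k ^ 2)) \<ge> 0" for k by simp
      \<comment> \<open>The sign of \<open>E u\<close> is read off from the partial fraction series,
        whose terms are nonnegative.\<close>
      have E0: "E u \<ge> 0"
      proof (rule ccontr)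
        assume "\<not> E u \<ge> 0"
        then have "E u * (1 / (1 - exp (- u))) < 0" using q by (intro mult_neg_pos) auto
        then show False using sums_le[OF pos sums_zero cs] by linarith
      qed
      have gs: "(\<lambda>n. E u * exp (- u) ^ n) sums (E u * (1 / (1 - exp (- u))))"
        by (intro sums_mult geometric_sums) (use True in auto)
      have "(\<Sum>n. ennreal (E u * exp (- u) ^ n)) = ennreal (E u * (1 / (1 - exp (- u))))"
        using gs E0 by (subst suminf_ennreal2) (auto simp: sums_iff)
      also have "\<dots> = (\<Sum>k. ennreal (2 * (u powr (- \<alpha>) / (u ^ 2 + w k ^ 2))))"
        using cs pos by (subst suminf_ennreal2) (auto simp: sums_iff)
      finally show ?thesis using True by simp
    qed simp
  qed
  also have "\<dots> = (\<Sum>k. \<integral>\<^sup>+u. ennreal (indicator {0<..} u * (2 * (u powr (- \<alpha>) / (u ^ 2 + w k ^ 2)))) \<partial>lborel)"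
    by (rule nn_integral_suminf) measurable
  also have "\<dots> = (\<Sum>k. ennreal (2 * B * (2 * pi) powr (- 1 - \<alpha>)) * ennreal (real (Suc k) powr (- 1 - \<alpha>)))"
  proof (rule suminf_cong)
    fix k
    have "(\<integral>\<^sup>+u. ennreal (indicator {0<..} u * (2 * (u powr (- \<alpha>) / (u ^ 2 + w k ^ 2)))) \<partial>lborel) =
      (\<integral>\<^sup>+u. ennreal 2 * ennreal (indicator {0<..} u * (u powr (- \<alpha>) / (u ^ 2 + w k ^ 2))) \<partial>lborel)"
      by (intro nn_integral_cong) (simp only: ennreal_mult'[symmetric] zero_le_numeral mult.left_commute)
    also have "\<dots> = ennreal 2 * ennreal (w k powr (- 1 - \<alpha>) * B)"
      by (subst nn_integral_cmult, simp, subst nn_integral_powr_div_square_plus_square[OF \<alpha> w0], unfold B_def, rule refl)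
    also have "\<dots> = ennreal (2 * B * w k powr (- 1 - \<alpha>))"
      by (subst ennreal_mult'[symmetric]) (auto simp: mult_ac)
    also have "w k powr (- 1 - \<alpha>) = (2 * pi) powr (- 1 - \<alpha>) * real (Suc k) powr (- 1 - \<alpha>)"
      unfolding w_def by (rule powr_mult)
    finally show "(\<integral>\<^sup>+u. ennreal (indicator {0<..} u * (2 * (u powr (- \<alpha>) / (u ^ 2 + w k ^ 2)))) \<partial>lborel) =
       ennreal (2 * B * (2 * pi) powr (- 1 - \<alpha>)) * ennreal (real (Suc k) powr (- 1 - \<alpha>))"
      using B0 by (simp add: ennreal_mult'[symmetric] mult_ac)
  qed
  also have "\<dots> = ennreal (2 * B * (2 * pi) powr (- 1 - \<alpha>)) * ennreal Z"
    unfolding Z_def using sZ by (subst ennreal_suminf_cmult, subst suminf_ennreal2) auto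
  also have "ennreal c * \<dots> = ennreal (c * (2 * B * (2 * pi) powr (- 1 - \<alpha>) * Z))"
    using c0 B0 Z0 by (simp add: ennreal_mult')
  finally have "(\<Sum>n. trapezoid_defect \<alpha> n) = c * (2 * B * (2 * pi) powr (- 1 - \<alpha>) * Z)"
    using c0 B0 Z0 suminf_nonneg[OF trapezoid_defect_sums(1)[OF \<alpha>] trapezoid_defect_nonneg[OF \<alpha>]]
    by (subst (asm) ennreal_inj) auto
  then have "zeta (of_real (- \<alpha>)) = - of_real (c * (2 * B * (2 * pi) powr (- 1 - \<alpha>) * Z))"
    using trapezoid_defect_sums(2)[OF \<alpha>] by simp
  moreover have "zeta (of_real (1 + \<alpha>)) = of_real Z"
  proof -
    have "(\<lambda>k. complex_of_real (real (Suc k) powr (- 1 - \<alpha>))) sums of_real Z"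
      unfolding Z_def by (intro sums_of_real summable_sums sZ)
    moreover have "complex_of_real (real (Suc k) powr (- 1 - \<alpha>)) = 1 / of_nat (Suc k) powr of_real (1 + \<alpha>)" for k
    proof -
      have "complex_of_real (real (Suc k) powr (- (1 + \<alpha>))) = of_real (real (Suc k)) powr of_real (- (1 + \<alpha>))"
        by (rule powr_of_real[symmetric]) simp
      also have "\<dots> = 1 / of_real (real (Suc k)) powr of_real (1 + \<alpha>)"
        by (simp only: of_real_minus powr_minus inverse_eq_divide)
      finally show ?thesis by simp
    qed
    ultimately show ?thesis
      using zeta_sums[of "of_real (1 + \<alpha>)"] \<alpha> sums_unique2 by auto
  qed
  ultimately show ?thesis by (simp add: c_def B_def mult_ac)
qed

text \<open>Both sides are holomorphic off 0 and 1, because \<open>rGamma\<close> is entire and the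
  cosine stands as a factor. They agree on the segment (-1, 0) by \<open>zeta_neg_real\<close>, so
  the identity theorem applies. At 0 and 1 one of the two zeta values is only the convention at the
  pole.\<close>

theorem zeta_functional_equation:
  assumes s: "s \<noteq> 0" "s \<noteq> 1"
  shows "2 * cos (of_real pi * s / 2) * zeta s = of_real (2 * pi) powr s * rGamma s * zeta (1 - s)"
proof -
  define S where "S = - {0, 1 :: complex}"
  define U where "U = complex_of_real ` {-1<..<0}"
  define f where "f s = 2 * cos (of_real pi * s / 2) * zeta s - of_real (2 * pi) powr s * rGamma s * zeta (1 - s)" for s
  have "f s = 0"
  proof (rule analytic_continuation[of f S U "of_real (- 1 / 2)" s])
    have z1: "zeta holomorphic_on S"
      by (rule holomorphic_on_subset[OF holomorphic_zeta]) (auto simp: S_def)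
    have z2: "(\<lambda>s. zeta (1 - s)) holomorphic_on S"
      by (intro holomorphic_on_compose_gen[OF _ holomorphic_zeta, unfolded o_def] holomorphic_intros)
         (auto simp: S_def)
    show "f holomorphic_on S"
      unfolding f_def by (intro holomorphic_intros z1 z2) auto
    show "open S" unfolding S_def by (intro open_Compl finite_imp_closed) auto
    show "connected S"
      unfolding S_def Compl_eq_Diff_UNIV by (rule connected_open_delete_finite) auto
    show "U \<subseteq> S" by (auto simp: U_def S_def)
    show "of_real (- 1 / 2) \<in> S" by (simp add: S_def complex_eq_iff)
    show "s \<in> S" using s by (simp add: S_def)
    show "of_real (- 1 / 2) islimpt U"
      unfolding islimpt_approachable
    proof (intro allI impI)
      fix e :: real assume e: "e > 0"
      define x where "x = - 1 / 2 + min (e / 2) (1 / 4)"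
      have x: "x \<in> {-1<..<0}" "x \<noteq> - 1 / 2" "\<bar>x - (- 1 / 2)\<bar> < e" using e by (auto simp: x_def min_def)
      have "dist (complex_of_real x) (of_real (- 1 / 2)) < e"
        using x(3) unfolding dist_norm of_real_diff[symmetric] norm_of_real .
      then show "\<exists>x'\<in>U. x' \<noteq> of_real (- 1 / 2) \<and> dist x' (of_real (- 1 / 2)) < e"
        using x(1,2) unfolding U_def by (intro bexI[of _ "of_real x"]) (auto simp only: of_real_eq_iff)
    qed
    show "f z = 0" if zU: "z \<in> U" for z
    proof -
      obtain \<alpha> where \<alpha>: "z = of_real (- \<alpha>)" "0 < \<alpha>" "\<alpha> < 1"
      proof -
        obtain x where "z = of_real x" "- 1 < x" "x < 0" using zU unfolding U_def by auto
        then show thesis by (intro that[of "- x"]) auto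
      qed
      define c where "c = cos (pi * \<alpha> / 2)"
      have c: "c > 0" unfolding c_def by (rule cos_gt_zero) (use \<alpha> in auto)
      have G: "Gamma (1 - \<alpha>) > 0" by (rule Gamma_real_pos) (use \<alpha> in auto)
      have cz: "cos (of_real pi * z / 2) = of_real c"
      proof -
        have "of_real pi * z / 2 = of_real (- (pi * \<alpha> / 2))" by (simp add: \<alpha>(1))
        then show ?thesis by (simp only: cos_of_real cos_minus c_def)
      qed
      have rG: "rGamma z = of_real (- \<alpha> / Gamma (1 - \<alpha>))"
      proof -
        \<comment> \<open>The recurrence moves the negative argument to \<open>1 - \<alpha>\<close>,
          where the real Gamma function is positive.\<close>
        have "rGamma z = z * rGamma (z + 1)" by (rule rGamma_plus1[symmetric])
        also have "z + 1 = of_real (1 - \<alpha>)" by (simp add: \<alpha>(1))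
        also have "rGamma (of_real (1 - \<alpha>)) = complex_of_real (rGamma (1 - \<alpha>))" by (rule rGamma_complex_of_real)
        finally show ?thesis by (simp add: \<alpha>(1) rGamma_inverse_Gamma divide_inverse)
      qed
      have pw: "of_real (2 * pi) powr z = of_real ((2 * pi) powr (- \<alpha>))"
        unfolding \<alpha>(1) by (rule powr_of_real) simp
      have z1: "1 - z = of_real (1 + \<alpha>)" by (simp add: \<alpha>(1))
      have "2 * cos (of_real pi * z / 2) * zeta z = of_real (2 * c * - (\<alpha> / Gamma (1 - \<alpha>) * (2 * pi) powr (- 1 - \<alpha>) * (pi / c))) * zeta (1 - z)"
        unfolding cz z1 unfolding \<alpha>(1) zeta_neg_real[OF \<alpha>(2,3)] by (simp add: c_def)
      also have "2 * c * - (\<alpha> / Gamma (1 - \<alpha>) * (2 * pi) powr (- 1 - \<alpha>) * (pi / c)) =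
          (2 * pi) powr (- \<alpha>) * (- \<alpha> / Gamma (1 - \<alpha>))"
      proof -
        have "(2 * pi) powr (- \<alpha>) = (2 * pi) * (2 * pi) powr (- 1 - \<alpha>)" by (simp add: powr_mult_base)
        then show ?thesis using c G by (simp add: field_simps)
      qed
      finally show ?thesis unfolding f_def pw rG by simp
    qed
  qed
  then show ?thesis by (simp add: f_def)
qed

text \<open>At \<open>w = 1 - s\<close> the functional equation has right side 0 while
  \<open>zeta w\<close> is nonzero, so the cosine vanishes and \<open>w\<close> is an odd integer.
  \<open>Re w > 1 / 2\<close> and \<open>w \<noteq> 1\<close> leave only 3, 5, 7 and so on.\<close>

lemma zeta_zero_left_half_plane:
  assumes nz: "\<And>s. Re s > 1 / 2 \<Longrightarrow> s \<noteq> 1 \<Longrightarrow> zeta s \<noteq> 0"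
    and s: "zeta s = 0" "Re s < 1 / 2"
  shows "\<exists>n::nat. s = - 2 * of_nat (Suc n)"
proof -
  have s0: "s \<noteq> 0" using s zeta_0 by auto
  define w where "w = 1 - s"
  have w: "Re w > 1 / 2" "w \<noteq> 1" "w \<noteq> 0" using s s0 by (auto simp: w_def)
  have "2 * cos (of_real pi * w / 2) * zeta w = 0"
    using zeta_functional_equation[OF w(3,2)] s by (simp add: w_def)
  then have "cos (of_real pi * w / 2) = 0" using nz[OF w(1,2)] by simp
  then obtain n :: int where "of_real pi * w / 2 = of_real (of_int n * pi) + of_real pi / 2"
    by (auto simp: Complex_Transcendental.cos_eq_0)
  then have "of_real pi * (w / 2) = of_real pi * (of_int n + 1 / 2)" by (simp add: algebra_simps)
  then have "w / 2 = of_int n + 1 / 2" by (subst (asm) mult_cancel_left) simp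
  then have wn: "w = 2 * of_int n + 1" by (simp add: field_simps)
  then have "Re w = 2 * of_int n + 1" by simp
  with w(1) have "n \<ge> 0" by linarith
  moreover have "n \<noteq> 0" using wn w(2) by auto
  ultimately have "n = int (Suc (nat (n - 1)))" by simp
  then have "of_int n = (of_nat (Suc (nat (n - 1))) :: complex)" by (metis of_int_of_nat_eq)
  moreover have "s = - 2 * of_int n" using wn unfolding w_def by algebra
  ultimately show ?thesis by metis
qed

section \<open>The Moebius function\<close>

lemma abs_summable_on_product_dominated:
  fixes f :: "nat \<times> nat \<Rightarrow> complex" and a b :: "nat \<Rightarrow> real"
  assumes "summable a" "summable b" and le: "\<And>m n. norm (f (m, n)) \<le> a m * b n"
    and nn: "\<And>m. a m \<ge> 0" "\<And>n. b n \<ge> 0"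
  shows "(\<lambda>x. norm (f x)) summable_on UNIV"
proof -
  have "(\<lambda>(m, n). a m * b n) summable_on (Sigma UNIV (\<lambda>_. UNIV))"
  proof (rule summable_on_SigmaI)
    fix m
    have "(\<lambda>n. a m * b n) sums (a m * (\<Sum>n. b n))"
      by (intro sums_mult summable_sums assms)
    then have "((\<lambda>n. a m * b n) has_sum (a m * (\<Sum>n. b n))) UNIV"
      by (rule sums_nonneg_imp_has_sum) (simp add: nn)
    then show "((\<lambda>n. case (m, n) of (m, n) \<Rightarrow> a m * b n) has_sum (a m * (\<Sum>n. b n))) UNIV" by simp
  next
    have "0 \<le> (\<Sum>n. b n)" by (intro suminf_nonneg assms)
    then show "(\<lambda>m. a m * (\<Sum>n. b n)) summable_on UNIV"
      using assms(1) by (subst summable_on_UNIV_nonneg_real_iff) (auto intro: summable_mult2 simp: nn)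
  qed (auto simp: nn)
  then have *: "(\<lambda>(m, n). a m * b n) summable_on UNIV" by simp
  show ?thesis
    by (rule summable_on_comparison_test[OF *]) (auto simp: le)
qed

text \<open>Domination by a product makes the family summable over all pairs; summing by rows and by
  columns both give that total, which must therefore be \<open>S\<close>.\<close>

lemma sums_swap_dominated:
  fixes f :: "nat \<Rightarrow> nat \<Rightarrow> complex" and a b :: "nat \<Rightarrow> real"
  assumes "summable a" "summable b" and le: "\<And>m n. norm (f m n) \<le> a m * b n"
    and nn: "\<And>m. a m \<ge> 0" "\<And>n. b n \<ge> 0"
    and rows: "\<And>m. f m sums r m" and cols: "\<And>n. (\<lambda>m. f m n) sums c n" and "c sums S"
  shows "r sums S"
proof -
  define g where "g = (\<lambda>(m, n). f m n)"
  have abs: "(\<lambda>x. norm (g x)) summable_on UNIV"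
    by (rule abs_summable_on_product_dominated[OF assms(1,2)]) (auto simp: g_def le nn)
  then obtain T where T: "(g has_sum T) UNIV"
    using abs_summable_summable summable_on_def by blast
  have row: "(f m has_sum r m) UNIV" for m
  proof (rule norm_summable_imp_has_sum[OF _ rows])
    show "summable (\<lambda>n. norm (f m n))"
      by (rule summable_comparison_test'[OF summable_mult[OF assms(2), of "a m"]]) (simp add: le)
  qed
  have col: "((\<lambda>m. f m n) has_sum c n) UNIV" for n
  proof (rule norm_summable_imp_has_sum[OF _ cols])
    show "summable (\<lambda>m. norm (f m n))"
      by (rule summable_comparison_test'[OF summable_mult2[OF assms(1), of "b n"]]) (simp add: le)
  qed
  have "(r has_sum T) UNIV"
    by (rule has_sum_SigmaD[where f = g and S = T and A = UNIV and B = "\<lambda>_. UNIV"]) (use T row in \<open>auto simp: g_def\<close>)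
  moreover have "((\<lambda>(n, m). g (m, n)) has_sum T) (UNIV \<times> UNIV)"
    using T has_sum_swap[where f = g and S = T and A = UNIV and B = UNIV] by simp
  then have "(c has_sum T) UNIV"
    by (rule has_sum_SigmaD) (use col in \<open>auto simp: g_def\<close>)
  ultimately show ?thesis
    using has_sum_imp_sums \<open>c sums S\<close> sums_unique2 by blast
qed

section \<open>Moebius values and the Dirichlet series of the reciprocal zeta function\<close>

definition moebius_mu :: "nat \<Rightarrow> complex" where
  "moebius_mu n = (if squarefree n then (-1) ^ card (prime_factors n) else 0)"

lemma moebius_0 [simp]: "moebius_mu 0 = 0"
  by (simp add: moebius_mu_def)

lemma moebius_1 [simp]: "moebius_mu (Suc 0) = 1"
  by (simp add: moebius_mu_def)

lemma norm_moebius_le: "norm (moebius_mu n) \<le> 1"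
  by (simp add: moebius_mu_def norm_power)

lemma moebius_prime_mult:
  assumes p: "prime p" and d: "\<not> p dvd d"
  shows "moebius_mu (p * d) = - moebius_mu d"
proof -
  have "d \<noteq> 0" "p \<noteq> 0" using p d by (metis dvd_0_right, auto)
  have cop: "coprime p d" using p d by (simp add: prime_imp_coprime)
  have "squarefree (p * d) \<longleftrightarrow> squarefree d"
    using squarefree_mult_coprime[OF cop] squarefree_prime[OF p] squarefree_mono[of d "p * d"] by auto
  moreover have "prime_factors (p * d) = insert p (prime_factors d)"
    using p \<open>d \<noteq> 0\<close> \<open>p \<noteq> 0\<close> by (simp add: prime_factors_product prime_prime_factors)
  moreover have "p \<notin> prime_factors d" using d by (auto simp: prime_factors_dvd)
  ultimately show ?thesis by (simp add: moebius_mu_def)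
qed

text \<open>Fix a prime \<open>p\<close> dividing \<open>n\<close>. Divisors \<open>d\<close> prime
  to \<open>p\<close> pair with \<open>p * d\<close>, which also divides \<open>n\<close> and has
  the opposite sign; every other divisor is divisible by \<open>p ^ 2\<close> and contributes
  0.\<close>

lemma sum_moebius_divisors:
  assumes n: "n > 0"
  shows "(\<Sum>d | d dvd n. moebius_mu d) = (if n = 1 then 1 else 0)"
proof (cases "n = 1")
  case True
  then have "{d. d dvd n} = {1}" by auto
  then show ?thesis using True by (simp add: moebius_mu_def)
next
  case False
  then obtain p where p: "prime p" "p dvd n" using prime_factor_nat by blast
  have fin: "finite {d. d dvd n}" using n by simp
  define D where "D = {d. d dvd n \<and> \<not> p dvd d \<and> p * d dvd n}"
  define E where "E = {d. d dvd n \<and> \<not> p dvd d}"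
  have finE: "finite E" unfolding E_def using finite_subset[OF _ fin] by auto
  have "E = D"
  proof -
    have "p * d dvd n" if "d dvd n" "\<not> p dvd d" for d
      by (rule divides_mult) (use p that in \<open>auto simp: prime_imp_coprime\<close>)
    then show ?thesis by (auto simp: D_def E_def)
  qed
  have "(\<Sum>d | d dvd n. moebius_mu d) = (\<Sum>d\<in>E \<union> (*) p ` E. moebius_mu d)"
  proof (rule sum.mono_neutral_right[OF fin])
    show "E \<union> (*) p ` E \<subseteq> {d. d dvd n}" unfolding \<open>E = D\<close> by (auto simp: D_def)
    show "\<forall>d\<in>{d. d dvd n} - (E \<union> (*) p ` E). moebius_mu d = 0"
    proof
      fix d assume d: "d \<in> {d. d dvd n} - (E \<union> (*) p ` E)"
      then have "p dvd d" by (auto simp: E_def)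
      then obtain e where e: "d = p * e" by blast
      then have "e dvd n" using d by auto
      then have "p dvd e" using d e by (auto simp: E_def)
      then have "p ^ 2 dvd d" using e by (auto simp: power2_eq_square)
      then have "\<not> squarefree d" using p not_prime_unit by (auto dest!: squarefreeD)
      then show "moebius_mu d = 0" by (simp add: moebius_mu_def)
    qed
  qed
  also have "\<dots> = (\<Sum>d\<in>E. moebius_mu d) + (\<Sum>d\<in>(*) p ` E. moebius_mu d)"
    by (rule sum.union_disjoint) (use finE in \<open>auto simp: E_def\<close>)
  also have "(\<Sum>d\<in>(*) p ` E. moebius_mu d) = (\<Sum>d\<in>E. moebius_mu (p * d))"
    by (rule sum.reindex_cong[of "(*) p"]) (use p in \<open>auto intro!: inj_onI\<close>)
  also have "\<dots> = (\<Sum>d\<in>E. - moebius_mu d)"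
    by (intro sum.cong moebius_prime_mult p) (auto simp: E_def)
  finally show ?thesis using False by (simp add: sum_negf)
qed

lemma summable_real_powr_neg: "Re s > 1 \<Longrightarrow> summable (\<lambda>n. real n powr (- Re s))"
  by (simp add: summable_real_powr_iff)

lemma norm_nat_powr_le: "norm (of_nat n powr s :: complex) \<le> real n powr Re s"
  by (cases "n = 0") (simp_all add: norm_of_nat_powr)

lemma norm_moebius_powr_le: "norm (moebius_mu n * of_nat n powr (-s)) \<le> real n powr (- Re s)"
  using mult_mono[OF norm_moebius_le norm_nat_powr_le[of n "-s"]] by (simp add: norm_mult)

lemma summable_moebius:
  assumes "Re s > 1"
  shows "summable (\<lambda>n. moebius_mu n * of_nat n powr (-s))"
  by (rule summable_comparison_test'[OF summable_real_powr_neg[OF assms] norm_moebius_powr_le])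

text \<open>The double series over pairs (m, n) is summed in two ways: as a product, and grouped by
  N = m n, where the inner sum over the divisors of N vanishes unless N = 1.\<close>

lemma zeta_mult_moebius:
  assumes s: "Re s > 1"
  shows "zeta s * (\<Sum>n. moebius_mu n * of_nat n powr (-s)) = 1"
proof -
  \<comment> \<open>Since \<open>0 powr (-s) = 0\<close>, index 0 contributes nothing and the series
    may run over all naturals.\<close>
  define z where "z n = (of_nat n powr (-s) :: complex)" for n :: nat
  define u where "u n = moebius_mu n * z n" for n
  define M where "M = (\<Sum>n. u n)"
  define g where "g = (\<lambda>(m, n). z m * u n)"
  have zs: "z sums zeta s"
  proof -
    have "(\<lambda>n. z (Suc n)) sums zeta s"
      using zeta_sums[OF s] unfolding z_def by (simp only: powr_minus inverse_eq_divide)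
    then show ?thesis using sums_Suc_iff[of z "zeta s"] by (simp add: z_def)
  qed
  have us: "u sums M"
    unfolding M_def u_def z_def by (intro summable_sums summable_moebius s)
  have nz: "norm (z n) \<le> real n powr (- Re s)" for n
    using norm_nat_powr_le[of n "-s"] by (simp add: z_def)
  have nu: "norm (u n) \<le> real n powr (- Re s)" for n
    using norm_moebius_powr_le[of n s] by (simp add: z_def u_def)
  have hz: "(z has_sum zeta s) UNIV" "(u has_sum M) UNIV"
    by (rule norm_summable_imp_has_sum[OF _ zs],
        rule summable_comparison_test'[OF summable_real_powr_neg[OF s]], use nz in simp)
       (rule norm_summable_imp_has_sum[OF _ us],
        rule summable_comparison_test'[OF summable_real_powr_neg[OF s]], use nu in simp)
  have "(\<lambda>x. norm (g x)) summable_on UNIV"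
    by (rule abs_summable_on_product_dominated[OF summable_real_powr_neg[OF s] summable_real_powr_neg[OF s]])
       (auto simp: g_def norm_mult intro!: mult_mono nz nu)
  then obtain T where T: "(g has_sum T) UNIV"
    using abs_summable_summable summable_on_def by blast
  have "((\<lambda>m. z m * M) has_sum T) UNIV"
    by (rule has_sum_SigmaD[where f = g and S = T and A = UNIV and B = "\<lambda>_. UNIV"])
       (use T hz in \<open>auto simp: g_def intro!: has_sum_cmult_right\<close>)
  moreover have "((\<lambda>m. z m * M) has_sum (zeta s * M)) UNIV"
    by (rule has_sum_cmult_left) (use hz in auto)
  ultimately have TM: "T = zeta s * M" using has_sum_unique by blast
  define B where "B n = {d. d dvd (n::nat)}" for n
  \<comment> \<open>Zero indices are dropped first: only on positive pairs is (m, n) -> (m n, n) a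
    bijection onto the pairs of a number and one of its divisors.\<close>
  have "(g has_sum T) ({0<..} \<times> {0<..})"
    using T by (subst (asm) has_sum_cong_neutral[where T = "{0<..} \<times> {0<..}" and g = g])
      (auto simp: g_def z_def u_def)
  then have "((\<lambda>(N, d). z N * moebius_mu d) has_sum T) (Sigma {0<..} B)"
  proof (subst (asm) has_sum_reindex_bij_witness[where i = "\<lambda>(N, d). (N div d, d)" and
        j = "\<lambda>(m, n). (m * n, n)" and T = "Sigma {0<..} B" and h = "\<lambda>(N, d). z N * moebius_mu d"])
    fix a :: "nat \<times> nat" assume a: "a \<in> {0<..} \<times> {0<..}"
    show "(\<lambda>(N, d). z N * moebius_mu d) ((\<lambda>(m, n). (m * n, n)) a) = g a"
      by (cases a) (simp add: g_def z_def u_def powr_times_real)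
  qed (auto simp: B_def dvd_imp_le dvd_div_eq_0_iff intro!: Nat.gr0I)
  then have "((\<lambda>N. z N * (\<Sum>d\<in>B N. moebius_mu d)) has_sum T) {0<..}"
    by (rule has_sum_SigmaD) (auto simp: B_def sum_distrib_left intro!: has_sum_finiteI)
  moreover have "((\<lambda>N. z N * (\<Sum>d\<in>B N. moebius_mu d)) has_sum 1) {0<..}"
    by (rule has_sum_finite_neutralI[of "{1}"])
       (auto simp: B_def sum_moebius_divisors z_def)
  ultimately have "T = 1" using has_sum_unique by blast
  then show ?thesis using TM by (simp add: M_def u_def z_def)
qed

lemma zeta_nonzero_Re_gt_1: "Re s > 1 \<Longrightarrow> zeta s \<noteq> 0"
  using zeta_mult_moebius by force

lemma inverse_zeta_sums:
  assumes s: "Re s > 1"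
  shows "(\<lambda>n. moebius_mu n * of_nat n powr (-s)) sums (1 / zeta s)"
proof -
  have "1 / zeta s = (\<Sum>n. moebius_mu n * of_nat n powr (-s))"
    using zeta_mult_moebius[OF s] zeta_nonzero_Re_gt_1[OF s] by (simp add: field_simps)
  then show ?thesis using summable_sums[OF summable_moebius[OF s]] by simp
qed

lemma norm_inverse_zeta_le:
  "\<exists>C>0. \<forall>s. Re s \<ge> 2 \<longrightarrow> norm (1 / zeta s) \<le> C"
proof -
  have sm: "summable (\<lambda>n. real n powr (-2))" by (simp add: summable_real_powr_iff)
  have "norm (1 / zeta s) \<le> (\<Sum>n. real n powr (-2))" if s: "Re s \<ge> 2" for s
  proof -
    have "Re s > 1" using s by simp
    have "norm (moebius_mu n * of_nat n powr (-s)) \<le> real n powr (-2)" for n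
    proof (cases "n = 0")
      case False
      then have "real n powr (- Re s) \<le> real n powr (-2)" using s by (intro powr_mono) auto
      then show ?thesis using norm_moebius_powr_le[of n s] by linarith
    qed auto
    from norm_suminf_le[OF this sm] show ?thesis
      using inverse_zeta_sums[OF \<open>Re s > 1\<close>] by (simp add: sums_iff)
  qed
  moreover have "(\<Sum>n. real n powr (-2)) \<ge> 0" by (intro suminf_nonneg sm) auto
  ultimately show ?thesis
    by (intro exI[of _ "(\<Sum>n. real n powr (-2)) + 1"]) fastforce
qed

section \<open>The Newton series of the reciprocal zeta function\<close>

text \<open>Up to the sign \<open>(-1) ^ k\<close> these are the Newton basis polynomials for the
  nodes 1, 2, 3, ..., and \<open>c_seq k\<close> is the matching signed finite difference of 1 /
  zeta(2w) at those nodes.\<close>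

definition newton_poly :: "nat \<Rightarrow> complex \<Rightarrow> complex" where
  "newton_poly k w = (\<Prod>r=1..k. 1 - w / of_nat r)"

lemma newton_poly_gbinomial: "newton_poly k w = (-1) ^ k * ((w - 1) gchoose k)"
proof (induction k)
  case (Suc k)
  have *: "of_nat (Suc k) * (w - 1 gchoose Suc k) = (w - 1 - of_nat k) * (w - 1 gchoose k)"
    using gbinomial_absorb_comp[of "w - 1" k] gbinomial_absorption[of k "w - 1"] by (simp only:)
  have "newton_poly (Suc k) w = newton_poly k w * (1 - w / of_nat (Suc k))"
    by (simp add: newton_poly_def)
  also have "\<dots> = (-1) ^ Suc k * ((w - 1 - of_nat k) * (w - 1 gchoose k)) / of_nat (Suc k)"
    using of_nat_neq_0[of k, where ?'a = complex] unfolding Suc.IH by (simp add: field_simps)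
  also have "\<dots> = (-1) ^ Suc k * (w - 1 gchoose Suc k)"
    unfolding *[symmetric] using of_nat_neq_0[of k, where ?'a = complex] by (simp del: of_nat_Suc)
  finally show ?case .
qed (simp add: newton_poly_def)

text \<open>Expand the squared modulus and apply 1 + y <= exp y.\<close>

lemma norm_one_minus_le: "norm (1 - x :: complex) \<le> exp (- Re x + norm x ^ 2 / 2)"
proof -
  have "norm (1 - x) ^ 2 = 1 + (- 2 * Re x + norm x ^ 2)"
    unfolding cmod_power2 by (simp add: power2_eq_square algebra_simps)
  also have "\<dots> \<le> exp (- 2 * Re x + norm x ^ 2)" by (rule exp_ge_add_one_self)
  also have "\<dots> = exp (- Re x + norm x ^ 2 / 2) ^ 2"
    by (simp add: exp_double[symmetric] algebra_simps)
  finally show ?thesis by (rule power2_le_imp_le) simp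
qed

lemma sum_inverse_squares_le: "(\<Sum>r=1..k. 1 / real r ^ 2) \<le> 2"
proof -
  \<comment> \<open>The correction term makes the induction work by telescoping; the sum up to
    \<open>Suc k\<close> avoids dividing by 0.\<close>
  have "(\<Sum>r=1..Suc k. 1 / real r ^ 2) \<le> 2 - 1 / real (Suc k)" for k
  proof (induction k)
    case (Suc k)
    have "1 / real (Suc (Suc k)) ^ 2 \<le> 1 / real (Suc k) - 1 / real (Suc (Suc k))"
    proof -
      have "1 / real (Suc k) - 1 / real (Suc (Suc k)) = 1 / (real (Suc k) * real (Suc (Suc k)))"
        by (simp add: field_simps)
      then show ?thesis by (simp add: power2_eq_square frac_le)
    qed
    then show ?case using Suc by simp
  qed simp
  from this[of "k - 1"] show ?thesis by (cases k) (auto intro: order_trans)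
qed

text \<open>Bound each factor by an exponential. The linear terms form a harmonic sum, at least
  \<open>ln (real k + 1)\<close>, which helps because \<open>Re w \<ge> 0\<close>; the quadratic
  terms stay bounded.\<close>

lemma norm_newton_poly_le:
  assumes w: "Re w \<ge> 0"
  shows "norm (newton_poly k w) \<le> exp (norm w ^ 2) * real (k + 1) powr (- Re w)"
proof -
  have "norm (newton_poly k w) = (\<Prod>r=1..k. norm (1 - w / of_nat r))"
    by (simp add: newton_poly_def prod_norm)
  also have "\<dots> \<le> (\<Prod>r=1..k. exp (- Re (w / of_nat r) + norm (w / of_nat r) ^ 2 / 2))"
    by (intro prod_mono conjI norm_one_minus_le) auto
  also have "\<dots> = exp (\<Sum>r=1..k. - Re (w / of_nat r) + norm (w / of_nat r) ^ 2 / 2)"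
    by (rule exp_sum[symmetric]) simp
  also have "(\<Sum>r=1..k. - Re (w / of_nat r) + norm (w / of_nat r) ^ 2 / 2) =
      - Re w * harm k + norm w ^ 2 / 2 * (\<Sum>r=1..k. 1 / real r ^ 2)"
  proof -
    have "- Re (w / of_nat r) + norm (w / of_nat r) ^ 2 / 2 =
        - Re w * inverse (real r) + norm w ^ 2 / 2 * (1 / real r ^ 2)" for r
      by (simp add: norm_divide power_divide inverse_eq_divide)
    then show ?thesis by (simp only: harm_def sum.distrib sum_distrib_left of_nat_id)
  qed
  also have "\<dots> \<le> - Re w * ln (real k + 1) + norm w ^ 2 / 2 * 2"
    using w ln_le_harm[of k] sum_inverse_squares_le[of k]
    by (intro add_mono mult_left_mono mult_left_mono_neg) auto
  also have "exp (- Re w * ln (real k + 1) + norm w ^ 2 / 2 * 2) = exp (norm w ^ 2) * real (k + 1) powr (- Re w)"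
    by (simp add: powr_def mult_exp_exp add_ac)
  finally show ?thesis by simp
qed

text \<open>Insert the Moebius series of each reciprocal zeta value; the finite alternating sum over
  \<open>j\<close> collapses by the binomial theorem.\<close>

lemma c_seq_sums:
  "(\<lambda>n. moebius_mu n * of_nat n powr (-2) * (1 - of_nat n powr (-2)) ^ k) sums c_seq k"
proof -
  have pw: "of_nat n powr (- (2 * of_nat j + 2)) = (of_nat n powr (-2) * (of_nat n powr (-2)) ^ j :: complex)"
    for n j :: nat
  proof (cases "n = 0")
    case False
    have "(of_nat n powr (-2) :: complex) ^ j = of_nat n powr (of_nat j * (-2))"
      using False by (simp only: powr_def exp_of_nat_mult[symmetric] of_nat_eq_0_iff if_False mult.assoc)
    moreover have "- (2 * of_nat j + 2) = -2 + of_nat j * (-2 :: complex)" by simp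
    ultimately show ?thesis by (simp only: powr_add)
  qed simp
  have "(\<lambda>n. \<Sum>j=0..k. (-1) ^ j * of_nat (k choose j) * (moebius_mu n * of_nat n powr (- (2 * of_nat j + 2))))
      sums c_seq k"
    unfolding c_seq_def by (intro sums_sum sums_mult inverse_zeta_sums) simp
  moreover have "(\<Sum>j=0..k. (-1) ^ j * of_nat (k choose j) * (moebius_mu n * of_nat n powr (- (2 * of_nat j + 2))))
     = moebius_mu n * of_nat n powr (-2) * (1 - of_nat n powr (-2)) ^ k" for n
  proof -
    have "(1 - of_nat n powr (-2)) ^ k = (- (of_nat n powr (-2)) + 1 :: complex) ^ k" by simp
    also have "\<dots> = (\<Sum>j\<le>k. of_nat (k choose j) * (- (of_nat n powr (-2))) ^ j * 1 ^ (k - j))"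
      by (rule binomial_ring)
    also have "\<dots> = (\<Sum>j=0..k. of_nat (k choose j) * ((-1) ^ j * (of_nat n powr (-2)) ^ j))"
      by (subst power_minus) (simp add: atMost_atLeast0)
    finally show ?thesis unfolding pw by (simp add: sum_distrib_left mult_ac)
  qed
  ultimately show ?thesis by simp
qed

text \<open>For fixed \<open>n\<close> the sum over \<open>k\<close> is the binomial series of a
  power of \<open>n\<close>, which turns the Moebius series of \<open>c_seq k\<close> into that of
  \<open>1 / zeta (2 * w)\<close>. The exchange is justified because the powers of 1 - 1/n^2 are at
  most 1 and the Newton polynomials decay like \<open>real k powr (- Re w)\<close>, with
  \<open>Re w > 1\<close>.\<close>

lemma newton_series_inverse_zeta:
  assumes w: "Re w > 1"
  shows "(\<lambda>k. c_seq k * newton_poly k w) sums (1 / zeta (2 * w))"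
proof (rule sums_swap_dominated)
  define a where "a k = exp (norm w ^ 2) * real (k + 1) powr (- Re w)" for k
  define b where "b n = real n powr (-2)" for n
  show "summable a" unfolding a_def
    using w summable_iff_shift[of "\<lambda>n. real n powr (- Re w)" 1] summable_real_powr_iff[of "- Re w"]
    by (intro summable_mult) simp
  show "summable b" unfolding b_def by (simp add: summable_real_powr_iff)
  show "a k \<ge> 0" "b n \<ge> 0" for k n by (auto simp: a_def b_def)
  have n2: "(of_nat n powr (-2) :: complex) = of_real (1 / real n ^ 2)" if "n > 0" for n
    using that by (simp add: powr_minus inverse_eq_divide)
  show "norm (moebius_mu n * of_nat n powr (-2) * (1 - of_nat n powr (-2)) ^ k * newton_poly k w) \<le> a k * b n" for k n
  proof (cases "n = 0")
    case False
    have "norm (1 - of_nat n powr (-2) :: complex) = \<bar>1 - 1 / real n ^ 2\<bar>"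
      unfolding n2[OF False[unfolded neq0_conv]] by (metis norm_of_real of_real_1 of_real_diff)
    also have "\<dots> \<le> 1" using False by (simp add: field_simps)
    finally have "norm (1 - of_nat n powr (-2) :: complex) ^ k \<le> 1" by (simp add: power_le_one)
    then have "norm (moebius_mu n * of_nat n powr (-2)) * norm (1 - of_nat n powr (-2) :: complex) ^ k * norm (newton_poly k w)
       \<le> b n * 1 * a k"
      using norm_moebius_powr_le[of n 2] norm_newton_poly_le[of w k] w unfolding a_def b_def
      by (intro mult_mono) auto
    then show ?thesis by (simp add: norm_mult norm_power mult_ac)
  qed (simp add: a_def b_def)
  show "(\<lambda>n. moebius_mu n * of_nat n powr (-2) * (1 - of_nat n powr (-2)) ^ k * newton_poly k w)
      sums (c_seq k * newton_poly k w)" for k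
    by (intro sums_mult2 c_seq_sums)
  show "(\<lambda>n. moebius_mu n * of_nat n powr (- (2 * w))) sums (1 / zeta (2 * w))"
    by (rule inverse_zeta_sums) (use w in simp)
  show "(\<lambda>k. moebius_mu n * of_nat n powr (-2) * (1 - of_nat n powr (-2)) ^ k * newton_poly k w)
      sums (moebius_mu n * of_nat n powr (- (2 * w)))" for n
  proof (cases "n = 0")
    case False
    define x :: real where "x = 1 / real n ^ 2"
    have x: "0 < x" "x \<le> 1" using False by (auto simp: x_def field_simps)
    \<comment> \<open>Here \<open>x\<close> is written as 1 - (1 - x); \<open>0 < x\<close> and
      \<open>x \<le> 1\<close> keep the argument inside the unit disc.\<close>
    have "(\<lambda>k. ((w - 1) gchoose k) * (- of_real (1 - x)) ^ k) sums (1 + - of_real (1 - x)) powr (w - 1)"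
    proof (rule gen_binomial_complex)
      have "norm (- of_real (1 - x) :: complex) = \<bar>1 - x\<bar>" by (metis norm_minus_cancel norm_of_real)
      then show "norm (- of_real (1 - x) :: complex) < 1" using x by simp
    qed
    then have "(\<lambda>k. (1 - of_real x) ^ k * newton_poly k w) sums (of_real x powr (w - 1))"
      unfolding newton_poly_gbinomial by (subst (asm) power_minus) (simp add: mult_ac)
    from sums_mult[OF this, of "moebius_mu n * of_real x"]
    have "(\<lambda>k. moebius_mu n * of_real x * ((1 - of_real x) ^ k * newton_poly k w)) sums
       (moebius_mu n * of_real x * of_real x powr (w - 1))" .
    moreover have "of_real x * of_real x powr (w - 1) = (of_nat n powr (- (2 * w)) :: complex)"
    proof -
      have "of_real x * of_real x powr (w - 1) = (of_real x powr w :: complex)"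
        using x by (simp add: powr_diff)
      also have "\<dots> = exp (w * of_real (ln x))" using x by (simp add: powr_def Ln_of_real)
      also have "ln x = - 2 * ln (real n)" using False by (simp add: x_def ln_div ln_realpow)
      finally show ?thesis using False by (simp add: powr_def mult_ac)
    qed
    moreover have "of_nat n powr (-2) = (of_real x :: complex)"
      using n2[of n] False by (simp add: x_def)
    ultimately show ?thesis by (simp only: mult.assoc)
  qed simp
qed

text \<open>With the assumed decay the Newton series at \<open>s / 2\<close> converges locally
  uniformly for \<open>Re s > 1 / 2\<close>. Its sum \<open>f\<close> is the reciprocal of zeta for
  \<open>Re s > 2\<close>, so \<open>f s * zeta s = 1\<close> continues to the whole region and
  rules out zeros.\<close>

lemma zeta_nonzero_if_c_seq_decay:
  assumes decay: "\<And>\<epsilon>::real. \<epsilon> > 0 \<Longrightarrow>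
      \<exists>C>0. \<forall>k::nat. k \<ge> 1 \<longrightarrow> norm (c_seq k) \<le> C * real k powr (- 3 / 4 + \<epsilon>)"
    and s: "Re s > 1 / 2" "s \<noteq> 1"
  shows "zeta s \<noteq> 0"
proof -
  define f where "f s = (\<Sum>k. c_seq k * newton_poly k (s / 2))" for s
  have hol: "f holomorphic_on {s. Re s > 1 / 2}"
    unfolding f_def[abs_def]
  proof (rule holomorphic_on_suminf)
    show "(\<lambda>s. c_seq n * newton_poly n (s / 2)) holomorphic_on {s. Re s > 1 / 2}" for n
      unfolding newton_poly_def by (intro holomorphic_intros) auto
    fix x assume "x \<in> {s. Re s > 1 / 2}"
    then have x: "Re x > 1 / 2" by simp
    define d where "d = (Re x - 1 / 2) / 2"
    have d: "d > 0" using x by (simp add: d_def)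
    have re: "Re y \<ge> 1 / 2 + d" if "y \<in> cball x d" for y
    proof -
      have "\<bar>Re (x - y)\<bar> \<le> d"
        using that abs_Re_le_cmod[of "x - y"] by (simp add: dist_norm)
      then show ?thesis by (simp add: d_def field_simps abs_if split: if_splits)
    qed
    \<comment> \<open>The choice \<open>d / 4\<close> works because the Newton polynomials
      contribute the exponent \<open>- 1 / 4 - d / 2\<close>, giving the total
      \<open>- 1 - d / 4\<close>.\<close>
    obtain C where C: "C > 0" "\<And>k. k \<ge> 1 \<Longrightarrow> norm (c_seq k) \<le> C * real k powr (- 3 / 4 + d / 4)"
      using decay[of "d / 4"] d by auto
    define B where "B = norm x + d"
    \<comment> \<open>Index 0 is separate: \<open>0 powr\<close> anything is 0, and the decay is
      assumed only from 1 on.\<close>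
    define h where "h k = (if k = 0 then norm (c_seq 0) else C * exp (B ^ 2) * real k powr (- 1 - d / 4))" for k
    have "summable (\<lambda>k. C * exp (B ^ 2) * real k powr (- 1 - d / 4))"
      using d by (intro summable_mult) (simp add: summable_real_powr_iff)
    then have "summable h"
      by (rule summable_cong[THEN iffD1, rotated])
         (auto simp: h_def eventually_sequentially intro!: exI[of _ 1])
    moreover have "norm (c_seq k * newton_poly k (y / 2)) \<le> h k" if y: "y \<in> cball x d" for k y
    proof (cases "k = 0")
      case True
      then show ?thesis by (simp add: h_def newton_poly_def)
    next
      case False
      have rey: "Re y \<ge> 1 / 2 + d" by (rule re[OF y])
      have "norm y \<le> B"
        using y norm_triangle_sub[of y x] by (simp add: B_def dist_norm norm_minus_commute)
      then have "norm (y / 2) ^ 2 \<le> B ^ 2"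
        using order_trans[OF norm_ge_zero, of y B] by (intro power_mono) (auto simp: norm_divide)
      have "norm (newton_poly k (y / 2)) \<le> exp (norm (y / 2) ^ 2) * real (k + 1) powr (- Re (y / 2))"
        by (rule norm_newton_poly_le) (use rey d in auto)
      also have "\<dots> \<le> exp (B ^ 2) * real k powr (- 1 / 4 - d / 2)"
      proof (intro mult_mono)
        have "real (k + 1) powr (- Re (y / 2)) \<le> real (k + 1) powr (- 1 / 4 - d / 2)"
          using rey by (intro powr_mono) auto
        also have "\<dots> \<le> real k powr (- 1 / 4 - d / 2)"
          using False d by (intro powr_mono2') auto
        finally show "real (k + 1) powr (- Re (y / 2)) \<le> real k powr (- 1 / 4 - d / 2)" .
      qed (use \<open>norm (y / 2) ^ 2 \<le> B ^ 2\<close> in auto)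
      finally have "norm (c_seq k * newton_poly k (y / 2)) \<le>
          (C * real k powr (- 3 / 4 + d / 4)) * (exp (B ^ 2) * real k powr (- 1 / 4 - d / 2))"
        unfolding norm_mult using False C by (intro mult_mono) auto
      also have "\<dots> = C * exp (B ^ 2) * (real k powr (- 3 / 4 + d / 4) * real k powr (- 1 / 4 - d / 2))"
        by (simp add: mult_ac)
      also have "real k powr (- 3 / 4 + d / 4) * real k powr (- 1 / 4 - d / 2) = real k powr (- 1 - d / 4)"
        by (subst powr_add[symmetric]) simp
      finally show ?thesis using False by (simp add: h_def)
    qed
    moreover have "cball x d \<subseteq> {s. Re s > 1 / 2}" using re d by fastforce
    ultimately show "\<exists>d>0. cball x d \<subseteq> {s. Re s > 1 / 2} \<and> (\<exists>h. summable h \<and>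
        (\<forall>n. \<forall>y\<in>cball x d. norm (c_seq n * newton_poly n (y / 2)) \<le> h n))"
      using d by blast
  qed (rule open_halfspace_Re_gt)
  have "f s * zeta s = 1"
  proof (rule analytic_continuation_open[of "{s. Re s > 2}" "{s. Re s > 1 / 2} - {1}" "\<lambda>s. f s * zeta s" "\<lambda>_. 1"])
    show "{s. Re s > 2} \<noteq> {}" by (auto intro!: exI[of _ 3])
    show "connected ({s. Re s > 1 / 2} - {1})"
      by (intro connected_open_delete convex_connected convex_halfspace_Re_gt open_halfspace_Re_gt) auto
    show "(\<lambda>s. f s * zeta s) holomorphic_on {s. Re s > 1 / 2} - {1}"
      by (intro holomorphic_intros holomorphic_on_subset[OF holomorphic_zeta] holomorphic_on_subset[OF hol]) auto
    show "f z * zeta z = 1" if "z \<in> {s. Re s > 2}" for z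
      using newton_series_inverse_zeta[of "z / 2"] zeta_nonzero_Re_gt_1[of z] that
      by (auto simp: f_def sums_iff)
      show "open ({s. Re s > 1 / 2} - {1})" by (intro open_delete open_halfspace_Re_gt)
  qed (use s in \<open>auto intro!: open_halfspace_Re_gt\<close>)
  then show ?thesis by auto
qed

section \<open>Growth of the reciprocal zeta function\<close>

text \<open>After rescaling to the unit disc, u -> u / (2A - u) maps the half-plane Re u < A into
  the unit disc and fixes 0. The Schwarz lemma bounds the image, and solving for the modulus of u
  gives the estimate.\<close>

lemma borel_caratheodory:
  assumes hol: "f holomorphic_on ball c R" and r: "r < R"
    and A: "\<And>w. w \<in> ball c R \<Longrightarrow> Re (f w) - Re (f c) < A" and z: "norm (z - c) \<le> r"
  shows "norm (f z - f c) \<le> 2 * A * r / (R - r)"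
proof -
  have r0: "0 \<le> r" using z norm_ge_zero order_trans by blast
  have R: "R > 0" using r0 r by simp
  have A0: "A > 0" using A[of c] R by simp
  define u where "u w = f (c + of_real R * w) - f c" for w
  define g where "g w = u w / (2 * of_real A - u w)" for w
  have inb: "c + of_real R * w \<in> ball c R" if "norm w < 1" for w
    using that R by (simp add: dist_norm norm_mult)
  have reu: "Re (u w) < A" if "norm w < 1" for w
    using A[OF inb[OF that]] by (simp add: u_def)
  have nz: "2 * of_real A - u w \<noteq> 0" if "norm w < 1" for w
  proof
    assume "2 * of_real A - u w = 0"
    then have "Re (u w) = 2 * A" by (simp add: complex_eq_iff)
    then show False using reu[OF that] A0 by simp
  qed
  have lt: "norm (u w) < norm (2 * of_real A - u w)" if "norm w < 1" for w
  proof -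
    \<comment> \<open>The excess over \<open>norm (u w) ^ 2\<close> is positive exactly because
      \<open>Re (u w) < A\<close>.\<close>
    have "norm (2 * of_real A - u w) ^ 2 = norm (u w) ^ 2 + 4 * A * (A - Re (u w))"
      unfolding cmod_power2 by (simp add: power2_eq_square algebra_simps)
    moreover have "4 * A * (A - Re (u w)) > 0" using A0 reu[OF that] by simp
    ultimately have "norm (u w) ^ 2 < norm (2 * of_real A - u w) ^ 2" by linarith
    then show ?thesis by (rule power2_less_imp_less) simp
  qed
  have holu: "u holomorphic_on ball 0 1"
    unfolding u_def
    by (intro holomorphic_intros holomorphic_on_compose_gen[OF _ hol, unfolded o_def])
       (use inb in auto)
  define x where "x = (z - c) / of_real R"
  have nx: "norm x = norm (z - c) / R" using R by (simp add: x_def norm_divide)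
  have x1: "norm x < 1" unfolding nx using z r R by (simp add: field_simps)
  have "norm (g x) \<le> norm x"
  proof (rule Schwarz_Lemma(1)[OF _ _ _ x1])
    show "g holomorphic_on ball 0 1"
      unfolding g_def by (intro holomorphic_intros holu) (use nz in auto)
    show "g 0 = 0" by (simp add: g_def u_def)
    show "norm (g w) < 1" if "norm w < 1" for w
      using lt[OF that] nz[OF that] by (simp add: g_def norm_divide)
  qed
  then have "norm (u x) \<le> norm x * norm (2 * of_real A - u x)"
    using nz[OF x1] by (simp add: g_def norm_divide field_simps)
  also have "\<dots> \<le> norm x * (2 * A + norm (u x))"
    using norm_triangle_ineq4[of "2 * of_real A" "u x"] A0 by (intro mult_left_mono) (simp_all add: norm_mult)
  also have "u x = f z - f c" using R by (simp add: u_def x_def)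
  finally have "norm (f z - f c) * R \<le> norm (z - c) * (2 * A + norm (f z - f c))"
    using R unfolding nx by (simp add: field_simps)
  also have "\<dots> \<le> r * (2 * A + norm (f z - f c))"
    using z A0 by (intro mult_right_mono) auto
  finally have "norm (f z - f c) * (R - r) \<le> 2 * A * r" by (simp add: algebra_simps)
  then show ?thesis using r by (simp add: field_simps)
qed

lemma norm_zeta_reg_poly_bound:
  "\<exists>C>0. \<forall>s. Re s \<ge> 0 \<longrightarrow> norm (zeta_reg s) \<le> C * (1 + norm s) ^ 3"
proof -
  obtain C where C: "C > 0"
    "\<And>s. Re s \<ge> 0 \<Longrightarrow> norm (zeta_reg s - 1) \<le> C * norm (s - 1) * (1 + norm s) ^ 2"
    using norm_zeta_reg_le by blast
  have "norm (zeta_reg s) \<le> (1 + C) * (1 + norm s) ^ 3" if s: "Re s \<ge> 0" for s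
  proof -
    have "norm (zeta_reg s) \<le> 1 + norm (zeta_reg s - 1)"
      using norm_triangle_ineq[of 1 "zeta_reg s - 1"] by simp
    also have "norm (zeta_reg s - 1) \<le> C * norm (s - 1) * (1 + norm s) ^ 2" by (rule C(2)[OF s])
    also have "\<dots> \<le> C * (1 + norm s) * (1 + norm s) ^ 2"
      using C(1) norm_triangle_ineq4[of s 1] by (intro mult_right_mono mult_left_mono) auto
    also have "\<dots> = C * (1 + norm s) ^ 3" by (simp add: power3_eq_cube power2_eq_square)
    also have "1 + C * (1 + norm s) ^ 3 \<le> (1 + norm s) ^ 3 + C * (1 + norm s) ^ 3"
      by (intro add_right_mono one_le_power) simp
    finally show ?thesis by (simp add: algebra_simps)
  qed
  then show ?thesis using C(1) by (intro exI[of _ "1 + C"]) auto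
qed

text \<open>A logarithm \<open>L\<close> of \<open>zeta_reg\<close> exists on the zero-free
  half-plane. On the disc of radius 3/2 around 2 + i Im s, which lies in that half-plane, its real
  part exceeds that at the centre by at most a logarithm of \<open>\<bar>Im s\<bar>\<close>.
  Borel-Caratheodory turns this into a lower bound for \<open>Re (L s)\<close>.\<close>

lemma inverse_zeta_growth:
  assumes nz: "\<And>s. Re s > 1 / 2 \<Longrightarrow> s \<noteq> 1 \<Longrightarrow> zeta s \<noteq> 0" and \<delta>: "\<delta> > 0"
  shows "\<exists>C m. C > 0 \<and> (\<forall>s. Re s \<ge> 1 / 2 + \<delta> \<longrightarrow> norm (1 / zeta s) \<le> C * (1 + \<bar>Im s\<bar>) ^ m)"
proof -
  define H where "H = {s. Re s > 1 / 2}"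
  have "zeta_reg s \<noteq> 0" if "s \<in> H" for s
    using nz[of s] that by (auto simp: H_def zeta_reg_def)
  moreover have "contractible H"
    unfolding H_def by (intro convex_imp_contractible convex_halfspace_Re_gt)
  ultimately obtain L where L: "L holomorphic_on H" "\<And>s. s \<in> H \<Longrightarrow> zeta_reg s = exp (L s)"
    using contractible_imp_holomorphic_log[of zeta_reg H] holomorphic_on_subset[OF holomorphic_zeta_reg]
    by (metis subset_UNIV)
  obtain C0 where C0: "C0 > 0" "\<And>s. Re s \<ge> 0 \<Longrightarrow> norm (zeta_reg s) \<le> C0 * (1 + norm s) ^ 3"
    using norm_zeta_reg_poly_bound by blast
  obtain C1 where C1: "C1 > 0" "\<And>s. Re s \<ge> 2 \<Longrightarrow> norm (1 / zeta s) \<le> C1"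
    using norm_inverse_zeta_le by blast
  \<comment> \<open>\<open>125 = 5 ^ 3\<close>, from \<open>1 + norm w \<le> 5 * (1 + \<bar>Im s\<bar>)\<close> on the discs of radius 3/2 around \<open>2 + i Im s\<close>.\<close>
  define K where "K = C1 * C0 * 125 + 1"
  have K: "K > 1" using C0 C1 by (simp add: K_def)
  \<comment> \<open>With radii 3/2 and 3/2 - \<delta>, Borel-Caratheodory costs a factor at most
    3/\<delta>; applied to the cubic bound it gives the exponent 9/\<delta>. One more power pays for
    the factor \<open>s - 1\<close>.\<close>
  define m where "m = Suc (nat \<lceil>9 / \<delta>\<rceil>)"
  define C where "C = C1 * K powr (3 / \<delta>) + C1"
  have "norm (1 / zeta s) \<le> C * (1 + \<bar>Im s\<bar>) ^ m" if s: "Re s \<ge> 1 / 2 + \<delta>" for s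
  \<comment> \<open>At \<open>s = 1\<close> the convention \<open>zeta 1 = 0\<close> gives
    \<open>1 / zeta 1 = 0\<close>; for \<open>Re s \<ge> 2\<close> the constant \<open>C1\<close>
    suffices.\<close>
  proof (cases "Re s \<ge> 2 \<or> s = 1")
    case True
    then have "norm (1 / zeta s) \<le> C1 * 1" using C1 by auto
    also have "\<dots> \<le> C1 * (1 + \<bar>Im s\<bar>) ^ m" using C1 by (intro mult_left_mono one_le_power) auto
    also have "\<dots> \<le> C * (1 + \<bar>Im s\<bar>) ^ m"
      using C1 by (intro mult_right_mono) (auto simp: C_def)
    finally show ?thesis .
  next
    case False
    define y where "y = 1 + \<bar>Im s\<bar>"
    have y: "y \<ge> 1" by (simp add: y_def)
    define c where "c = Complex 2 (Im s)"
    define M where "M = ln (K * y ^ 3)"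
    have ball: "w \<in> H" "1 + norm w \<le> 5 * y" if "w \<in> ball c (3 / 2)" for w
    proof -
      have d: "norm (c - w) < 3 / 2" using that by (simp add: dist_norm)
      then have "\<bar>Re (c - w)\<bar> < 3 / 2" using abs_Re_le_cmod[of "c - w"] by linarith
      then have "\<bar>2 - Re w\<bar> < 3 / 2" by (simp add: c_def)
      then have "Re w > 1 / 2" by linarith
      then show "w \<in> H" by (simp add: H_def)
      have "norm c \<le> 2 + \<bar>Im s\<bar>" using cmod_le[of c] by (simp add: c_def)
      then show "1 + norm w \<le> 5 * y"
        using d norm_triangle_ineq4[of c "c - w"] y by (simp add: y_def)
    qed
    have cH: "c \<in> H" by (simp add: c_def H_def)
    have sH: "s \<in> H" using s \<delta> by (simp add: H_def)
    have zc: "1 / C1 \<le> norm (zeta_reg c)"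
    proof -
      have "c \<noteq> 1" by (simp add: c_def complex_eq_iff)
      then have "norm (zeta_reg c) = norm (c - 1) * norm (zeta c)" by (simp add: zeta_reg_def norm_mult)
      moreover have "norm (c - 1) \<ge> 1" using abs_Re_le_cmod[of "c - 1"] by (simp add: c_def)
      moreover have "norm (zeta c) \<ge> 1 / C1"
        using C1(2)[of c] C1(1) nz[of c] \<open>c \<noteq> 1\<close> by (simp add: c_def norm_divide field_simps)
      ultimately show ?thesis
        using mult_mono[of 1 "norm (c - 1)" "1 / C1" "norm (zeta c)"] C1(1) by simp
    qed
    have ReL: "Re (L w) = ln (norm (zeta_reg w))" if "w \<in> H" for w
      using L(2)[OF that] by simp
    have pos: "norm (zeta_reg w) > 0" if "w \<in> H" for w
      using L(2)[OF that] by simp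
    have "norm (L s - L c) \<le> 2 * M * (3 / 2 - \<delta>) / (3 / 2 - (3 / 2 - \<delta>))"
    proof (rule borel_caratheodory[of L c "3 / 2"])
      show "L holomorphic_on ball c (3 / 2)"
        by (rule holomorphic_on_subset[OF L(1)]) (use ball in auto)
      have "s - c = of_real (Re s - 2)" by (simp add: c_def complex_eq_iff)
      then have "norm (s - c) = \<bar>Re s - 2\<bar>" by (metis norm_of_real)
      then show "norm (s - c) \<le> 3 / 2 - \<delta>" using False s by simp
      fix w assume w: "w \<in> ball c (3 / 2)"
      have "norm (zeta_reg w) \<le> C0 * (1 + norm w) ^ 3"
        by (rule C0(2)) (use ball(1)[OF w] in \<open>simp add: H_def\<close>)
      also have "\<dots> \<le> C0 * (5 * y) ^ 3"
        using C0 ball(2)[OF w] by (intro mult_left_mono power_mono) auto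
      finally have "norm (zeta_reg w) * C1 \<le> C0 * (5 * y) ^ 3 * C1"
        using C1 by (intro mult_right_mono) auto
      also have "\<dots> < K * y ^ 3" using y by (simp add: K_def power_mult_distrib algebra_simps)
      finally have "norm (zeta_reg w) * C1 < K * y ^ 3" .
      moreover have "norm (zeta_reg w) / norm (zeta_reg c) \<le> norm (zeta_reg w) * C1"
        using zc C1 pos[OF cH] pos[OF ball(1)[OF w]] by (simp add: field_simps)
      ultimately have "norm (zeta_reg w) / norm (zeta_reg c) < K * y ^ 3" by linarith
      then have "ln (norm (zeta_reg w) / norm (zeta_reg c)) < M"
        unfolding M_def using pos[OF cH] pos[OF ball(1)[OF w]] K y by (subst ln_less_cancel_iff) auto
      then show "Re (L w) - Re (L c) < M"
        using pos[OF cH] pos[OF ball(1)[OF w]] by (simp add: ReL ball(1)[OF w] cH ln_div)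
    qed (use \<delta> in auto)
    also have "\<dots> \<le> 3 / \<delta> * M"
    proof -
      have "1 \<le> K * y ^ 3" using K one_le_power[OF y, of 3] mult_mono[of 1 K 1 "y ^ 3"] by simp
      then have "M \<ge> 0" by (simp add: M_def)
      then show ?thesis using \<delta> by (simp add: field_simps)
    qed
    finally have "Re (L c) - Re (L s) \<le> 3 / \<delta> * M"
      using abs_Re_le_cmod[of "L s - L c"] by simp
    have "norm (1 / zeta_reg s) = exp (- Re (L c)) * exp (Re (L c) - Re (L s))"
      by (simp add: L(2)[OF sH] norm_divide mult_exp_exp exp_minus field_simps)
    also have "\<dots> \<le> C1 * exp (3 / \<delta> * M)"
    proof (intro mult_mono)
      have "exp (- Re (L c)) = 1 / norm (zeta_reg c)"
        by (simp add: L(2)[OF cH] exp_minus field_simps)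
      also have "\<dots> \<le> C1" using zc C1 pos[OF cH] by (simp add: field_simps)
      finally show "exp (- Re (L c)) \<le> C1" .
    qed (use \<open>Re (L c) - Re (L s) \<le> 3 / \<delta> * M\<close> C1 in auto)
    also have "exp (3 / \<delta> * M) = (K * y ^ 3) powr (3 / \<delta>)"
      using K y by (simp add: M_def powr_def)
    also have "\<dots> = K powr (3 / \<delta>) * y powr (9 / \<delta>)"
      using K y by (simp add: powr_mult powr_powr flip: powr_numeral)
    also have "y powr (9 / \<delta>) \<le> y ^ nat \<lceil>9 / \<delta>\<rceil>"
    proof -
      have "y powr (9 / \<delta>) \<le> y powr (real (nat \<lceil>9 / \<delta>\<rceil>))"
        using y by (intro powr_mono real_nat_ceiling_ge) auto
      then show ?thesis using y by (simp add: powr_realpow)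
    qed
    finally have *: "norm (1 / zeta_reg s) \<le> C1 * (K powr (3 / \<delta>) * y ^ nat \<lceil>9 / \<delta>\<rceil>)"
      using C1 by (simp add: mult_left_mono)
    have "1 / zeta s = (s - 1) * (1 / zeta_reg s)" using False by (simp add: zeta_reg_def)
    then have "norm (1 / zeta s) = norm (s - 1) * norm (1 / zeta_reg s)" by (simp only: norm_mult)
    also have "\<dots> \<le> y * (C1 * (K powr (3 / \<delta>) * y ^ nat \<lceil>9 / \<delta>\<rceil>))"
    proof (intro mult_mono *)
      show "norm (s - 1) \<le> y"
      proof -
        have "Re s < 2" using False by auto
        then have "\<bar>Re (s - 1)\<bar> \<le> 1" using s \<delta> by simp
        then show ?thesis using cmod_le[of "s - 1"] by (simp add: y_def)
      qed
    qed (use y in auto)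
    also have "\<dots> = C1 * K powr (3 / \<delta>) * y ^ m" by (simp add: m_def)
    also have "\<dots> \<le> C * y ^ m" using C1 y by (intro mult_right_mono) (auto simp: C_def)
    finally show ?thesis by (simp add: y_def)
  qed
  moreover have "C > 0" using C1 K by (simp add: C_def add_pos_pos)
  ultimately show ?thesis by blast
qed

text \<open>The pole at 1 becomes a zero of the reciprocal, and division by zero assigns precisely
  this value 0 to \<open>1 / zeta 1\<close>.\<close>

lemma holomorphic_inverse_zeta:
  assumes nz: "\<And>s. Re s > 1 / 2 \<Longrightarrow> s \<noteq> 1 \<Longrightarrow> zeta s \<noteq> 0"
  shows "(\<lambda>s. 1 / zeta s) holomorphic_on {s. Re s > 1 / 2}"
proof (rule holomorphic_transform)
  show "(\<lambda>s. (s - 1) / zeta_reg s) holomorphic_on {s. Re s > 1 / 2}"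
    by (intro holomorphic_intros holomorphic_on_subset[OF holomorphic_zeta_reg])
       (use nz in \<open>auto simp: zeta_reg_def\<close>)
qed (auto simp: zeta_reg_def)

section \<open>Noerlund--Rice integrals\<close>

text \<open>Pascal's rule: a finite difference of order k + 1 is the difference of two of order
  k.\<close>

lemma alternating_binomial_sum_Suc:
  fixes g :: "nat \<Rightarrow> 'a :: comm_ring_1"
  shows "(\<Sum>j\<le>Suc k. (-1) ^ j * of_nat (Suc k choose j) * g j) =
    (\<Sum>j\<le>k. (-1) ^ j * of_nat (k choose j) * g j) - (\<Sum>j\<le>k. (-1) ^ j * of_nat (k choose j) * g (Suc j))"
proof -
  have "(\<Sum>j\<le>Suc k. (-1) ^ j * of_nat (Suc k choose j) * g j) =
     g 0 + (\<Sum>j\<le>k. (-1) ^ Suc j * of_nat (k choose Suc j) * g (Suc j))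
      - (\<Sum>j\<le>k. (-1) ^ j * of_nat (k choose j) * g (Suc j))"
    by (simp add: sum.atMost_Suc_shift sum_subtractf[symmetric] sum.distrib[symmetric] algebra_simps
        del: sum.atMost_Suc)
  also have "g 0 + (\<Sum>j\<le>k. (-1) ^ Suc j * of_nat (k choose Suc j) * g (Suc j)) =
     (\<Sum>j\<le>Suc k. (-1) ^ j * of_nat (k choose j) * g j)"
    by (subst sum.atMost_Suc_shift) simp
  also have "\<dots> = (\<Sum>j\<le>k. (-1) ^ j * of_nat (k choose j) * g j)" by (simp add: binomial_eq_0)
  finally show ?thesis .
qed

text \<open>Induction through the difference recursion; the shifted sum is the induction hypothesis
  at \<open>z - 1\<close>. The binomial weights are thus the residues of the kernel.\<close>

lemma partial_fractions_falling_factorial: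
  fixes z :: complex
  assumes "\<And>j. j \<le> k \<Longrightarrow> z \<noteq> of_nat j"
  shows "(\<Sum>j\<le>k. (-1) ^ j * of_nat (k choose j) * (1 / (z - of_nat j))) =
    (-1) ^ k * fact k / (\<Prod>j\<le>k. z - of_nat j)"
  using assms
proof (induction k arbitrary: z)
  case (Suc k)
  define p where "p = (\<Prod>j\<le>k. z - 1 - of_nat j)"
  have shift: "z - of_nat (Suc j) = z - 1 - of_nat j" for j by simp
  have nz: "z - 1 \<noteq> of_nat j" if "j \<le> k" for j
    using Suc.prems[of "Suc j"] that by (auto simp: algebra_simps)
  have "p \<noteq> 0" unfolding p_def using nz by auto
  have z0: "z \<noteq> 0" "z - of_nat (Suc k) \<noteq> 0" using Suc.prems[of 0] Suc.prems[of "Suc k"] by auto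
  have q: "(\<Prod>j\<le>Suc k. z - of_nat j) = z * p"
    unfolding p_def by (subst prod.atMost_Suc_shift) (simp add: algebra_simps)
  have r: "(\<Prod>j\<le>k. z - of_nat j) * (z - of_nat (Suc k)) = z * p"
    using q by simp
  have "(\<Prod>j\<le>k. z - of_nat j) = z * p / (z - of_nat (Suc k))"
    using r z0(2) by (simp add: nonzero_eq_divide_eq)
  moreover have "(\<Sum>j\<le>k. (-1) ^ j * of_nat (k choose j) * (1 / (z - of_nat j))) =
      (-1) ^ k * fact k / (\<Prod>j\<le>k. z - of_nat j)"
    using Suc.prems by (intro Suc.IH) auto
  moreover have "(\<Sum>j\<le>k. (-1) ^ j * of_nat (k choose j) * (1 / (z - of_nat (Suc j)))) =
      (-1) ^ k * fact k / p"
    unfolding shift p_def by (intro Suc.IH nz)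
  ultimately have "(\<Sum>j\<le>Suc k. (-1) ^ j * of_nat (Suc k choose j) * (1 / (z - of_nat j))) =
     (-1) ^ k * fact k / (z * p / (z - of_nat (Suc k))) - (-1) ^ k * fact k / p"
    unfolding alternating_binomial_sum_Suc by simp
  also have "\<dots> = (-1) ^ k * fact k * ((z - of_nat (Suc k)) - z) / (z * p)"
    using z0 \<open>p \<noteq> 0\<close> by (simp add: divide_simps algebra_simps del: of_nat_Suc)
  also have "\<dots> = (-1) ^ Suc k * fact (Suc k) / (z * p)" by (simp add: algebra_simps)
  finally show ?case unfolding q .
qed simp

text \<open>Multiplied by \<open>real k powr a\<close>, the quotient is Euler's sequence for Gamma,
  which converges and hence is bounded.\<close>

lemma fact_div_pochhammer_le:
  fixes a :: real
  assumes a: "a > 0"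
  shows "\<exists>C>0. \<forall>k\<ge>1. fact k / (\<Prod>j\<le>k. a + real j) \<le> C * real k powr (- a)"
proof -
  have "convergent (Gamma_series a)"
    using Gamma_series_LIMSEQ convergent_def by blast
  then obtain C where C: "C > 0" "\<And>k. norm (Gamma_series a k) \<le> C"
    using convergent_imp_Bseq BseqE by metis
  have "fact k / (\<Prod>j\<le>k. a + real j) \<le> C * real k powr (- a)" if k: "k \<ge> 1" for k
  proof -
    have "(\<Prod>j\<le>k. a + real j) = pochhammer a (k + 1)"
      by (simp add: pochhammer_prod atLeast0LessThan lessThan_Suc_atMost del: prod.atMost_Suc)
    then have "fact k / (\<Prod>j\<le>k. a + real j) * real k powr a = Gamma_series a k"
      using k by (simp add: Gamma_series_def powr_def)
    then have "fact k / (\<Prod>j\<le>k. a + real j) * real k powr a \<le> C"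
      using C(2)[of k] by simp
    then show ?thesis using k by (simp add: powr_minus field_simps)
  qed
  then show ?thesis using C(1) by blast
qed

text \<open>The left side of the Noerlund--Rice contour. The quotient of consecutive factors gains a
  power of \<open>\<bar>t\<bar>\<close> for each of the first \<open>m\<close> factors, uniformly in \<open>k\<close>.\<close>

lemma norm_prod_shifted_ge:
  fixes a t :: real
  assumes a: "0 < a" "a \<le> 1" and k: "m \<le> Suc k"
  shows "(\<Prod>j\<le>k. a + real j) * (1 + \<bar>t\<bar>) ^ m \<le>
     (2 * (real m + 1)) ^ m * norm (\<Prod>j\<le>k. Complex (- a) t - of_nat j)"
proof -
  define D where "D j = norm (Complex (- a) t - of_nat j)" for j
  have D1: "a + real j \<le> D j" for j
    using abs_Re_le_cmod[of "Complex (- a) t - of_nat j"] a by (simp add: D_def)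
  have D2: "\<bar>t\<bar> \<le> D j" for j
    using abs_Im_le_cmod[of "Complex (- a) t - of_nat j"] by (simp add: D_def)
  have D0: "0 \<le> D j" for j by (simp add: D_def)
  \<comment> \<open>Both \<open>a + real j\<close> and \<open>\<bar>t\<bar>\<close> are at most
    \<open>D j\<close>; \<open>j < m\<close> and \<open>a \<le> 1\<close> give
    \<open>a + real j + 1 \<le> real m + 1\<close>.\<close>
  have small: "(a + real j) * (1 + \<bar>t\<bar>) \<le> 2 * (real m + 1) * D j" if "j < m" for j
  proof -
    have "(a + real j) * (1 + \<bar>t\<bar>) \<le> (a + real j + 1) * (a + real j + \<bar>t\<bar>)"
      using a by (simp add: algebra_simps)
    also have "\<dots> \<le> (real m + 1) * (2 * D j)"
      using D1[of j] D2[of j] that a by (intro mult_mono) auto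
    finally show ?thesis by (simp add: mult_ac)
  qed
  have split: "{..k} = {..<m} \<union> {m..k}" "{..<m} \<inter> {m..k} = {}" using k by auto
  have "(\<Prod>j\<le>k. a + real j) * (1 + \<bar>t\<bar>) ^ m =
      (\<Prod>j<m. (a + real j) * (1 + \<bar>t\<bar>)) * (\<Prod>j=m..k. a + real j)"
    unfolding split(1) by (subst prod.union_disjoint) (auto simp: prod.distrib mult_ac)
  also have "\<dots> \<le> (\<Prod>j<m. 2 * (real m + 1) * D j) * (\<Prod>j=m..k. D j)"
    using a small D1 D0
    by (intro mult_mono prod_mono) (auto intro!: prod_nonneg mult_nonneg_nonneg)
  also have "\<dots> = (2 * (real m + 1)) ^ m * (\<Prod>j\<le>k. D j)"
    unfolding split(1) by (subst prod.union_disjoint) (auto simp: prod.distrib mult_ac)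
  also have "(\<Prod>j\<le>k. D j) = norm (\<Prod>j\<le>k. Complex (- a) t - of_nat j)"
    by (simp add: D_def prod_norm)
  finally show ?thesis .
qed

text \<open>Split the kernel into partial fractions and apply Cauchy's formula to each;
  \<open>T > real k\<close> and \<open>0 < a\<close> put all nodes 0, ..., k inside the
  rectangle.\<close>

lemma rice_contour_integral:
  fixes f :: "complex \<Rightarrow> complex"
  assumes hol: "f holomorphic_on {z. Re z > - b}" and ab: "0 < a" "a < b" and T: "T > real k"
  shows "((\<lambda>z. f z * ((-1) ^ k * fact k / (\<Prod>j\<le>k. z - of_nat j))) has_contour_integral
      2 * pi * \<i> * (\<Sum>j\<le>k. (-1) ^ j * of_nat (k choose j) * f (of_nat j)))
      (rectpath (Complex (- a) (- T)) (Complex T T))"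
proof -
  define \<gamma> where "\<gamma> = rectpath (Complex (- a) (- T)) (Complex T T)"
  have T0: "T > 0" using T by simp
  have inbox: "of_nat j \<in> box (Complex (- a) (- T)) (Complex T T)" if "j \<le> k" for j
    using that T ab by (auto simp: in_box_complex_iff)
  have img: "path_image \<gamma> = cbox (Complex (- a) (- T)) (Complex T T) - box (Complex (- a) (- T)) (Complex T T)"
    unfolding \<gamma>_def by (rule path_image_rectpath_cbox_minus_box) (use ab T0 in auto)
  have sub: "path_image \<gamma> \<subseteq> {z. Re z > - b}"
    unfolding img using ab by (auto simp: in_cbox_complex_iff)
  have nin: "of_nat j \<notin> path_image \<gamma>" if "j \<le> k" for j
    unfolding img using inbox[OF that] by auto
  have "((\<lambda>z. f z / (z - of_nat j)) has_contour_integral (2 * pi * \<i> * f (of_nat j))) \<gamma>" if "j \<le> k" for j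
  proof -
    have "((\<lambda>z. f z / (z - of_nat j)) has_contour_integral
       (2 * pi * \<i> * winding_number \<gamma> (of_nat j) * f (of_nat j))) \<gamma>"
    proof (rule Cauchy_integral_formula_convex_simple[OF _ hol])
      have "open {z. Re z > - b}" by (rule open_halfspace_Re_gt)
      then show "of_nat j \<in> interior {z. Re z > - b}" using ab by (simp add: interior_open)
      show "path_image \<gamma> \<subseteq> {z. - b < Re z} - {of_nat j}" using sub nin[OF that] by auto
    qed (auto simp: \<gamma>_def convex_halfspace_Re_gt)
    moreover have "winding_number \<gamma> (of_nat j) = 1"
      unfolding \<gamma>_def by (rule winding_number_rectpath[OF inbox[OF that]])
    ultimately show ?thesis by simp
  qed
  then have "((\<lambda>z. \<Sum>j\<le>k. (-1) ^ j * of_nat (k choose j) * (f z / (z - of_nat j))) has_contour_integral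
      (\<Sum>j\<le>k. (-1) ^ j * of_nat (k choose j) * (2 * pi * \<i> * f (of_nat j)))) \<gamma>"
    by (intro has_contour_integral_sum has_contour_integral_lmul) auto
  moreover have "(\<Sum>j\<le>k. (-1) ^ j * of_nat (k choose j) * (f z / (z - of_nat j))) =
     f z * ((-1) ^ k * fact k / (\<Prod>j\<le>k. z - of_nat j))" if "z \<in> path_image \<gamma>" for z
    using that nin
    by (subst partial_fractions_falling_factorial[symmetric]) (auto simp: sum_distrib_left mult_ac)
  ultimately have "((\<lambda>z. f z * ((-1) ^ k * fact k / (\<Prod>j\<le>k. z - of_nat j))) has_contour_integral
      (\<Sum>j\<le>k. (-1) ^ j * of_nat (k choose j) * (2 * pi * \<i> * f (of_nat j)))) \<gamma>"
    by (rule has_contour_integral_eq)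
  then show ?thesis by (simp add: \<gamma>_def sum_distrib_left mult_ac)
qed

lemma has_integral_inverse_one_plus_square:
  assumes T: "T > 0"
  shows "((\<lambda>t::real. 1 / (1 + t ^ 2)) has_integral (arctan T - arctan (- T))) {- T..T}"
  by (rule fundamental_theorem_of_calculus)
     (use T in \<open>auto intro!: derivative_eq_intros simp: divide_inverse simp flip: has_real_derivative_iff_has_vector_derivative\<close>)

text \<open>As the rectangle grows, the three far sides contribute O(1/T) and only the line
  \<open>Re z = - a\<close> remains. There the kernel supplies both the decay in \<open>k\<close>
  and enough decay in \<open>t\<close> to absorb the growth of \<open>f\<close>.\<close>

lemma rice_bound:
  fixes f :: "complex \<Rightarrow> complex"
  assumes hol: "f holomorphic_on {z. Re z > - b}" and a: "0 < a" "a \<le> 1" "a < b"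
    and C: "\<And>z. Re z \<ge> - a \<Longrightarrow> norm (f z) \<le> C * (1 + \<bar>Im z\<bar>) ^ m"
  shows "\<exists>K>0. \<forall>k\<ge>m + 2. norm (\<Sum>j\<le>k. (-1) ^ j * of_nat (k choose j) * f (of_nat j)) \<le> K * real k powr (- a)"
proof -
  have C0: "C \<ge> 0" using C[of 0] a by (auto intro: order_trans[OF norm_ge_zero])
  obtain G where G: "G > 0" "\<And>k. k \<ge> 1 \<Longrightarrow> fact k / (\<Prod>j\<le>k. a + real j) \<le> G * real k powr (- a)"
    using fact_div_pochhammer_le[OF a(1)] by blast
  \<comment> \<open>The three factors come from the growth of \<open>f\<close>, from
    \<open>norm_prod_shifted_ge\<close> with exponent \<open>m + 2\<close>, and from the Gamma
    quotient.\<close>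
  define Q where "Q = C * (2 * (real (m + 2) + 1)) ^ (m + 2) * G"
  have Q0: "Q \<ge> 0" using C0 G by (simp add: Q_def)
  have "norm (\<Sum>j\<le>k. (-1) ^ j * of_nat (k choose j) * f (of_nat j)) \<le> (Q + 1) * real k powr (- a)"
    if k: "k \<ge> m + 2" for k
  proof -
    define S where "S = (\<Sum>j\<le>k. (-1) ^ j * of_nat (k choose j) * f (of_nat j))"
    define F where "F z = f z * ((-1) ^ k * fact k / (\<Prod>j\<le>k. z - of_nat j))" for z
    \<comment> \<open>6 T bounds the total length of the three sides away from the line \<open>Re z = - a\<close>.\<close>
    define E where "E = C * 2 ^ m * fact k * 2 ^ Suc k * 6"
    \<comment> \<open>\<open>T \<ge> 2 * real k\<close> keeps the far sides at distance at least
      \<open>T / 2\<close> from every node.\<close>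
    have main: "2 * pi * norm S \<le> Q * real k powr (- a) * pi + E / T" if T: "T \<ge> 2 * real k" for T
    proof -
      have T1: "T \<ge> 1" "T > real k" using T k by auto
      define z1 where "z1 = Complex (- a) (- T)"
      define z2 where "z2 = Complex T (- T)"
      define z3 where "z3 = Complex T T"
      define z4 where "z4 = Complex (- a) T"
      have rect: "rectpath z1 z3 = linepath z1 z2 +++ linepath z2 z3 +++ linepath z3 z4 +++ linepath z4 z1"
        by (simp add: rectpath_def Let_def z1_def z2_def z3_def z4_def)
      have I: "(F has_contour_integral 2 * pi * \<i> * S) (rectpath z1 z3)"
        unfolding F_def S_def z1_def z3_def by (rule rice_contour_integral[OF hol]) (use a T1 in auto)
      then have int: "F contour_integrable_on (rectpath z1 z3)"
        by (auto simp: contour_integrable_on_def)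
      then have ints: "F contour_integrable_on linepath z1 z2" "F contour_integrable_on linepath z2 z3"
         "F contour_integrable_on linepath z3 z4" "F contour_integrable_on linepath z4 z1"
        unfolding rect by simp_all
      have "2 * pi * \<i> * S = contour_integral (rectpath z1 z3) F"
        using contour_integral_unique[OF I] by simp
      also have "\<dots> = contour_integral (linepath z1 z2) F + (contour_integral (linepath z2 z3) F +
           (contour_integral (linepath z3 z4) F + contour_integral (linepath z4 z1) F))"
        unfolding rect using ints by simp
      finally have "norm (2 * pi * \<i> * S) \<le> norm (contour_integral (linepath z1 z2) F) +
          (norm (contour_integral (linepath z2 z3) F) + (norm (contour_integral (linepath z3 z4) F) +
           norm (contour_integral (linepath z4 z1) F)))"
        by (simp only: norm_triangle_mono order_refl)
      then have "2 * pi * norm S \<le> norm (contour_integral (linepath z1 z2) F) +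
          (norm (contour_integral (linepath z2 z3) F) + (norm (contour_integral (linepath z3 z4) F) +
           norm (contour_integral (linepath z4 z1) F)))"
        by (simp add: norm_mult)
      moreover have far: "norm (F z) \<le> E / (6 * T ^ 2)"
        if z: "Re z \<ge> - a" "\<bar>Im z\<bar> \<le> T" "\<bar>Im z\<bar> = T \<or> Re z = T" for z
      proof -
        have dist: "T / 2 \<le> norm (z - of_nat j)" if "j \<le> k" for j
          using z(3)
        proof
          assume "\<bar>Im z\<bar> = T"
          then show ?thesis using abs_Im_le_cmod[of "z - of_nat j"] T1 by simp
        next
          assume "Re z = T"
          then show ?thesis using abs_Re_le_cmod[of "z - of_nat j"] T that by simp
        qed
        have "(T / 2) ^ Suc k = (\<Prod>j\<le>k. T / 2)" by simp
        also have "\<dots> \<le> (\<Prod>j\<le>k. norm (z - of_nat j))"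
          by (rule prod_mono) (use dist T1 in auto)
        finally have prod: "(T / 2) ^ Suc k \<le> norm (\<Prod>j\<le>k. z - of_nat j)" by (simp add: prod_norm)
        have "norm (f z) \<le> C * (1 + \<bar>Im z\<bar>) ^ m" by (rule C[OF z(1)])
        also have "\<dots> \<le> C * (2 * T) ^ m"
          using z T1 C0 by (intro mult_left_mono power_mono) auto
        finally have fz: "norm (f z) \<le> C * (2 * T) ^ m" .
        have "norm (F z) = norm (f z) * (fact k / norm (\<Prod>j\<le>k. z - of_nat j))"
          by (simp add: F_def norm_mult norm_divide norm_power)
        also have "\<dots> \<le> C * (2 * T) ^ m * (fact k / (T / 2) ^ Suc k)"
        proof (intro mult_mono fz divide_left_mono prod)
          have "(T / 2) ^ Suc k > 0" using T1 by simp
          then show "0 < norm (\<Prod>j\<le>k. z - of_nat j) * (T / 2) ^ Suc k"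
            using prod by (intro mult_pos_pos) linarith+
        qed (use T1 C0 in auto)
        also have "\<dots> = C * 2 ^ m * fact k * 2 ^ Suc k * (T ^ m / T ^ Suc k)"
          by (simp add: power_mult_distrib power_divide)
        also have "\<dots> \<le> C * 2 ^ m * fact k * 2 ^ Suc k * (1 / T ^ 2)"
        proof (rule mult_left_mono)
          \<comment> \<open>The lower bound on \<open>k\<close> supplies enough factors in the
            denominator to leave 1/T^2.\<close>
          have "T ^ (m + 2) \<le> T ^ Suc k" using T1 k by (intro power_increasing) auto
          then show "T ^ m / T ^ Suc k \<le> 1 / T ^ 2"
            using T1 by (simp add: field_simps power_add power2_eq_square)
        qed (use C0 in simp)
        also have "\<dots> = E / (6 * T ^ 2)" by (simp add: E_def)
        finally show ?thesis .
      qed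
      moreover have "norm (contour_integral (linepath z1 z2) F) \<le> E / (6 * T ^ 2) * norm (z2 - z1)"
      proof (rule contour_integral_bound_linepath[OF ints(1)])
        fix z assume "z \<in> closed_segment z1 z2"
        then show "norm (F z) \<le> E / (6 * T ^ 2)"
          using T1 a by (intro far)
            (auto simp: z1_def z2_def closed_segment_same_Im closed_segment_eq_real_ivl split: if_splits)
      qed (use C0 in \<open>simp add: E_def\<close>)
      moreover have "norm (contour_integral (linepath z2 z3) F) \<le> E / (6 * T ^ 2) * norm (z3 - z2)"
      proof (rule contour_integral_bound_linepath[OF ints(2)])
        fix z assume "z \<in> closed_segment z2 z3"
        then show "norm (F z) \<le> E / (6 * T ^ 2)"
          using T1 a by (intro far)
            (auto simp: z2_def z3_def closed_segment_same_Re closed_segment_eq_real_ivl split: if_splits)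
      qed (use C0 in \<open>simp add: E_def\<close>)
      moreover have "norm (contour_integral (linepath z3 z4) F) \<le> E / (6 * T ^ 2) * norm (z4 - z3)"
      proof (rule contour_integral_bound_linepath[OF ints(3)])
        fix z assume "z \<in> closed_segment z3 z4"
        then show "norm (F z) \<le> E / (6 * T ^ 2)"
          using T1 a by (intro far)
            (auto simp: z3_def z4_def closed_segment_same_Im closed_segment_eq_real_ivl split: if_splits)
      qed (use C0 in \<open>simp add: E_def\<close>)
      moreover have "E / (6 * T ^ 2) * norm (z2 - z1) + (E / (6 * T ^ 2) * norm (z3 - z2) +
          E / (6 * T ^ 2) * norm (z4 - z3)) \<le> E / T"
      proof -
        have "norm (z2 - z1) \<le> 2 * T" "norm (z3 - z2) \<le> 2 * T" "norm (z4 - z3) \<le> 2 * T"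
          using a T1 cmod_le[of "z2 - z1"] cmod_le[of "z3 - z2"] cmod_le[of "z4 - z3"]
          by (auto simp: z1_def z2_def z3_def z4_def)
        then have "E / (6 * T ^ 2) * norm (z2 - z1) + (E / (6 * T ^ 2) * norm (z3 - z2) +
          E / (6 * T ^ 2) * norm (z4 - z3)) \<le> E / (6 * T ^ 2) * (2 * T) + (E / (6 * T ^ 2) * (2 * T) +
          E / (6 * T ^ 2) * (2 * T))"
          using C0 by (intro add_mono mult_left_mono) (auto simp: E_def)
        also have "\<dots> = E / T" using T1 by (simp add: field_simps power2_eq_square)
        finally show ?thesis .
      qed
      moreover have "norm (contour_integral (linepath z4 z1) F) \<le> Q * real k powr (- a) * pi"
      proof -
        \<comment> \<open>Of the \<open>m + 2\<close> powers gained from the kernel,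
          \<open>m\<close> cancel the growth of \<open>f\<close>; the other two give an integrable
          bound whose integral is less than pi.\<close>
        have left: "norm (F (Complex (- a) t)) \<le> Q * real k powr (- a) * (1 / (1 + t ^ 2))" for t
        proof -
          define P where "P = (\<Prod>j\<le>k. a + real j)"
          define N where "N = norm (\<Prod>j\<le>k. Complex (- a) t - of_nat j)"
          define y where "y = 1 + \<bar>t\<bar>"
          define W where "W = (2 * (real (m + 2) + 1)) ^ (m + 2)"
          have P: "P > 0" using a unfolding P_def by (intro prod_pos) auto
          have y: "y \<ge> 1" by (simp add: y_def)
          have "W > 0" by (simp add: W_def)
          have QW: "Q = C * W * G" by (simp add: Q_def W_def)
          have PN: "P * y ^ (m + 2) \<le> W * N"
            unfolding P_def N_def y_def W_def by (rule norm_prod_shifted_ge) (use a k in auto)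
          then have "W * N > 0" using P y by (smt (verit) mult_pos_pos zero_less_power)
          then have N: "N > 0" using \<open>W > 0\<close> by (simp add: zero_less_mult_iff)
          have "norm (F (Complex (- a) t)) = norm (f (Complex (- a) t)) * (fact k / N)"
            by (simp add: F_def N_def norm_mult norm_divide norm_power)
          also have "\<dots> \<le> C * y ^ m * (fact k / N)"
            using C[of "Complex (- a) t"] N by (intro mult_right_mono) (auto simp: y_def)
          also have "fact k / N \<le> fact k * W / (P * y ^ (m + 2))"
            using PN P N y by (simp add: field_simps)
          also have "fact k * W / (P * y ^ (m + 2)) = W * (fact k / P) / y ^ (m + 2)" by simp
          also have "fact k / P \<le> G * real k powr (- a)" unfolding P_def by (rule G(2)) (use k in simp)
          also have "C * y ^ m * (W * (G * real k powr (- a)) / y ^ (m + 2)) = Q * real k powr (- a) * (1 / y ^ 2)"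
            using y by (simp add: QW power_add power2_eq_square)
          also have "1 / y ^ 2 \<le> 1 / (1 + t ^ 2)"
          proof (rule divide_left_mono)
            show "1 + t ^ 2 \<le> y ^ 2" by (simp add: y_def power2_eq_square algebra_simps abs_mult_self_eq)
            show "0 < y ^ 2 * (1 + t ^ 2)" using y by (intro mult_pos_pos) (auto simp: add_pos_nonneg)
          qed simp
          finally show ?thesis using C0 y \<open>W > 0\<close> Q0
            by (simp add: mult_left_mono divide_right_mono)
        qed
        obtain I where I: "(F has_contour_integral I) (linepath z4 z1)"
          using ints(4) by (auto simp: contour_integrable_on_def)
        \<comment> \<open>The side from \<open>z4\<close> to \<open>z1\<close> runs downwards.
          Reversal gives - I, and dz = i dt turns this into i I, of the same norm.\<close>
        have int: "((\<lambda>t. F (Complex (- a) t)) has_integral (\<i> * I)) {- T..T}"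
          using has_contour_integral_reverse_linepath[OF I]
          by (subst (asm) has_contour_integral_linepath_same_Re_iff[where c = "- a" and a = "- T" and b = T])
             (use T1 in \<open>auto simp: z1_def z4_def\<close>)
        have "norm (contour_integral (linepath z4 z1) F) = norm (integral {- T..T} (\<lambda>t. F (Complex (- a) t)))"
          using contour_integral_unique[OF I] integral_unique[OF int] by (simp add: norm_mult)
        moreover have "norm (integral {- T..T} (\<lambda>t. F (Complex (- a) t))) \<le>
            Q * real k powr (- a) * (arctan T - arctan (- T))"
        proof (rule integral_norm_bound_integral[THEN order_trans])
          have hi: "((\<lambda>t. Q * real k powr (- a) * (1 / (1 + t ^ 2))) has_integral
              Q * real k powr (- a) * (arctan T - arctan (- T))) {- T..T}"
            by (intro has_integral_mult_right has_integral_inverse_one_plus_square) (use T1 in auto)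
          then show "(\<lambda>t. Q * real k powr (- a) * (1 / (1 + t ^ 2))) integrable_on {- T..T}"
            by blast
          show "integral {- T..T} (\<lambda>t. Q * real k powr (- a) * (1 / (1 + t ^ 2))) \<le>
             Q * real k powr (- a) * (arctan T - arctan (- T))"
            using integral_unique[OF hi] by simp
          show "(\<lambda>t. F (Complex (- a) t)) integrable_on {- T..T}" using int by blast
        qed (use left in auto)
        moreover have "Q * real k powr (- a) * (arctan T - arctan (- T)) \<le> Q * real k powr (- a) * pi"
          using arctan_ubound[of T] Q0 by (intro mult_left_mono) (auto simp: arctan_minus)
        ultimately show ?thesis by linarith
      qed
      ultimately show ?thesis by linarith
    qed
    \<comment> \<open>For fixed \<open>k\<close> the constant \<open>E\<close> is independent of
      \<open>T\<close>, so it disappears as \<open>T\<close> tends to infinity, however large it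
      is.\<close>
    have "2 * pi * norm S \<le> Q * real k powr (- a) * pi"
    proof (rule tendsto_lowerbound)
      have "((\<lambda>T. Q * real k powr (- a) * pi + E / T) \<longlongrightarrow> Q * real k powr (- a) * pi + 0) at_top"
        by (intro tendsto_add tendsto_const tendsto_divide_0[OF tendsto_const]
            filterlim_at_top_imp_at_infinity filterlim_ident)
      then show "((\<lambda>T. Q * real k powr (- a) * pi + E / T) \<longlongrightarrow> Q * real k powr (- a) * pi) at_top" by simp
      show "\<forall>\<^sub>F T in at_top. 2 * pi * norm S \<le> Q * real k powr (- a) * pi + E / T"
        using eventually_ge_at_top[of "2 * real k"] by eventually_elim (rule main)
    qed auto
    then have "pi * (2 * norm S) \<le> pi * (Q * real k powr (- a))" by (simp add: mult_ac)
    then have "2 * norm S \<le> Q * real k powr (- a)" by simp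
    moreover have "Q * real k powr (- a) \<le> (Q + 1) * real k powr (- a)" by (intro mult_right_mono) auto
    ultimately have "norm S \<le> (Q + 1) * real k powr (- a)" using norm_ge_zero[of S] by linarith
    then show ?thesis by (simp add: S_def)
  qed
  then show ?thesis using Q0 by (intro exI[of _ "Q + 1"]) auto
qed

section \<open>The criterion\<close>

theorem theorem1p1:
  shows "riemann_hypothesis \<longleftrightarrow>
    (\<forall>\<epsilon>::real. \<epsilon> > 0 \<longrightarrow>
      (\<exists>C::real. C > 0 \<and> (\<forall>k::nat. k \<ge> 1 \<longrightarrow> norm (c_seq k) \<le> C * real k powr (- 3 / 4 + \<epsilon>))))"
proof
  assume RH: "riemann_hypothesis"
  have nz: "zeta s \<noteq> 0" if "Re s > 1 / 2" "s \<noteq> 1" for s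
  proof
    assume "zeta s = 0"
    moreover have "s \<noteq> - 2 * of_nat (Suc n)" for n
      using that by auto
    ultimately have "Re s = 1 / 2"
      using RH that(2) unfolding riemann_hypothesis_def by blast
    then show False using that(1) by simp
  qed
  show "\<forall>\<epsilon>::real. \<epsilon> > 0 \<longrightarrow>
      (\<exists>C::real. C > 0 \<and> (\<forall>k::nat. k \<ge> 1 \<longrightarrow> norm (c_seq k) \<le> C * real k powr (- 3 / 4 + \<epsilon>)))"
  proof (intro allI impI)
    fix \<epsilon> :: real assume \<epsilon>: "\<epsilon> > 0"
    \<comment> \<open>The cap keeps \<open>a\<close> positive when \<epsilon> is large; a smaller
      exponent loss only strengthens the bound.\<close>
    define \<eta> where "\<eta> = min \<epsilon> (1 / 4)"
    define a where "a = 3 / 4 - \<eta>"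
    have \<eta>: "0 < \<eta>" "\<eta> \<le> \<epsilon>" "\<eta> \<le> 1 / 4" using \<epsilon> by (auto simp: \<eta>_def)
    have a: "0 < a" "a \<le> 1" "a < 3 / 4" using \<eta> by (auto simp: a_def)
    define f where "f z = 1 / zeta (2 * z + 2)" for z
    \<comment> \<open>The line \<open>Re z = - a\<close> corresponds to
      \<open>Re (2 * z + 2) = 1 / 2 + 2 * \<eta>\<close>, hence the choice
      \<open>2 * \<eta>\<close>.\<close>
    obtain C0 m where C0: "C0 > 0"
      "\<And>s. Re s \<ge> 1 / 2 + 2 * \<eta> \<Longrightarrow> norm (1 / zeta s) \<le> C0 * (1 + \<bar>Im s\<bar>) ^ m"
      using inverse_zeta_growth[OF nz, of "2 * \<eta>"] \<eta> by auto
    have "\<exists>K>0. \<forall>k\<ge>m + 2. norm (\<Sum>j\<le>k. (-1) ^ j * of_nat (k choose j) * f (of_nat j)) \<le> K * real k powr (- a)"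
    proof (rule rice_bound[OF _ a])
      show "f holomorphic_on {z. Re z > - (3 / 4)}"
        unfolding f_def
        by (intro holomorphic_on_compose_gen[OF _ holomorphic_inverse_zeta[OF nz], unfolded o_def] holomorphic_intros)
           auto
      fix z assume z: "Re z \<ge> - a"
      have "norm (f z) \<le> C0 * (1 + \<bar>Im (2 * z + 2)\<bar>) ^ m"
        unfolding f_def by (rule C0(2)) (use z in \<open>simp add: a_def\<close>)
      also have "\<dots> \<le> C0 * (2 * (1 + \<bar>Im z\<bar>)) ^ m"
        using C0(1) by (intro mult_left_mono power_mono) auto
      finally show "norm (f z) \<le> (C0 * 2 ^ m) * (1 + \<bar>Im z\<bar>) ^ m"
        by (simp only: power_mult_distrib mult.assoc)
    qed
    then obtain K where K: "K > 0" "\<And>k. k \<ge> m + 2 \<Longrightarrow> norm (c_seq k) \<le> K * real k powr (- a)"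
      unfolding c_seq_def f_def by (auto simp: atLeast0AtMost)
    define M where "M = (\<Sum>k\<le>m + 2. norm (c_seq k) * real k powr a)"
    have M: "M \<ge> 0" unfolding M_def by (intro sum_nonneg) auto
    have "norm (c_seq k) \<le> (K + M) * real k powr (- 3 / 4 + \<epsilon>)" if k: "k \<ge> 1" for k
    proof -
      have "norm (c_seq k) \<le> (K + M) * real k powr (- a)"
      proof (cases "k \<ge> m + 2")
        case True
        have "K * real k powr (- a) \<le> (K + M) * real k powr (- a)"
          using M by (intro mult_right_mono) auto
        then show ?thesis using K(2)[OF True] by linarith
      next
        case False
        have "norm (c_seq k) * real k powr a \<le> M"
          unfolding M_def by (rule member_le_sum) (use False in auto)
        then have "norm (c_seq k) * real k powr a \<le> K + M" using K by linarith
        then show ?thesis using k by (simp add: powr_minus field_simps)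
      qed
      also have "\<dots> \<le> (K + M) * real k powr (- 3 / 4 + \<epsilon>)"
        using K M k \<eta> by (intro mult_left_mono powr_mono) (auto simp: a_def)
      finally show ?thesis .
    qed
    then show "\<exists>C::real. C > 0 \<and> (\<forall>k::nat. k \<ge> 1 \<longrightarrow> norm (c_seq k) \<le> C * real k powr (- 3 / 4 + \<epsilon>))"
      using K M by (intro exI[of _ "K + M"]) auto
  qed
next
  assume decay: "\<forall>\<epsilon>::real. \<epsilon> > 0 \<longrightarrow>
      (\<exists>C::real. C > 0 \<and> (\<forall>k::nat. k \<ge> 1 \<longrightarrow> norm (c_seq k) \<le> C * real k powr (- 3 / 4 + \<epsilon>)))"
  have nz: "zeta s \<noteq> 0" if "Re s > 1 / 2" "s \<noteq> 1" for s
    by (rule zeta_nonzero_if_c_seq_decay[OF _ that]) (use decay in blast)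
  show "riemann_hypothesis"
    unfolding riemann_hypothesis_def
  proof (intro allI impI, elim conjE)
    fix s :: complex assume s: "s \<noteq> 1" "zeta s = 0" "\<nexists>n::nat. s = - 2 * of_nat (Suc n)"
    have "\<not> Re s > 1 / 2" using nz s by blast
    moreover have "\<not> Re s < 1 / 2" using zeta_zero_left_half_plane[OF nz] s by blast
    ultimately show "Re s = 1 / 2" by linarith
  qed
qed

end
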